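(* Let $n\geq 3$, $m\geq 0$, $s\in\{m+2,\dots,2m+3\}$ be integers, let $\varphi\colon \mathcal O_{\mathbb P^s}^{\oplus n+m}\to\mathcal O_{\mathbb P^s}(1)^{\oplus n}$ be a general morphism of vector bundles, and let $S$, $\psi\colon S\to\mathbb P^{n-1}$, $f\colon\mathbb P^{n-1}\hookrightarrow\mathbb P=\mathbb P(\mathsf{Mat}_{n+m,s+1}(\mathbb C))$ and $N_k\subset\mathbb P$ be as defined in the context. (i) Assume $s=n+m$. Then: (1) $\psi$ is surjective and its generic fibre is a point; (2) $f\circ\psi$ admits $1$-dimensional fibres precisely over $\mathrm{Im}(f)\cap N_{s-1}$. (ii) Assume $s<n+m$. Then: (1) $\psi$ is a closed immersion if and only if $n>2s-2m-3$, in which case the image of the composition $f\circ\psi$ is $\mathrm{Im}(f)\cap N_s\subset\mathbb P$; (2) $f\circ\psi$ admits $1$-dimensional fibres if and only if $n\leq 2s-2m-3$, and such fibres arise precisely over $\mathrm{Im}(f)\cap N_{s-1}$; (3) $f\circ\psi$ admits $2$-dimensional fibres if and only if $n\leq\frac12(3s-3m-7)$, and such fibres arise precisely over $\mathrm{Im}(f)\cap N_{s-2}$.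
   Context: Work over $\mathbb C$. $V_d=\mathbb C^d$ and $\mathbb P^s=\mathbb P(V_{s+1})$ is the space of one-dimensional subspaces. The morphism $\varphi$ is the same as an $n\times(n+m)$ matrix $M$ of linear forms on $V_{s+1}$, with value $M_v\in\mathsf{Mat}_{n,n+m}(\mathbb C)$ at $v\in V_{s+1}$. $S=D_{n-1}(\varphi)\subset\mathbb P^s$ is the first degeneracy locus, where $\mathrm{rank}(M_v)\le n-1$ (defined by the maximal minors); for general $\varphi$ and $s$ in the given range it is smooth of dimension $s-m-1$, and $\mathrm{rank}(M_v)=n-1$ for every $[v]\in S$. For $[v]\in S$, $\alpha_v\in V_n$ is the nonzero vector, unique up to scaling, with $M_v^t\cdot\alpha_v=0$; the morphism $\psi\colon S\to\mathbb P^{n-1}$ is $[v]\mapsto[\alpha_v]$. For $\alpha\in V_n$, let $A_\alpha\in\mathsf{Mat}_{n+m,s+1}(\mathbb C)$ be the matrix of the linear map $V_{s+1}\to V_{n+m}$, $v\mapsto M_v^t\cdot\alpha$; thus $\psi^{-1}([\alpha])=\{[v]\in S : M_v^t\cdot\alpha=0\}$ is the linear subspace of $\mathbb P^s$ defined by $A_\alpha v=0$. The map $f\colon\mathbb P^{n-1}\hookrightarrow\mathbb P=\mathbb P(\mathsf{Mat}_{n+m,s+1}(\mathbb C))$ is the linear immersion $[\alpha]\mapsto[A_\alpha]$. $N_k\subset\mathbb P$ denotes the subvariety of (classes of) matrices of rank at most $k$.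
   Formalization: Fibres of dimension at least k are shown to lie precisely over Im(f)∩N_{s-k}, those of dimension exactly k over Im(f)∩N_{s-k} minus N_{s-k-1}; read literally, the claim fails when Im(f) meets N_{s-k-1} (e.g. n=7, m=4, s=11, k=1). *)

theory Defs
  imports
    "HOL-Analysis.Function_Topology"
    "HOL-Library.Extended_Real"
    "HOL-Library.Poly_Mapping"
    "Jordan_Normal_Form.DL_Rank"
begin

section \<open>Polynomials in several variables\<close>

text \<open>A polynomial with variables indexed by \<open>'i\<close> is a finitely supported map from exponent
  vectors to coefficients, i.e. an element of the monoid algebra provided by Poly_Mapping.\<close>

type_synonym 'i cpoly = "('i \<Rightarrow>\<^sub>0 nat) \<Rightarrow>\<^sub>0 complex"

definition poly_in :: "'i set \<Rightarrow> 'i cpoly set" where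
  "poly_in I = {F. \<forall>a \<in> Poly_Mapping.keys F. Poly_Mapping.keys a \<subseteq> I}"

definition peval :: "'i cpoly \<Rightarrow> ('i \<Rightarrow> complex) \<Rightarrow> complex" where
  "peval F x = (\<Sum>a \<in> Poly_Mapping.keys F. Poly_Mapping.lookup F a *
                  (\<Prod>i \<in> Poly_Mapping.keys a. x i ^ Poly_Mapping.lookup a i))"

text \<open>Homogeneous polynomials of degree \<open>e\<close> in \<open>d\<close> variables; the zero polynomial is included.\<close>

definition forms :: "nat \<Rightarrow> nat \<Rightarrow> nat cpoly set" where
  "forms d e = {F \<in> poly_in {..<d}.
     \<forall>a \<in> Poly_Mapping.keys F. (\<Sum>i \<in> Poly_Mapping.keys a. Poly_Mapping.lookup a i) = e}"

abbreviation form_at :: "nat cpoly \<Rightarrow> complex vec \<Rightarrow> complex" where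
  "form_at F v \<equiv> peval F (vec_index v)"


section \<open>Projective spaces and Zariski topologies\<close>

text \<open>Points of a projective space are one-dimensional subspaces, as sets of vectors or
  matrices. Thus \<open>proj_space d\<close> is the projective space of dimension \<open>d - 1\<close>.\<close>

definition proj_space :: "nat \<Rightarrow> complex vec set set" where
  "proj_space d = {range (\<lambda>c. c \<cdot>\<^sub>v v) | v. v \<in> carrier_vec d \<and> v \<noteq> 0\<^sub>v d}"

definition proj_mat :: "nat \<Rightarrow> nat \<Rightarrow> complex mat set set" where
  "proj_mat r c = {range (\<lambda>t. t \<cdot>\<^sub>m A) | A. A \<in> carrier_mat r c \<and> A \<noteq> 0\<^sub>m r c}"

text \<open>The basic open sets are the complements of hypersurfaces.\<close>

definition zariski :: "nat \<Rightarrow> complex vec set topology" where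
  "zariski d = topology_generated_by
     {{l \<in> proj_space d. \<forall>v \<in> l - {0\<^sub>v d}. form_at F v \<noteq> 0} | F e. F \<in> forms d e}"

definition affine_zariski :: "'i set \<Rightarrow> ('i \<Rightarrow> complex) topology" where
  "affine_zariski I = topology_generated_by
     {{x \<in> I \<rightarrow>\<^sub>E UNIV. peval F x \<noteq> 0} | F. F \<in> poly_in I}"


section \<open>Krull dimension\<close>

definition irreducible_space :: "'a topology \<Rightarrow> bool" where
  "irreducible_space X \<longleftrightarrow> topspace X \<noteq> {} \<and>
     (\<forall>C D. closedin X C \<and> closedin X D \<and> C \<union> D = topspace X \<longrightarrow> C = topspace X \<or> D = topspace X)"

definition irreducible_chain :: "'a topology \<Rightarrow> nat \<Rightarrow> (nat \<Rightarrow> 'a set) \<Rightarrow> bool" where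
  "irreducible_chain X k Z \<longleftrightarrow>
     (\<forall>i\<le>k. closedin X (Z i) \<and> irreducible_space (subtopology X (Z i))) \<and>
     (\<forall>i<k. Z i \<subset> Z (Suc i))"

text \<open>The empty space has dimension \<open>-\<infinity>\<close>.\<close>

definition krull_dim :: "'a topology \<Rightarrow> ereal" where
  "krull_dim X = (SUP k \<in> {k. \<exists>Z. irreducible_chain X k Z}. ereal (real k))"


section \<open>Regular functions and closed immersions\<close>

text \<open>\<open>g\<close> is regular on \<open>U\<close>, a relatively open subset of a subvariety of \<open>proj_space d\<close>: locally
  on \<open>U\<close> it is a quotient of two forms of the same degree.\<close>

definition regular_on :: "nat \<Rightarrow> complex vec set set \<Rightarrow> (complex vec set \<Rightarrow> complex) \<Rightarrow> bool" where
  "regular_on d U g \<longleftrightarrow>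
     (\<forall>p \<in> U. \<exists>W e F G. openin (zariski d) W \<and> p \<in> W \<and> F \<in> forms d e \<and> G \<in> forms d e \<and>
        (\<forall>l \<in> W \<inter> U. \<forall>v \<in> l - {0\<^sub>v d}. form_at G v \<noteq> 0 \<and> g l = form_at F v / form_at G v))"

definition morphism_to_proj ::
    "nat \<Rightarrow> complex vec set set \<Rightarrow> nat \<Rightarrow> (complex vec set \<Rightarrow> complex vec set) \<Rightarrow> bool" where
  "morphism_to_proj a X b \<psi> \<longleftrightarrow>
     continuous_map (subtopology (zariski a) X) (zariski b) \<psi> \<and>
     (\<forall>V h. openin (zariski b) V \<and> regular_on b V h \<longrightarrow>
        regular_on a {p \<in> X. \<psi> p \<in> V} (h \<circ> \<psi>))"

text \<open>A closed immersion of a subvariety \<open>X\<close> of \<open>proj_space a\<close> into \<open>proj_space b\<close>: a morphism that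
  is a homeomorphism onto a closed subset and is surjective on the stalks of the sheaves of
  regular functions.\<close>

definition closed_immersion ::
    "nat \<Rightarrow> complex vec set set \<Rightarrow> nat \<Rightarrow> (complex vec set \<Rightarrow> complex vec set) \<Rightarrow> bool" where
  "closed_immersion a X b \<psi> \<longleftrightarrow>
     morphism_to_proj a X b \<psi> \<and>
     embedding_map (subtopology (zariski a) X) (zariski b) \<psi> \<and>
     closedin (zariski b) (\<psi> ` X) \<and>
     (\<forall>p U g. openin (subtopology (zariski a) X) U \<and> p \<in> U \<and> regular_on a U g \<longrightarrow>
        (\<exists>V h U'. openin (zariski b) V \<and> \<psi> p \<in> V \<and> regular_on b V h \<and>
           openin (subtopology (zariski a) X) U' \<and> p \<in> U' \<and> U' \<subseteq> U \<and>
           (\<forall>q \<in> U'. \<psi> q \<in> V \<and> g q = h (\<psi> q))))"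


section \<open>The degeneracy locus and the associated maps\<close>

text \<open>A morphism from the sum of \<open>n + m\<close> copies of \<open>O\<close> to the sum of \<open>n\<close> copies of \<open>O(1)\<close> on
  projective \<open>s\<close>-space is an \<open>n \<times> (n + m)\<close> matrix of linear forms in \<open>s + 1\<close> variables:
  \<open>\<phi> (i, j, k)\<close> is the coefficient of the \<open>k\<close>-th variable in the \<open>(i, j)\<close> entry.\<close>

type_synonym bundle_map = "nat \<times> nat \<times> nat \<Rightarrow> complex"

definition bundle_map_index :: "nat \<Rightarrow> nat \<Rightarrow> nat \<Rightarrow> (nat \<times> nat \<times> nat) set" where
  "bundle_map_index n m s = {..<n} \<times> {..<n+m} \<times> {..<s+1}"

text \<open>A property holds for general \<open>\<phi>\<close> if it holds on a nonempty (hence dense) Zariski open subset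
  of the affine space of all \<open>\<phi>\<close>.\<close>

definition for_general_morphism :: "nat \<Rightarrow> nat \<Rightarrow> nat \<Rightarrow> (bundle_map \<Rightarrow> bool) \<Rightarrow> bool" where
  "for_general_morphism n m s Q \<longleftrightarrow>
     (\<exists>U. openin (affine_zariski (bundle_map_index n m s)) U \<and> U \<noteq> {} \<and> (\<forall>\<phi> \<in> U. Q \<phi>))"

definition Mv :: "nat \<Rightarrow> nat \<Rightarrow> nat \<Rightarrow> bundle_map \<Rightarrow> complex vec \<Rightarrow> complex mat" where
  "Mv n m s \<phi> v = mat n (n+m) (\<lambda>(i, j). \<Sum>k<s+1. \<phi> (i, j, k) * vec_index v k)"

text \<open>For general \<open>\<phi>\<close> and \<open>s \<le> 2m + 3\<close> the scheme defined by the maximal minors is smooth, hence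
  determined by its set of points, as taken here.\<close>

definition degeneracy_locus :: "nat \<Rightarrow> nat \<Rightarrow> nat \<Rightarrow> bundle_map \<Rightarrow> complex vec set set" where
  "degeneracy_locus n m s \<phi> =
     {p \<in> proj_space (s+1). \<forall>v \<in> p. vec_space.rank n (Mv n m s \<phi> v) \<le> n - 1}"

text \<open>The line spanned by \<open>\<alpha>\<^sub>v\<close>, where \<open>v\<close> spans \<open>p\<close>; meaningful where the rank is exactly \<open>n - 1\<close>.\<close>

definition psi :: "nat \<Rightarrow> nat \<Rightarrow> nat \<Rightarrow> bundle_map \<Rightarrow> complex vec set \<Rightarrow> complex vec set" where
  "psi n m s \<phi> p = (THE l. l \<in> proj_space n \<and>
     (\<forall>v \<in> p. \<forall>\<alpha> \<in> l. transpose_mat (Mv n m s \<phi> v) *\<^sub>v \<alpha> = 0\<^sub>v (n+m)))"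

definition Aalpha :: "nat \<Rightarrow> nat \<Rightarrow> nat \<Rightarrow> bundle_map \<Rightarrow> complex vec \<Rightarrow> complex mat" where
  "Aalpha n m s \<phi> \<alpha> = mat (n+m) (s+1)
     (\<lambda>(j, k). vec_index (transpose_mat (Mv n m s \<phi> (unit_vec (s+1) k)) *\<^sub>v \<alpha>) j)"

definition fmap :: "nat \<Rightarrow> nat \<Rightarrow> nat \<Rightarrow> bundle_map \<Rightarrow> complex vec set \<Rightarrow> complex mat set" where
  "fmap n m s \<phi> l = Aalpha n m s \<phi> ` l"

definition Im_f :: "nat \<Rightarrow> nat \<Rightarrow> nat \<Rightarrow> bundle_map \<Rightarrow> complex mat set set" where
  "Im_f n m s \<phi> = fmap n m s \<phi> ` proj_space n"

definition rank_locus :: "nat \<Rightarrow> nat \<Rightarrow> nat \<Rightarrow> complex mat set set" where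
  "rank_locus r c k = {q \<in> proj_mat r c. \<forall>A \<in> q. vec_space.rank r A \<le> k}"

definition fibre_dim :: "nat \<Rightarrow> nat \<Rightarrow> nat \<Rightarrow> bundle_map \<Rightarrow> complex mat set \<Rightarrow> ereal" where
  "fibre_dim n m s \<phi> q = krull_dim (subtopology (zariski (s+1))
     {p \<in> degeneracy_locus n m s \<phi>. fmap n m s \<phi> (psi n m s \<phi> p) = q})"

definition admits_fibres_of_dim :: "nat \<Rightarrow> nat \<Rightarrow> nat \<Rightarrow> bundle_map \<Rightarrow> nat \<Rightarrow> bool" where
  "admits_fibres_of_dim n m s \<phi> k \<longleftrightarrow>
     (\<exists>q \<in> proj_mat (n+m) (s+1). fibre_dim n m s \<phi> q = ereal (real k))"

text \<open>The \<open>k\<close>-dimensional fibres of \<open>f \<circ> \<psi>\<close> arise precisely over the intersection of \<open>Im f\<close> with the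
  locus \<open>N\<^sub>j\<close> of rank at most \<open>j\<close>. Since \<open>N\<^sub>j\<close> contains \<open>N\<^bsub>j-1\<^esub>\<close>, over which fibres may be larger,
  this means: that intersection is the locus of fibres of dimension at least \<open>k\<close>, and the
  dimension is exactly \<open>k\<close> away from \<open>N\<^bsub>j-1\<^esub>\<close>. For \<open>j = 0\<close> truncated subtraction is harmless, as
  \<open>N\<^sub>0\<close> is empty.\<close>

definition fibres_of_dim_precisely_over ::
    "nat \<Rightarrow> nat \<Rightarrow> nat \<Rightarrow> bundle_map \<Rightarrow> nat \<Rightarrow> nat \<Rightarrow> bool" where
  "fibres_of_dim_precisely_over n m s \<phi> k j \<longleftrightarrow>
     {q \<in> proj_mat (n+m) (s+1). fibre_dim n m s \<phi> q \<ge> ereal (real k)} =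
       Im_f n m s \<phi> \<inter> rank_locus (n+m) (s+1) j \<and>
     {q \<in> proj_mat (n+m) (s+1). fibre_dim n m s \<phi> q = ereal (real k)} =
       Im_f n m s \<phi> \<inter> rank_locus (n+m) (s+1) j - rank_locus (n+m) (s+1) (j - 1)"

end

theory Submission
  imports Defs "HOL-Computational_Algebra.Fundamental_Theorem_Algebra"
begin

text \<open>
  The equations \<open>M\<^sub>v\<^sup>t \<alpha> = 0\<close> are bilinear in \<open>\<alpha>\<close> and \<open>v\<close>. For fixed \<open>v\<close> they describe the kernel of
  \<open>M\<^sub>v\<^sup>t\<close>, for fixed \<open>\<alpha>\<close> the kernel of \<open>A\<^sub>\<alpha>\<close>. Hence the degeneracy locus and the image of \<open>\<psi>\<close> are the
  two projections of one incidence variety, the fibre of \<open>\<psi>\<close> over \<open>[\<alpha>]\<close> is the projective space of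
  \<open>ker A\<^sub>\<alpha>\<close>, of dimension \<open>s - rank A\<^sub>\<alpha>\<close>, and every claim reduces to the question which nullities occur
  in the linear families of matrices \<open>A\<^sub>\<alpha>\<close> and \<open>M\<^sub>v\<^sup>t\<close> when \<open>\<phi>\<close> is general.

  The \<open>p \<times> q\<close> matrices of nullity at least \<open>k\<close> have codimension \<open>k (p + k - q)\<close>. So a general linear
  family of \<open>p \<times> q\<close> matrices with \<open>a\<close> parameters should have a nonzero member of nullity at least \<open>k\<close>
  if and only if \<open>a > k (p + k - q)\<close>. For \<open>A\<^sub>\<alpha>\<close>, where \<open>a = n\<close>, \<open>p = n + m\<close> and \<open>q = s + 1\<close>, this gives
  \<open>n \<le> 2 s - 2 m - 3\<close> for \<open>k = 2\<close> and \<open>2 n \<le> 3 s - 3 m - 7\<close> for \<open>k = 3\<close>. For \<open>M\<^sub>v\<^sup>t\<close> and \<open>k = 2\<close> it gives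
  \<open>s + 1 > 2 (m + 2)\<close>, which is excluded, so that \<open>\<psi>\<close> is well defined.

  The expectation is proved by elimination theory. Nullity at least \<open>k\<close> is the vanishing of minors,
  which are forms in the parameters of the family. If the minors have no common zero, then by the
  Nullstellensatz they generate all forms of some degree, and they continue to do so for nearby
  families: having no nonzero member of nullity at least \<open>k\<close> is a Zariski open condition
  (\<open>bounded_nullity_is_open\<close>). For \<open>a \<le> k (p + k - q)\<close> one explicit family is therefore enough
  (\<open>exists_space_of_bounded_nullity\<close>). For \<open>a = k (p + k - q) + 1\<close>, if some family had no such member,
  a nonzero polynomial would vanish at every family that has one. But a transversal degenerate family
  can be deformed, staying degenerate, with any prescribed velocity, so the lowest homogeneous part
  of that polynomial would be zero (\<open>exists_point_of_nullity\<close>). When there are more parameters one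
  passes to a subfamily, and the first case for \<open>k + 1\<close> shows that the nullity is exactly \<open>k\<close>.

  Two facts about projective varieties complete the argument. The Krull dimension of a projective
  space of dimension \<open>d\<close> is \<open>d\<close>: a chain of irreducible closed subsets yields algebraically independent
  forms, whose number is bounded by counting monomials (\<open>krull_dim_projective\<close>). And if all kernels are
  at most one-dimensional, both \<open>\<psi>\<close> and its inverse are given locally by cofactors, which makes \<open>\<psi>\<close> a
  closed immersion (\<open>kernel_map_locally_by_forms\<close>, \<open>closed_immersion_of_local_inverse\<close>).
\<close>

section \<open>Polynomials as functions\<close>

definition monomial_value :: "('i \<Rightarrow>\<^sub>0 nat) \<Rightarrow> ('i \<Rightarrow> complex) \<Rightarrow> complex" where
  "monomial_value a x = (\<Prod>i \<in> Poly_Mapping.keys a. x i ^ Poly_Mapping.lookup a i)"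

lemma monomial_value_superset:
  assumes "finite A" "Poly_Mapping.keys a \<subseteq> A"
  shows "monomial_value a x = (\<Prod>i\<in>A. x i ^ Poly_Mapping.lookup a i)"
  unfolding monomial_value_def
  by (rule prod.mono_neutral_left) (use assms in \<open>auto simp: in_keys_iff\<close>)

lemma monomial_value_add: "monomial_value (a + b) x = monomial_value a x * monomial_value b x"
proof -
  let ?A = "Poly_Mapping.keys a \<union> Poly_Mapping.keys b"
  have "Poly_Mapping.keys (a + b) \<subseteq> ?A" by (rule keys_add)
  then show ?thesis
    by (simp add: monomial_value_superset[of ?A] lookup_add power_add prod.distrib)
qed

lemma peval_superset:
  assumes "finite A" "Poly_Mapping.keys F \<subseteq> A"
  shows "peval F x = (\<Sum>a\<in>A. Poly_Mapping.lookup F a * monomial_value a x)"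
  unfolding peval_def monomial_value_def
  by (rule sum.mono_neutral_left) (use assms in \<open>auto simp: in_keys_iff\<close>)

lemma peval_add: "peval (F + G) x = peval F x + peval G x"
proof -
  let ?A = "Poly_Mapping.keys F \<union> Poly_Mapping.keys G"
  have "Poly_Mapping.keys (F + G) \<subseteq> ?A" by (rule keys_add)
  then show ?thesis
    by (simp add: peval_superset[of ?A] lookup_add algebra_simps sum.distrib)
qed

lemma peval_zero [simp]: "peval 0 x = 0"
  by (simp add: peval_def)

lemma peval_sum: "peval (\<Sum>i\<in>A. f i) x = (\<Sum>i\<in>A. peval (f i) x)"
  by (induction A rule: infinite_finite_induct) (auto simp: peval_add)

lemma peval_single: "peval (Poly_Mapping.single a c) x = c * monomial_value a x"
  by (simp add: peval_superset[of "{a}"])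

lemma poly_mapping_sum_single:
  fixes a :: "'a \<Rightarrow>\<^sub>0 'b::comm_monoid_add"
  shows "a = (\<Sum>i\<in>Poly_Mapping.keys a. Poly_Mapping.single i (Poly_Mapping.lookup a i))"
  by (rule poly_mapping_eqI) (auto simp: lookup_sum lookup_single when_def in_keys_iff)

lemma peval_mult: "peval (F * G) x = peval F x * peval G x"
proof -
  have "F * G = (\<Sum>a\<in>Poly_Mapping.keys F. \<Sum>b\<in>Poly_Mapping.keys G.
      Poly_Mapping.single (a + b) (Poly_Mapping.lookup F a * Poly_Mapping.lookup G b))"
    unfolding mult_single[symmetric] sum_product[symmetric]
    by (simp only: poly_mapping_sum_single[symmetric])
  then have "peval (F * G) x = (\<Sum>a\<in>Poly_Mapping.keys F. \<Sum>b\<in>Poly_Mapping.keys G.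
      (Poly_Mapping.lookup F a * monomial_value a x) * (Poly_Mapping.lookup G b * monomial_value b x))"
    by (simp add: peval_sum peval_single monomial_value_add mult_ac)
  also have "\<dots> = peval F x * peval G x"
    by (simp add: peval_superset[OF _ order_refl] sum_product)
  finally show ?thesis .
qed

definition const_poly :: "complex \<Rightarrow> 'i cpoly" where
  "const_poly c = Poly_Mapping.single 0 c"

definition var_poly :: "'i \<Rightarrow> 'i cpoly" where
  "var_poly i = Poly_Mapping.single (Poly_Mapping.single i 1) 1"

lemma peval_const [simp]: "peval (const_poly c) x = c"
  by (simp add: const_poly_def peval_single monomial_value_def)

lemma peval_var [simp]: "peval (var_poly i) x = x i"
  by (simp add: var_poly_def peval_single monomial_value_def)

text \<open>Induction over polynomial functions; with it, later arguments never expand a polynomial into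
  monomials.\<close>

lemma peval_closed:
  assumes const: "\<And>c. P (\<lambda>x. c)"
    and var: "\<And>i. i \<in> I \<Longrightarrow> P (\<lambda>x. x i)"
    and add: "\<And>f g. P f \<Longrightarrow> P g \<Longrightarrow> P (\<lambda>x. f x + g x)"
    and mult: "\<And>f g. P f \<Longrightarrow> P g \<Longrightarrow> P (\<lambda>x. f x * g x)"
    and F: "F \<in> poly_in I"
  shows "P (peval F)"
proof -
  have pow: "P (\<lambda>x. x i ^ k)" if "i \<in> I" for i k
  proof (induction k)
    case (Suc k)
    then show ?case using mult[OF var[OF that] Suc] by simp
  qed (auto intro: const)
  have prod: "P (\<lambda>x. \<Prod>i\<in>A. x i ^ g i)" if "finite A" "A \<subseteq> I" for A and g :: "_ \<Rightarrow> nat"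
    using that
  proof (induction A rule: finite_induct)
    case (insert i A)
    then show ?case using mult[OF pow[of i "g i"], of "\<lambda>x. \<Prod>i\<in>A. x i ^ g i"] by simp
  qed (auto intro: const)
  have "P (\<lambda>x. \<Sum>a\<in>A. Poly_Mapping.lookup F a * monomial_value a x)"
    if "finite A" "A \<subseteq> Poly_Mapping.keys F" for A
    using that
  proof (induction A rule: finite_induct)
    case (insert a A)
    have "P (\<lambda>x. Poly_Mapping.lookup F a * monomial_value a x)"
      unfolding monomial_value_def
      by (intro mult const prod) (use insert.prems F in \<open>auto simp: poly_in_def\<close>)
    then show ?case
      using insert add[of "\<lambda>x. Poly_Mapping.lookup F a * monomial_value a x"] by simp
  qed (auto intro: const)
  from this[OF finite_keys order_refl] show ?thesis
    by (simp add: peval_superset[OF finite_keys order_refl, abs_def])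
qed

definition polyfun :: "'i set \<Rightarrow> (('i \<Rightarrow> complex) \<Rightarrow> complex) set" where
  "polyfun I = peval ` poly_in I"

lemma polyfunI: "F \<in> poly_in I \<Longrightarrow> (\<And>x. f x = peval F x) \<Longrightarrow> f \<in> polyfun I"
  by (auto simp: polyfun_def image_iff fun_eq_iff)

lemma polyfun_const [intro]: "(\<lambda>x. c) \<in> polyfun I"
  by (rule polyfunI[of "const_poly c"]) (simp_all add: poly_in_def, simp add: const_poly_def)

lemma polyfun_var [intro]: "i \<in> I \<Longrightarrow> (\<lambda>x. x i) \<in> polyfun I"
  by (rule polyfunI[of "var_poly i"]) (simp_all add: poly_in_def, simp add: var_poly_def)

lemma polyfun_add [intro]:
  assumes "f \<in> polyfun I" "g \<in> polyfun I" shows "(\<lambda>x. f x + g x) \<in> polyfun I"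
proof -
  obtain F G where "F \<in> poly_in I" "G \<in> poly_in I" "f = peval F" "g = peval G"
    using assms by (auto simp: polyfun_def)
  then show ?thesis
    by (intro polyfunI[of "F + G"]) (use keys_add[of F G] in \<open>auto simp: poly_in_def peval_add\<close>)
qed

lemma polyfun_mult [intro]:
  assumes "f \<in> polyfun I" "g \<in> polyfun I" shows "(\<lambda>x. f x * g x) \<in> polyfun I"
proof -
  obtain F G where FG: "F \<in> poly_in I" "G \<in> poly_in I" "f = peval F" "g = peval G"
    using assms by (auto simp: polyfun_def)
  have "F * G \<in> poly_in I"
    unfolding poly_in_def
  proof (intro CollectI ballI subsetI)
    fix a i assume a: "a \<in> Poly_Mapping.keys (F * G)" and i: "i \<in> Poly_Mapping.keys a"
    obtain b c where "b \<in> Poly_Mapping.keys F" "c \<in> Poly_Mapping.keys G" "a = b + c"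
      using a keys_mult[of F G] by auto
    then show "i \<in> I" using i FG keys_add[of b c] unfolding poly_in_def by blast
  qed
  then show ?thesis using FG by (intro polyfunI[of "F * G"]) (auto simp: peval_mult)
qed

lemma polyfun_sum [intro]:
  "(\<And>i. i \<in> A \<Longrightarrow> f i \<in> polyfun I) \<Longrightarrow> (\<lambda>x. \<Sum>i\<in>A. f i x) \<in> polyfun I"
  by (induction A rule: infinite_finite_induct) auto

lemma polyfun_prod [intro]:
  "(\<And>i. i \<in> A \<Longrightarrow> f i \<in> polyfun I) \<Longrightarrow> (\<lambda>x. \<Prod>i\<in>A. f i x) \<in> polyfun I"
  by (induction A rule: infinite_finite_induct) auto

lemma polyfun_closed:
  assumes "f \<in> polyfun I"
    and "\<And>c. P (\<lambda>x. c)" "\<And>i. i \<in> I \<Longrightarrow> P (\<lambda>x. x i)"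
    and "\<And>f g. P f \<Longrightarrow> P g \<Longrightarrow> P (\<lambda>x. f x + g x)"
    and "\<And>f g. P f \<Longrightarrow> P g \<Longrightarrow> P (\<lambda>x. f x * g x)"
  shows "P f"
proof -
  obtain F where F: "F \<in> poly_in I" "f = peval F" using assms(1) by (auto simp: polyfun_def)
  show ?thesis unfolding F(2) by (rule peval_closed[of P I, OF assms(2-5) F(1)])
qed

lemma polyfun_cong:
  assumes "f \<in> polyfun I" "\<And>i. i \<in> I \<Longrightarrow> x i = y i"
  shows "f x = f y"
  using assms(1) by (rule polyfun_closed) (use assms(2) in auto)

lemma polyfun_compose:
  assumes "f \<in> polyfun I" "\<And>i. i \<in> I \<Longrightarrow> (\<lambda>x. g x i) \<in> polyfun J"
  shows "(\<lambda>x. f (g x)) \<in> polyfun J"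
  using assms(1) by (rule polyfun_closed) (use assms(2) in auto)

lemma polyfun_on_line:
  assumes "f \<in> polyfun I"
  shows "\<exists>q. \<forall>t. f (\<lambda>i. x i + t * y i) = poly q t"
  using assms
proof (rule polyfun_closed)
  show "\<exists>q. \<forall>t. c = poly q t" for c by (rule exI[of _ "[:c:]"]) simp
  show "\<exists>q. \<forall>t. x i + t * y i = poly q t" for i
    by (rule exI[of _ "[:x i, y i:]"]) simp
  show "\<exists>q. \<forall>t. f (\<lambda>i. x i + t * y i) + g (\<lambda>i. x i + t * y i) = poly q t"
    if "\<exists>q. \<forall>t. f (\<lambda>i. x i + t * y i) = poly q t" "\<exists>q. \<forall>t. g (\<lambda>i. x i + t * y i) = poly q t"
    for f g using that by (metis poly_add)
  show "\<exists>q. \<forall>t. f (\<lambda>i. x i + t * y i) * g (\<lambda>i. x i + t * y i) = poly q t"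
    if "\<exists>q. \<forall>t. f (\<lambda>i. x i + t * y i) = poly q t" "\<exists>q. \<forall>t. g (\<lambda>i. x i + t * y i) = poly q t"
    for f g using that by (metis poly_mult)
qed

text \<open>Nonempty basic open sets meet: on the line through a point of each, only finitely many
  parameters are excluded.\<close>

lemma polyfun_common_nonzero:
  assumes f: "f \<in> polyfun I" "f x \<noteq> 0" and g: "g \<in> polyfun I" "g y \<noteq> 0"
  shows "\<exists>t. f (\<lambda>i. x i + t * (y i - x i)) \<noteq> 0 \<and> g (\<lambda>i. x i + t * (y i - x i)) \<noteq> 0"
proof -
  obtain p where p: "\<And>t. f (\<lambda>i. x i + t * (y i - x i)) = poly p t"
    using polyfun_on_line[OF f(1), of x "\<lambda>i. y i - x i"] by auto
  obtain q where q: "\<And>t. g (\<lambda>i. x i + t * (y i - x i)) = poly q t"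
    using polyfun_on_line[OF g(1), of x "\<lambda>i. y i - x i"] by auto
  have "poly p 0 \<noteq> 0" using p[of 0] f(2) by simp
  moreover have "poly q 1 \<noteq> 0" using q[of 1] g(2) by simp
  ultimately have "p * q \<noteq> 0" by auto
  then have "finite {t. poly (p * q) t = 0}" by (rule poly_roots_finite)
  then obtain t where "poly (p * q) t \<noteq> 0"
    using infinite_UNIV_char_0[where 'a = complex] ex_new_if_finite by blast
  then show ?thesis using p q by auto
qed

section \<open>Linear algebra over finite index sets\<close>

lemma underdetermined_system:
  fixes T :: "'e \<Rightarrow> 'v \<Rightarrow> complex"
  assumes "finite E" "finite V" "card E < card V"
  shows "\<exists>z. (\<exists>v\<in>V. z v \<noteq> 0) \<and> (\<forall>e\<in>E. (\<Sum>v\<in>V. T e v * z v) = 0)"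
  using assms
proof (induction E arbitrary: V T rule: finite_induct)
  case empty
  then obtain v where "v \<in> V" by fastforce
  then show ?case by (intro exI[of _ "\<lambda>_. 1"]) auto
next
  case (insert e0 E)
  show ?case
  proof (cases "\<forall>v\<in>V. T e0 v = 0")
    case True
    have "card E < card V" using insert by auto
    then obtain z where "\<exists>v\<in>V. z v \<noteq> 0" "\<forall>e\<in>E. (\<Sum>v\<in>V. T e v * z v) = 0"
      using insert.IH[of V T] insert.prems(1) by blast
    then show ?thesis using True by (intro exI[of _ z]) auto
  next
    case False
    then obtain v0 where v0: "v0 \<in> V" "T e0 v0 \<noteq> 0" by auto
    define V' where "V' = V - {v0}"
    define c where "c v = T e0 v / T e0 v0" for v
    have V: "V = insert v0 V'" "v0 \<notin> V'" "finite V'" using v0 insert by (auto simp: V'_def)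
    have "card E < card V'" using insert V by simp
    then obtain z where z: "\<exists>v\<in>V'. z v \<noteq> 0"
        "\<And>e. e \<in> E \<Longrightarrow> (\<Sum>v\<in>V'. (T e v - T e v0 * c v) * z v) = 0"
      using insert.IH[of V' "\<lambda>e v. T e v - T e v0 * c v"] V(3) by blast
    define z' where "z' = z(v0 := - (\<Sum>v\<in>V'. c v * z v))"
    have sum: "(\<Sum>v\<in>V. T e v * z' v) = (\<Sum>v\<in>V'. (T e v - T e v0 * c v) * z v)" for e
    proof -
      have "(\<Sum>v\<in>V'. T e v * z' v) = (\<Sum>v\<in>V'. T e v * z v)"
        using V by (intro sum.cong) (auto simp: z'_def)
      moreover have "z' v0 = - (\<Sum>v\<in>V'. c v * z v)" by (simp add: z'_def)
      ultimately show ?thesis unfolding V(1)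
        using V by (simp add: algebra_simps sum_subtractf sum_distrib_left)
    qed
    have "(\<Sum>v\<in>V. T e v * z' v) = 0" if "e \<in> insert e0 E" for e
      using that z(2) v0 unfolding sum by (auto simp: c_def)
    moreover have "\<exists>v\<in>V. z' v \<noteq> 0" using z(1) V by (auto simp: z'_def)
    ultimately show ?thesis by blast
  qed
qed

text \<open>A left inverse is built one column at a time: the part of the new column that the old left
  inverse does not see is nonzero by injectivity, and a coordinate where it is nonzero yields the new
  row.\<close>

lemma left_inverse_of_injective:
  fixes T :: "'j \<Rightarrow> 'c \<Rightarrow> complex"
  assumes "finite C" "finite J"
    and "\<And>z. (\<And>j. j \<in> J \<Longrightarrow> (\<Sum>c\<in>C. T j c * z c) = 0) \<Longrightarrow> (\<forall>c\<in>C. z c = 0)"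
  shows "\<exists>P. \<forall>c\<in>C. \<forall>c'\<in>C. (\<Sum>j\<in>J. P c j * T j c') = (if c = c' then 1 else 0)"
  using assms(1,3)
proof (induction C rule: finite_induct)
  case empty
  then show ?case by auto
next
  case (insert a C)
  have "\<forall>c\<in>C. z c = 0" if "\<And>j. j \<in> J \<Longrightarrow> (\<Sum>c\<in>C. T j c * z c) = 0" for z
  proof -
    have "(\<Sum>c\<in>C. T j c * (z(a := 0)) c) = (\<Sum>c\<in>C. T j c * z c)" for j
      using insert.hyps by (intro sum.cong) auto
    then have "(\<Sum>c\<in>insert a C. T j c * (z(a := 0)) c) = 0" if "j \<in> J" for j
      using \<open>\<And>j. j \<in> J \<Longrightarrow> (\<Sum>c\<in>C. T j c * z c) = 0\<close>[OF that] insert.hyps by simp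
    from insert.prems[OF this] have "\<forall>c\<in>C. (z(a := 0)) c = 0" by blast
    then show ?thesis using insert.hyps by (metis fun_upd_other)
  qed
  from insert.IH[OF this] obtain P where
    P: "\<And>c c'. c \<in> C \<Longrightarrow> c' \<in> C \<Longrightarrow> (\<Sum>j\<in>J. P c j * T j c') = (if c = c' then 1 else 0)"
    by blast
  \<comment> \<open>The part of column \<open>a\<close> that the left inverse of the other columns does not see.\<close>
  define t where "t c = (\<Sum>j\<in>J. P c j * T j a)" for c
  define w where "w j = T j a - (\<Sum>c\<in>C. T j c * t c)" for j
  obtain j0 where j0: "j0 \<in> J" "w j0 \<noteq> 0"
  proof (rule ccontr)
    assume "\<not> thesis"
    with that have w0: "w j = 0" if "j \<in> J" for j using \<open>j \<in> J\<close> by blast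
    have "(\<Sum>c\<in>insert a C. T j c * ((\<lambda>c. - t c)(a := 1)) c) = w j" if "j \<in> J" for j
    proof -
      have "(\<Sum>c\<in>C. T j c * ((\<lambda>c. - t c)(a := 1)) c) = (\<Sum>c\<in>C. - (T j c * t c))"
        using insert.hyps by (intro sum.cong) auto
      then show ?thesis using insert.hyps by (simp add: w_def sum_negf)
    qed
    then have "\<forall>c\<in>insert a C. ((\<lambda>c. - t c)(a := 1)) c = 0"
      using w0 by (intro insert.prems) auto
    then show False by simp
  qed
  define l where "l j = ((if j = j0 then 1 else 0) - (\<Sum>c\<in>C. T j0 c * P c j)) / w j0" for j
  have l: "(\<Sum>j\<in>J. l j * T j c') = (T j0 c' - (\<Sum>c\<in>C. T j0 c * (\<Sum>j\<in>J. P c j * T j c'))) / w j0" for c'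
  proof -
    have "(\<Sum>j\<in>J. l j * T j c') = (\<Sum>j\<in>J. ((if j = j0 then 1 else 0) * T j c'
        - (\<Sum>c\<in>C. T j0 c * (P c j * T j c')))) / w j0"
      unfolding sum_divide_distrib l_def
      by (intro sum.cong) (auto simp: field_simps sum_distrib_left sum_distrib_right)
    also have "(\<Sum>j\<in>J. ((if j = j0 then 1 else 0) * T j c' - (\<Sum>c\<in>C. T j0 c * (P c j * T j c'))))
        = T j0 c' - (\<Sum>c\<in>C. T j0 c * (\<Sum>j\<in>J. P c j * T j c'))"
    proof -
      have "(\<Sum>j\<in>J. (if j = j0 then 1 else 0) * T j c') = (\<Sum>j\<in>J. if j = j0 then T j c' else 0)"
        by (intro sum.cong) auto
      then have "(\<Sum>j\<in>J. (if j = j0 then 1 else 0) * T j c') = T j0 c'"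
        using j0 assms(2) by simp
      moreover have "(\<Sum>j\<in>J. \<Sum>c\<in>C. T j0 c * (P c j * T j c')) = (\<Sum>c\<in>C. \<Sum>j\<in>J. T j0 c * (P c j * T j c'))"
        by (rule sum.swap)
      ultimately show ?thesis by (simp add: sum_subtractf sum_distrib_left)
    qed
    finally show ?thesis .
  qed
  have lC: "(\<Sum>j\<in>J. l j * T j c') = 0" if "c' \<in> C" for c'
  proof -
    have "(\<Sum>c\<in>C. T j0 c * (\<Sum>j\<in>J. P c j * T j c')) = (\<Sum>c\<in>C. if c = c' then T j0 c else 0)"
      using P that by (intro sum.cong) auto
    then show ?thesis unfolding l using that insert.hyps by simp
  qed
  have la: "(\<Sum>j\<in>J. l j * T j a) = 1"
    unfolding l t_def[symmetric] using j0 by (simp add: w_def)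
  define P' where "P' c j = (if c = a then l j else P c j - t c * l j)" for c j
  have "(\<Sum>j\<in>J. P' c j * T j c') = (if c = c' then 1 else 0)"
    if "c \<in> insert a C" "c' \<in> insert a C" for c c'
  proof (cases "c = a")
    case True
    then show ?thesis using that lC la insert.hyps by (auto simp: P'_def)
  next
    case False
    then have c: "c \<in> C" using that by simp
    have "(\<Sum>j\<in>J. P' c j * T j c') = (\<Sum>j\<in>J. P c j * T j c') - t c * (\<Sum>j\<in>J. l j * T j c')"
      using False by (simp add: P'_def sum_subtractf algebra_simps sum_distrib_left)
    then show ?thesis using that P[OF c] lC la False c insert.hyps
      by (cases "c' = a") (auto simp: t_def)
  qed
  then show ?case by blast
qed

text \<open>The kernel of the \<open>p \<times> q\<close> matrix \<open>T\<close> has dimension at least \<open>k\<close> if and only if it meets every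
  coordinate subspace of dimension greater than \<open>q - k\<close>. This form speaks about square submatrices
  without mentioning dimensions of subspaces, and is meaningful for all \<open>k\<close>: it holds for \<open>k = 0\<close> and
  fails for \<open>k > q\<close>.\<close>

definition nullity_ge :: "nat \<Rightarrow> nat \<Rightarrow> nat \<Rightarrow> (nat \<Rightarrow> nat \<Rightarrow> complex) \<Rightarrow> bool" where
  "nullity_ge p q k T \<longleftrightarrow> (\<forall>C. C \<subseteq> {..<q} \<and> q < card C + k \<longrightarrow>
     (\<exists>y. (\<exists>i\<in>C. y i \<noteq> 0) \<and> (\<forall>i. i \<notin> C \<longrightarrow> y i = 0) \<and> (\<forall>j<p. (\<Sum>i<q. T j i * y i) = 0)))"

lemma nullity_ge_0 [simp]: "nullity_ge p q 0 T"
proof -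
  have "False" if "C \<subseteq> {..<q}" "q < card C" for C
    using card_mono[OF _ that(1)] that(2) by simp
  then show ?thesis unfolding nullity_ge_def add_0_right by blast
qed

lemma not_nullity_ge_Suc: "\<not> nullity_ge p q (Suc q) T"
  unfolding nullity_ge_def by (intro notI, drule spec[of _ "{}"]) simp

lemma nullity_ge_mono: "nullity_ge p q k T \<Longrightarrow> l \<le> k \<Longrightarrow> nullity_ge p q l T"
  unfolding nullity_ge_def by (intro allI impI, drule spec, erule mp) auto

section \<open>Forms with polynomial coefficients\<close>

definition expo :: "nat \<Rightarrow> nat \<Rightarrow> (nat \<Rightarrow> nat) set" where
  "expo d e = {b. (\<forall>i\<ge>d. b i = 0) \<and> sum b {..<d} = e}"

definition mono_fun :: "nat \<Rightarrow> (nat \<Rightarrow> nat) \<Rightarrow> (nat \<Rightarrow> complex) \<Rightarrow> complex" where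
  "mono_fun d b x = (\<Prod>i<d. x i ^ b i)"

text \<open>Forms of degree \<open>e\<close> in \<open>d\<close> variables \<open>x\<close> whose coefficients are polynomial functions of
  parameters \<open>\<phi>\<close>. Minors of a linear family of matrices are of this kind.\<close>

definition biform :: "'i set \<Rightarrow> nat \<Rightarrow> nat \<Rightarrow> (('i \<Rightarrow> complex) \<Rightarrow> (nat \<Rightarrow> complex) \<Rightarrow> complex) set" where
  "biform I d e = {F. \<exists>q. (\<forall>b. q b \<in> polyfun I) \<and> F = (\<lambda>\<phi> x. \<Sum>b\<in>expo d e. q b \<phi> * mono_fun d b x)}"

lemma finite_expo [simp]: "finite (expo d e)"
proof (rule finite_subset)
  show "expo d e \<subseteq> {b. \<forall>i. (i \<in> {..<d} \<longrightarrow> b i \<in> {..e}) \<and> (i \<notin> {..<d} \<longrightarrow> b i = 0)}"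
    by (auto simp: expo_def intro!: member_le_sum)
  show "finite {b. \<forall>i. (i \<in> {..<d} \<longrightarrow> b i \<in> {..e}) \<and> (i \<notin> {..<d} \<longrightarrow> b i = (0::nat))}"
    by (rule finite_set_of_finite_funs) auto
qed

lemma expo_support: "b \<in> expo d e \<Longrightarrow> b i \<noteq> 0 \<Longrightarrow> i < d"
  by (rule ccontr) (simp add: expo_def)

lemma expo_add: "b \<in> expo d e \<Longrightarrow> c \<in> expo d e' \<Longrightarrow> (\<lambda>i. b i + c i) \<in> expo d (e + e')"
  by (auto simp: expo_def sum.distrib)

lemma mono_fun_add: "mono_fun d (\<lambda>i. b i + c i) x = mono_fun d b x * mono_fun d c x"
  by (simp add: mono_fun_def power_add prod.distrib)

lemma mono_fun_scale: "b \<in> expo d e \<Longrightarrow> mono_fun d b (\<lambda>i. c * x i) = c ^ e * mono_fun d b x"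
  by (auto simp: mono_fun_def expo_def power_mult_distrib prod.distrib power_sum)

text \<open>Exponents may repeat in such a sum; collecting equal ones gives the normal form. This is the
  source of the closure properties of \<open>biform\<close>.\<close>

lemma biform_sumI:
  assumes "finite S" "\<And>s. s \<in> S \<Longrightarrow> b s \<in> expo d e" "\<And>s. s \<in> S \<Longrightarrow> q s \<in> polyfun I"
  shows "(\<lambda>\<phi> x. \<Sum>s\<in>S. q s \<phi> * mono_fun d (b s) x) \<in> biform I d e"
proof -
  define r where "r c = (\<lambda>\<phi>. \<Sum>s\<in>{s\<in>S. b s = c}. q s \<phi>)" for c
  have "(\<Sum>s\<in>S. q s \<phi> * mono_fun d (b s) x) = (\<Sum>c\<in>expo d e. r c \<phi> * mono_fun d c x)" for \<phi> x
  proof -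
    have "(\<Sum>s\<in>S. q s \<phi> * mono_fun d (b s) x)
        = (\<Sum>c\<in>expo d e. \<Sum>s\<in>{s\<in>S. b s = c}. q s \<phi> * mono_fun d (b s) x)"
      by (rule sum.group[symmetric]) (use assms in auto)
    also have "\<dots> = (\<Sum>c\<in>expo d e. r c \<phi> * mono_fun d c x)"
      by (intro sum.cong refl) (simp add: r_def sum_distrib_right)
    finally show ?thesis .
  qed
  moreover have "r c \<in> polyfun I" for c
    unfolding r_def using assms(3) by auto
  ultimately show ?thesis unfolding biform_def by (intro CollectI exI[of _ r]) auto
qed

lemma biform_0 [intro]: "(\<lambda>\<phi> x. 0) \<in> biform I d e"
  using biform_sumI[of "{}" "\<lambda>_ _. 0"] by simp

lemma biform_add [intro]:
  assumes "F \<in> biform I d e" "G \<in> biform I d e"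
  shows "(\<lambda>\<phi> x. F \<phi> x + G \<phi> x) \<in> biform I d e"
proof -
  obtain q r where "\<forall>b. q b \<in> polyfun I" "F = (\<lambda>\<phi> x. \<Sum>b\<in>expo d e. q b \<phi> * mono_fun d b x)"
    "\<forall>b. r b \<in> polyfun I" "G = (\<lambda>\<phi> x. \<Sum>b\<in>expo d e. r b \<phi> * mono_fun d b x)"
    using assms by (auto simp: biform_def)
  then show ?thesis
    unfolding biform_def
    by (intro CollectI exI[of _ "\<lambda>b \<phi>. q b \<phi> + r b \<phi>"]) (auto simp: sum.distrib algebra_simps)
qed

lemma biform_sum [intro]:
  "(\<And>s. s \<in> S \<Longrightarrow> F s \<in> biform I d e) \<Longrightarrow> (\<lambda>\<phi> x. \<Sum>s\<in>S. F s \<phi> x) \<in> biform I d e"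
  by (induction S rule: infinite_finite_induct) auto

lemma biform_coeff:
  assumes "c \<in> polyfun I" shows "(\<lambda>\<phi> x. c \<phi>) \<in> biform I d 0"
  using biform_sumI[of "{()}" "\<lambda>_ _. 0" d 0 "\<lambda>_. c" I] assms by (simp add: expo_def mono_fun_def)

lemma biform_var: "i < d \<Longrightarrow> (\<lambda>\<phi> x. x i) \<in> biform I d 1"
proof -
  assume i: "i < d"
  have "mono_fun d (\<lambda>j. if j = i then 1 else 0) x = x i" for x
  proof -
    have "mono_fun d (\<lambda>j. if j = i then 1 else 0) x = (\<Prod>j<d. if j = i then x i else 1)"
      unfolding mono_fun_def by (intro prod.cong) auto
    then show ?thesis using i by simp
  qed
  then show ?thesis
    using biform_sumI[of "{()}" "\<lambda>_ j. if j = i then 1 else 0" d 1 "\<lambda>_ _. 1" I] i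
    by (simp add: expo_def polyfun_const)
qed

lemma biform_mult [intro]:
  assumes "F \<in> biform I d e" "G \<in> biform I d e'"
  shows "(\<lambda>\<phi> x. F \<phi> x * G \<phi> x) \<in> biform I d (e + e')"
proof -
  obtain q r where F: "\<forall>b. q b \<in> polyfun I" "F = (\<lambda>\<phi> x. \<Sum>b\<in>expo d e. q b \<phi> * mono_fun d b x)"
    and G: "\<forall>b. r b \<in> polyfun I" "G = (\<lambda>\<phi> x. \<Sum>b\<in>expo d e'. r b \<phi> * mono_fun d b x)"
    using assms by (auto simp: biform_def)
  have "F \<phi> x * G \<phi> x = (\<Sum>s\<in>expo d e \<times> expo d e'. q (fst s) \<phi> * r (snd s) \<phi>
      * mono_fun d (\<lambda>i. fst s i + snd s i) x)" for \<phi> x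
    unfolding F G sum_product sum.cartesian_product
    by (intro sum.cong) (auto simp: mono_fun_add)
  moreover have "(\<lambda>\<phi> x. \<Sum>s\<in>expo d e \<times> expo d e'. q (fst s) \<phi> * r (snd s) \<phi>
      * mono_fun d (\<lambda>i. fst s i + snd s i) x) \<in> biform I d (e + e')"
    using F(1) G(1) by (intro biform_sumI) (auto intro: expo_add)
  ultimately show ?thesis by simp
qed

lemma biform_scale:
  assumes "c \<in> polyfun I" "F \<in> biform I d e"
  shows "(\<lambda>\<phi> x. c \<phi> * F \<phi> x) \<in> biform I d e"
  using biform_mult[OF biform_coeff[OF assms(1)] assms(2)] by simp

lemma biform_linear:
  assumes "\<And>i. i < d \<Longrightarrow> c i \<in> polyfun I"
  shows "(\<lambda>\<phi> x. \<Sum>i<d. c i \<phi> * x i) \<in> biform I d 1"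
  using assms by (intro biform_sum biform_scale biform_var) auto

lemma biform_prod:
  "finite S \<Longrightarrow> (\<And>s. s \<in> S \<Longrightarrow> F s \<in> biform I d 1) \<Longrightarrow> (\<lambda>\<phi> x. \<Prod>s\<in>S. F s \<phi> x) \<in> biform I d (card S)"
proof (induction S rule: finite_induct)
  case empty
  then show ?case using biform_coeff[OF polyfun_const[of 1]] by simp
next
  case (insert s S)
  have "(\<lambda>\<phi> x. F s \<phi> x * (\<Prod>s\<in>S. F s \<phi> x)) \<in> biform I d (1 + card S)"
    by (rule biform_mult) (use insert in simp_all)
  then show ?case using insert by simp
qed

lemma det_leibniz:
  "Determinant.det (mat r r (\<lambda>(i,j). h i j)) =
    (\<Sum>p\<in>{p. p permutes {0..<r}}. signof p * (\<Prod>i\<in>{0..<r}. h i (p i)))"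
proof -
  have "p i < r" if "p permutes {0..<r}" "i < r" for p i
    using permutes_in_image[OF that(1), of i] that(2) by simp
  then show ?thesis
    by (subst det_def'[of _ r]) (auto intro!: sum.cong prod.cong)
qed

lemma biform_det:
  assumes "\<And>i j. i < r \<Longrightarrow> j < r \<Longrightarrow> h i j \<in> biform I d 1"
  shows "(\<lambda>\<phi> x. Determinant.det (mat r r (\<lambda>(i,j). h i j \<phi> x))) \<in> biform I d r"
proof -
  have "(\<lambda>\<phi> x. \<Prod>i\<in>{0..<r}. h i (p i) \<phi> x) \<in> biform I d r" if p: "p permutes {0..<r}" for p
  proof -
    have "p i < r" if "i < r" for i
      using permutes_in_image[OF p, of i] that by simp
    then have "(\<lambda>\<phi> x. \<Prod>i\<in>{0..<r}. h i (p i) \<phi> x) \<in> biform I d (card {0..<r})"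
      by (intro biform_prod assms) simp_all
    then show ?thesis by simp
  qed
  then show ?thesis unfolding det_leibniz by (intro biform_sum biform_scale polyfun_const) simp
qed

lemma polyfun_det:
  assumes "\<And>i j. i < r \<Longrightarrow> j < r \<Longrightarrow> h i j \<in> polyfun I"
  shows "(\<lambda>\<phi>. Determinant.det (mat r r (\<lambda>(i,j). h i j \<phi>))) \<in> polyfun I"
proof -
  have "p i < r" if "p permutes {0..<r}" "i < r" for p i
    using permutes_in_image[OF that(1), of i] that(2) by simp
  then show ?thesis
    unfolding det_leibniz by (intro polyfun_sum polyfun_mult polyfun_prod polyfun_const assms) simp_all
qed

definition formfun :: "nat \<Rightarrow> nat \<Rightarrow> ((nat \<Rightarrow> complex) \<Rightarrow> complex) set" where
  "formfun d e = {f. \<exists>c. f = (\<lambda>x. \<Sum>b\<in>expo d e. c b * mono_fun d b x)}"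

lemma formfun_iff_biform:
  fixes I :: "'i set"
  shows "f \<in> formfun d e \<longleftrightarrow> (\<lambda>_. f) \<in> biform I d e"
proof
  assume "f \<in> formfun d e"
  then obtain c where "f = (\<lambda>x. \<Sum>b\<in>expo d e. c b * mono_fun d b x)" by (auto simp: formfun_def)
  then show "(\<lambda>_. f) \<in> biform I d e"
    unfolding biform_def by (intro CollectI exI[of _ "\<lambda>b _. c b"]) auto
next
  assume "(\<lambda>_. f) \<in> biform I d e"
  then obtain q where "(\<lambda>_ :: 'i \<Rightarrow> complex. f) = (\<lambda>\<phi> x. \<Sum>b\<in>expo d e. q b \<phi> * mono_fun d b x)"
    by (auto simp: biform_def)
  from fun_cong[OF this, of "\<lambda>_. 0"] show "f \<in> formfun d e" unfolding formfun_def
    by (intro CollectI exI[of _ "\<lambda>b. q b (\<lambda>_. 0)"])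
qed

lemma formfun_of_biform: "F \<in> biform I d e \<Longrightarrow> F \<phi> \<in> formfun d e"
  by (auto simp: biform_def formfun_def)

lemma formfun_add [intro]: "f \<in> formfun d e \<Longrightarrow> g \<in> formfun d e \<Longrightarrow> (\<lambda>x. f x + g x) \<in> formfun d e"
  using biform_add[of "\<lambda>_. f" "{} :: unit set" d e "\<lambda>_. g"] by (simp add: formfun_iff_biform[where I = "{} :: unit set"])

lemma formfun_mult [intro]: "f \<in> formfun d e \<Longrightarrow> g \<in> formfun d e' \<Longrightarrow> (\<lambda>x. f x * g x) \<in> formfun d (e + e')"
  using biform_mult[of "\<lambda>_. f" "{} :: unit set" d e "\<lambda>_. g" e'] by (simp add: formfun_iff_biform[where I = "{} :: unit set"])

lemma formfun_scale [intro]: "f \<in> formfun d e \<Longrightarrow> (\<lambda>x. c * f x) \<in> formfun d e"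
  using biform_scale[of "\<lambda>_. c" "{} :: unit set" "\<lambda>_. f" d e] by (auto simp: formfun_iff_biform[where I = "{} :: unit set"])

lemma formfun_0 [intro]: "(\<lambda>x. 0) \<in> formfun d e"
  using biform_0[of "{} :: unit set"] by (simp add: formfun_iff_biform[where I = "{} :: unit set"])

lemma formfun_const [intro]: "(\<lambda>x. c) \<in> formfun d 0"
  using biform_coeff[of "\<lambda>_. c" "{} :: unit set"] by (auto simp: formfun_iff_biform[where I = "{} :: unit set"])

lemma formfun_var: "i < d \<Longrightarrow> (\<lambda>x. x i) \<in> formfun d 1"
  using biform_var[of i d "{} :: unit set"] by (simp add: formfun_iff_biform[where I = "{} :: unit set"])

lemma formfun_mono: "b \<in> expo d e \<Longrightarrow> mono_fun d b \<in> formfun d e"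
  unfolding formfun_iff_biform[where I = "{} :: unit set"]
  using biform_sumI[of "{()}" "\<lambda>_. b" d e "\<lambda>_ _. 1" "{} :: unit set"] by (simp add: polyfun_const)

lemma formfun_sum [intro]:
  "(\<And>s. s \<in> S \<Longrightarrow> f s \<in> formfun d e) \<Longrightarrow> (\<lambda>x. \<Sum>s\<in>S. f s x) \<in> formfun d e"
  by (induction S rule: infinite_finite_induct) auto

lemma formfun_power: "f \<in> formfun d e \<Longrightarrow> (\<lambda>x. f x ^ k) \<in> formfun d (k * e)"
proof (induction k)
  case (Suc k)
  then have "(\<lambda>x. f x * f x ^ k) \<in> formfun d (e + k * e)" by (intro formfun_mult)
  then show ?case by simp
qed (simp add: formfun_const)

lemma formfun_mono_compose:
  assumes b: "b \<in> expo d e" and g: "\<And>i. i < d \<Longrightarrow> (\<lambda>x. g x i) \<in> formfun d' e'"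
  shows "(\<lambda>x. mono_fun d b (g x)) \<in> formfun d' (e * e')"
proof -
  have "(\<lambda>x. \<Prod>i<k. g x i ^ b i) \<in> formfun d' (sum b {..<k} * e')" if "k \<le> d" for k
    using that
  proof (induction k)
    case (Suc k)
    then have "(\<lambda>x. (\<Prod>i<k. g x i ^ b i) * g x k ^ b k) \<in> formfun d' (sum b {..<k} * e' + b k * e')"
      by (intro formfun_mult formfun_power g) simp_all
    then show ?case by (simp add: algebra_simps)
  qed (simp add: formfun_const)
  from this[of d] show ?thesis using b by (simp add: mono_fun_def expo_def)
qed

lemma formfun_compose:
  assumes f: "f \<in> formfun d e" and g: "\<And>i. i < d \<Longrightarrow> (\<lambda>x. g x i) \<in> formfun d' e'"
  shows "(\<lambda>x. f (g x)) \<in> formfun d' (e * e')"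
proof -
  obtain c where "f = (\<lambda>x. \<Sum>b\<in>expo d e. c b * mono_fun d b x)" using f by (auto simp: formfun_def)
  then show ?thesis by (simp add: formfun_sum formfun_scale formfun_mono_compose g)
qed

lemma formfun_homogeneous: "f \<in> formfun d e \<Longrightarrow> f (\<lambda>i. c * x i) = c ^ e * f x"
  by (auto simp: formfun_def mono_fun_scale sum_distrib_left mult_ac intro!: sum.cong)

lemma formfun_cong:
  assumes "f \<in> formfun d e" "\<And>i. i < d \<Longrightarrow> x i = y i" shows "f x = f y"
proof -
  have "mono_fun d b x = mono_fun d b y" for b
    unfolding mono_fun_def using assms(2) by (intro prod.cong) auto
  then show ?thesis using assms(1) by (auto simp: formfun_def)
qed

lemma formfun_polyfun: "f \<in> formfun d e \<Longrightarrow> f \<in> polyfun {..<d}"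
proof -
  have pow: "(\<lambda>x. x i ^ k) \<in> polyfun {..<d}" if "i < d" for i k
  proof (induction k)
    case (Suc k)
    have "(\<lambda>x. x i * x i ^ k) \<in> polyfun {..<d}"
      by (rule polyfun_mult[OF polyfun_var Suc]) (use that in simp)
    then show ?case by simp
  qed (auto intro: polyfun_const)
  show "f \<in> formfun d e \<Longrightarrow> f \<in> polyfun {..<d}"
    by (auto simp: formfun_def mono_fun_def intro!: polyfun_sum polyfun_mult polyfun_prod pow)
qed

text \<open>Exponents are functions here, because these add pointwise without a support condition. The
  next two lemmas translate to the finitely supported exponents of the polynomial type.\<close>

lemma formfun_of_forms:
  assumes "F \<in> forms d e" shows "peval F \<in> formfun d e"
proof -
  have eq: "peval F x = (\<Sum>a\<in>Poly_Mapping.keys F. Poly_Mapping.lookup F a * mono_fun d (Poly_Mapping.lookup a) x)" for x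
  proof -
    have "Poly_Mapping.keys a \<subseteq> {..<d}" if "a \<in> Poly_Mapping.keys F" for a
      using assms that by (auto simp: forms_def poly_in_def)
    then show ?thesis
      by (simp add: peval_superset[OF _ order_refl] mono_fun_def monomial_value_superset[of "{..<d}"])
  qed
  have "Poly_Mapping.lookup a \<in> expo d e" if "a \<in> Poly_Mapping.keys F" for a
  proof -
    have k: "Poly_Mapping.keys a \<subseteq> {..<d}" and s: "sum (Poly_Mapping.lookup a) (Poly_Mapping.keys a) = e"
      using assms that by (auto simp: forms_def poly_in_def)
    have "sum (Poly_Mapping.lookup a) {..<d} = sum (Poly_Mapping.lookup a) (Poly_Mapping.keys a)"
      by (rule sum.mono_neutral_right) (use k in \<open>auto simp: in_keys_iff\<close>)
    moreover have "Poly_Mapping.lookup a i = 0" if "i \<ge> d" for i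
    proof -
      have "i \<notin> Poly_Mapping.keys a" using k that by auto
      then show ?thesis by (simp add: in_keys_iff)
    qed
    ultimately show ?thesis using s by (simp add: expo_def)
  qed
  then have "(\<lambda>_ :: unit \<Rightarrow> complex. \<lambda>x. \<Sum>a\<in>Poly_Mapping.keys F. Poly_Mapping.lookup F a *
      mono_fun d (Poly_Mapping.lookup a) x) \<in> biform {} d e"
    by (intro biform_sumI polyfun_const) simp_all
  then show ?thesis
    unfolding eq[symmetric] by (simp add: formfun_iff_biform[where I = "{} :: unit set"])
qed

lemma forms_of_formfun:
  assumes "f \<in> formfun d e" shows "\<exists>F\<in>forms d e. peval F = f"
proof -
  obtain c where c: "f = (\<lambda>x. \<Sum>b\<in>expo d e. c b * mono_fun d b x)" using assms by (auto simp: formfun_def)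
  have fin: "finite {i. b i \<noteq> 0}" if "b \<in> expo d e" for b
    by (rule finite_subset[of _ "{..<d}"]) (use that in \<open>auto intro: expo_support\<close>)
  define pm where "pm b = (Abs_poly_mapping b :: nat \<Rightarrow>\<^sub>0 nat)" for b
  have lk: "Poly_Mapping.lookup (pm b) = b" if "b \<in> expo d e" for b
    unfolding pm_def using fin[OF that] by (rule lookup_Abs_poly_mapping)
  have ks: "Poly_Mapping.keys (pm b) \<subseteq> {..<d}" if "b \<in> expo d e" for b
    using that by (auto simp: in_keys_iff lk intro: expo_support)
  define F where "F = (\<Sum>b\<in>expo d e. Poly_Mapping.single (pm b) (c b))"
  have "Poly_Mapping.keys F \<subseteq> pm ` expo d e"
    unfolding F_def by (rule order.trans[OF keys_sum]) auto
  moreover have "sum (Poly_Mapping.lookup (pm b)) (Poly_Mapping.keys (pm b)) = e" if "b \<in> expo d e" for b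
  proof -
    have "sum (Poly_Mapping.lookup (pm b)) {..<d} = sum (Poly_Mapping.lookup (pm b)) (Poly_Mapping.keys (pm b))"
      by (rule sum.mono_neutral_right) (use ks[OF that] in \<open>auto simp: in_keys_iff\<close>)
    then show ?thesis using that by (simp add: lk expo_def)
  qed
  ultimately have "F \<in> forms d e" using ks unfolding forms_def poly_in_def by blast
  moreover have "peval F = f"
    unfolding c F_def fun_eq_iff
    by (auto simp: peval_sum peval_single monomial_value_superset[OF _ ks] lk mono_fun_def intro!: sum.cong)
  ultimately show ?thesis by blast
qed

section \<open>The weak Nullstellensatz over the complex numbers\<close>

lemma const_poly_0 [simp]: "const_poly 0 = 0"
  by (simp add: const_poly_def)

lemma const_poly_1 [simp]: "const_poly 1 = 1"
  by (simp add: const_poly_def)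

lemma peval_1 [simp]: "peval 1 x = 1"
  using peval_const[of 1 x] by simp

lemma const_poly_add: "const_poly (a + b) = const_poly a + const_poly b"
  by (simp add: const_poly_def single_add)

lemma const_poly_mult: "const_poly (a * b) = const_poly a * const_poly b"
  by (simp add: const_poly_def mult_single)

lemma const_poly_uminus: "const_poly (- a) = - const_poly a"
  by (simp add: const_poly_def single_uminus)

lemma lookup_const_mult: "Poly_Mapping.lookup (const_poly c * F) a = c * Poly_Mapping.lookup F a"
  by (simp add: const_poly_def mult_map_scale_conv_mult[symmetric] Poly_Mapping.map.rep_eq when_def)

lemma cpoly_induct:
  assumes const: "\<And>c. P (const_poly c)" and var: "\<And>i. P (var_poly i)"
    and add: "\<And>F G. P F \<Longrightarrow> P G \<Longrightarrow> P (F + G)" and mult: "\<And>F G. P F \<Longrightarrow> P G \<Longrightarrow> P (F * G)"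
  shows "P F"
proof -
  have one: "P 1" using const[of 1] by simp
  have pow: "P (Poly_Mapping.single (Poly_Mapping.single i k) 1)" for i k
  proof (induction k)
    case (Suc k)
    have "P (var_poly i * Poly_Mapping.single (Poly_Mapping.single i k) 1)"
      using mult[OF var Suc] .
    then show ?case by (simp add: var_poly_def mult_single single_add[symmetric])
  qed (use one in simp)
  have mono: "P (Poly_Mapping.single (\<Sum>i\<in>A. Poly_Mapping.single i (k i)) 1)" if "finite A" for A and k :: "_ \<Rightarrow> nat"
    using that
  proof (induction A rule: finite_induct)
    case (insert i A)
    have "P (Poly_Mapping.single (Poly_Mapping.single i (k i)) 1
       * Poly_Mapping.single (\<Sum>i\<in>A. Poly_Mapping.single i (k i)) 1)"
      using mult[OF pow insert.IH] .
    then show ?case using insert.hyps by (simp add: mult_single)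
  qed (use one in simp)
  have single: "P (Poly_Mapping.single a c)" for a c
  proof -
    have "P (const_poly c * Poly_Mapping.single a 1)"
      using mult[OF const[of c] mono[OF finite_keys[of a], of "Poly_Mapping.lookup a"]]
      unfolding poly_mapping_sum_single[symmetric] .
    then show ?thesis by (simp add: const_poly_def mult_single)
  qed
  have "P (\<Sum>a\<in>A. Poly_Mapping.single a (Poly_Mapping.lookup F a))" if "finite A" for A
    using that
  proof (induction A rule: finite_induct)
    case empty
    then show ?case using const[of 0] by simp
  next
    case (insert a A)
    then show ?case using add[OF single insert.IH] by simp
  qed
  from this[OF finite_keys] show ?thesis
    by (subst poly_mapping_sum_single[of F])
qed

definition poly_at :: "'i cpoly \<Rightarrow> complex poly \<Rightarrow> 'i cpoly" where
  "poly_at X p = fold_coeffs (\<lambda>a r. const_poly a + X * r) p 0"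

lemma poly_at_0 [simp]: "poly_at X 0 = 0"
  by (simp add: poly_at_def)

lemma poly_at_pCons [simp]: "poly_at X (pCons a p) = const_poly a + X * poly_at X p"
  by (cases "a = 0 \<and> p = 0") (auto simp: poly_at_def)

lemma poly_at_add: "poly_at X (p + q) = poly_at X p + poly_at X q"
  by (induction p q rule: poly_induct2) (simp_all add: const_poly_add algebra_simps)

lemma poly_at_smult: "poly_at X (smult c p) = const_poly c * poly_at X p"
  by (induction p) (simp_all add: const_poly_mult algebra_simps)

lemma poly_at_linear_mult: "poly_at X ([:- d, 1:] * q) = (X - const_poly d) * poly_at X q"
proof -
  have "[:- d, 1:] * q = smult (- d) q + pCons 0 q" by simp
  then show ?thesis
    by (simp only: poly_at_add poly_at_smult poly_at_pCons) (simp add: const_poly_uminus algebra_simps)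
qed

lemma poly_at_sum: "poly_at X (\<Sum>c\<in>A. p c) = (\<Sum>c\<in>A. poly_at X (p c))"
  by (induction A rule: infinite_finite_induct) (auto simp: poly_at_add)

lemma poly_at_prod_linear:
  "finite A \<Longrightarrow> poly_at X (\<Prod>c\<in>A. [:- c, 1:]) = (\<Prod>c\<in>A. X - const_poly c)"
proof (induction A rule: finite_induct)
  case (insert c A)
  then show ?case
    by (simp only: prod.insert poly_at_linear_mult not_False_eq_True)
qed (simp add: one_pCons)

lemma ideal_module: "Modules.module ((*) :: 'i cpoly \<Rightarrow> 'i cpoly \<Rightarrow> 'i cpoly)"
  by unfold_locales (auto simp: algebra_simps)

abbreviation ideal_span :: "'i cpoly set \<Rightarrow> 'i cpoly set" where
  "ideal_span \<equiv> Modules.module.span (*)"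

abbreviation is_ideal :: "'i cpoly set \<Rightarrow> bool" where
  "is_ideal \<equiv> Modules.module.subspace (*)"

lemmas is_ideal_def = Modules.module.subspace_def[OF ideal_module]
lemmas is_ideal_0 = Modules.module.subspace_0[OF ideal_module]
lemmas is_ideal_add = Modules.module.subspace_add[OF ideal_module]
lemmas is_ideal_diff = Modules.module.subspace_diff[OF ideal_module]
lemmas is_ideal_scale = Modules.module.subspace_scale[OF ideal_module]
lemmas is_ideal_sum = Modules.module.subspace_sum[OF ideal_module]
lemmas is_ideal_span = Modules.module.subspace_span[OF ideal_module]
lemmas ideal_span_superset = Modules.module.span_superset[OF ideal_module]
lemmas ideal_span_insert = Modules.module.span_insert[OF ideal_module]
lemmas ideal_span_eq_iff = Modules.module.span_eq_iff[OF ideal_module]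
lemmas ideal_span_explicit = Modules.module.span_explicit[OF ideal_module]

lemma countable_exponents: "countable (UNIV :: (nat \<Rightarrow>\<^sub>0 nat) set)"
proof (rule countable_image_inj_on)
  let ?g = "\<lambda>a. (\<lambda>i. (i, Poly_Mapping.lookup a i)) ` Poly_Mapping.keys (a :: nat \<Rightarrow>\<^sub>0 nat)"
  show "countable (range ?g)"
    by (rule countable_subset[OF _ countable_Collect_finite]) auto
  show "inj_on ?g UNIV"
  proof (rule inj_onI)
    fix a b assume eq: "?g a = ?g b"
    have mem: "(i, v) \<in> ?g c \<longleftrightarrow> Poly_Mapping.lookup c i = v \<and> v \<noteq> 0" for i v c
      by (auto simp: in_keys_iff image_iff)
    have "Poly_Mapping.lookup a i = v \<and> v \<noteq> 0 \<longleftrightarrow> Poly_Mapping.lookup b i = v \<and> v \<noteq> 0" for i v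
      using mem[of i v a] mem[of i v b] unfolding eq by simp
    then have "Poly_Mapping.lookup a i = Poly_Mapping.lookup b i" for i
      by (metis (full_types))
    then show "a = b" by (rule poly_mapping_eqI)
  qed
qed

lemma uncountable_complex: "uncountable (UNIV :: complex set)"
proof
  assume "countable (UNIV :: complex set)"
  then have "countable (range complex_of_real)" by (rule countable_subset[rotated]) simp
  then have "countable (UNIV :: real set)"
    by (rule countable_image_inj_on) (auto simp: inj_on_def)
  then show False using uncountable_UNIV_real by simp
qed

text \<open>A polynomial has finitely many monomials out of countably many, so infinitely many members of
  an uncountable family share their monomials and live in one finite-dimensional space.\<close>

lemma dependent_of_uncountable_family:
  fixes h :: "complex \<Rightarrow> nat cpoly"
  shows "\<exists>T z. finite T \<and> (\<exists>c\<in>T. z c \<noteq> 0) \<and> (\<Sum>c\<in>T. const_poly (z c) * h c) = 0"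
proof -
  have "\<exists>K. infinite {c. Poly_Mapping.keys (h c) = K}"
  proof (rule ccontr)
    assume "\<not> ?thesis"
    then have fin: "finite {c. Poly_Mapping.keys (h c) = K}" for K by simp
    have "countable {K :: (nat \<Rightarrow>\<^sub>0 nat) set. finite K}"
      using countable_Collect_finite_subset[OF countable_exponents] by simp
    then have "countable (\<Union>K\<in>{K. finite K}. {c. Poly_Mapping.keys (h c) = K})"
      by (rule countable_UN) (rule countable_finite[OF fin])
    also have "(\<Union>K\<in>{K. finite K}. {c. Poly_Mapping.keys (h c) = K}) = UNIV"
    proof (intro equalityI subsetI)
      show "c \<in> (\<Union>K\<in>{K. finite K}. {c. Poly_Mapping.keys (h c) = K})" for c
        by (rule UN_I[of "Poly_Mapping.keys (h c)"]) simp_all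
    qed simp
    finally show False using uncountable_complex by simp
  qed
  then obtain K where K: "infinite {c. Poly_Mapping.keys (h c) = K}" by blast
  obtain T where T: "T \<subseteq> {c. Poly_Mapping.keys (h c) = K}" "card T = Suc (card K)" "finite T"
    using infinite_arbitrarily_large[OF K, of "Suc (card K)"] by blast
  then obtain c0 where "c0 \<in> T" by fastforce
  then have finK: "finite K" using T(1) by auto
  obtain z where z: "\<exists>c\<in>T. z c \<noteq> 0" "\<forall>a\<in>K. (\<Sum>c\<in>T. Poly_Mapping.lookup (h c) a * z c) = 0"
    using underdetermined_system[OF finK T(3), of "\<lambda>a c. Poly_Mapping.lookup (h c) a"] T(2) by auto
  have "(\<Sum>c\<in>T. const_poly (z c) * h c) = 0"
  proof (rule poly_mapping_eqI)
    fix a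
    have "(\<Sum>c\<in>T. z c * Poly_Mapping.lookup (h c) a) = 0"
    proof (cases "a \<in> K")
      case True
      then show ?thesis using z(2) by (simp add: mult.commute)
    next
      case False
      have "Poly_Mapping.lookup (h c) a = 0" if "c \<in> T" for c
        using that False T(1) by (auto simp: in_keys_iff)
      then show ?thesis by simp
    qed
    then show "Poly_Mapping.lookup (\<Sum>c\<in>T. const_poly (z c) * h c) a = Poly_Mapping.lookup 0 a"
      by (simp add: lookup_sum lookup_const_mult)
  qed
  then show ?thesis using z(1) T(3) by blast
qed

text \<open>Let \<open>M\<close> be a maximal ideal containing \<open>G\<close>. If no \<open>X - c\<close> lay in \<open>M\<close>, all the inverses of \<open>X - c\<close>
  modulo \<open>M\<close> would exist; by uncountability they are linearly dependent, and clearing denominators in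
  a dependency gives a nonzero univariate polynomial at \<open>X\<close> in \<open>M\<close>, which splits into linear factors.
  So every variable is congruent to a constant, and these constants form a common zero.\<close>

theorem weak_nullstellensatz:
  fixes G :: "nat cpoly set"
  assumes no_zero: "\<And>x. \<exists>g\<in>G. peval g x \<noteq> 0"
  shows "1 \<in> ideal_span G"
proof (rule ccontr)
  assume "1 \<notin> ideal_span G"
  define A where "A = {J. is_ideal J \<and> G \<subseteq> J \<and> 1 \<notin> J}"
  have "\<exists>M\<in>A. \<forall>J\<in>A. M \<subseteq> J \<longrightarrow> J = M"
  proof (rule subset_Zorn_nonempty)
    have "ideal_span G \<in> A"
      using \<open>1 \<notin> ideal_span G\<close> ideal_span_superset by (auto simp: A_def is_ideal_span)
    then show "A \<noteq> {}" by auto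
  next
    fix C assume C: "C \<noteq> {}" "subset.chain A C"
    have CA: "C \<subseteq> A" and tot: "\<And>X Y. X \<in> C \<Longrightarrow> Y \<in> C \<Longrightarrow> X \<subseteq> Y \<or> Y \<subseteq> X"
      using C(2) by (auto simp: subset_chain_def)
    have "is_ideal (\<Union>C)"
      unfolding is_ideal_def
    proof (intro conjI ballI allI)
      show "0 \<in> \<Union>C" using C(1) CA by (auto simp: A_def is_ideal_def)
      show "x + y \<in> \<Union>C" if xy: "x \<in> \<Union>C" "y \<in> \<Union>C" for x y
      proof -
        obtain X Y where "X \<in> C" "Y \<in> C" "x \<in> X" "y \<in> Y" using xy by blast
        then obtain Z where Z: "Z \<in> C" "x \<in> Z" "y \<in> Z" using tot[of X Y] by blast
        then have "is_ideal Z" using CA by (auto simp: A_def)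
        then have "x + y \<in> Z" using Z by (simp add: is_ideal_add)
        then show ?thesis using Z by blast
      qed
      show "c * x \<in> \<Union>C" if "x \<in> \<Union>C" for c x
        using that CA unfolding A_def is_ideal_def by blast
    qed
    then show "\<Union>C \<in> A" using C(1) CA by (auto simp: A_def)
  qed
  then obtain M where M: "M \<in> A" and max: "\<And>J. J \<in> A \<Longrightarrow> M \<subseteq> J \<Longrightarrow> J = M" by blast
  have sub: "is_ideal M" and GM: "G \<subseteq> M" and M1: "1 \<notin> M" using M by (auto simp: A_def)
  have inverse: "\<exists>h. 1 - h * f \<in> M" if "f \<notin> M" for f
  proof -
    have "ideal_span (insert f M) \<noteq> M" using that ideal_span_superset[of "insert f M"] by blast
    moreover have "M \<subseteq> ideal_span (insert f M)" using ideal_span_superset[of "insert f M"] by blast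
    ultimately have "ideal_span (insert f M) \<notin> A" using max by blast
    then have "1 \<in> ideal_span (insert f M)"
      using GM ideal_span_superset[of "insert f M"] by (auto simp: A_def is_ideal_span)
    then show ?thesis
      using ideal_span_eq_iff[THEN iffD2, OF sub] by (auto simp: ideal_span_insert)
  qed
  have prime: "f \<in> M" if "(X - const_poly d) * f \<in> M" and out: "X - const_poly d \<notin> M" for X d f
  proof -
    obtain h where "1 - h * (X - const_poly d) \<in> M" using inverse[OF out] by blast
    then have "f * (1 - h * (X - const_poly d)) \<in> M" using is_ideal_scale[OF sub] by blast
    moreover have "h * ((X - const_poly d) * f) \<in> M" using is_ideal_scale[OF sub \<open>(X - const_poly d) * f \<in> M\<close>] .
    ultimately have "f * (1 - h * (X - const_poly d)) + h * ((X - const_poly d) * f) \<in> M"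
      by (rule is_ideal_add[OF sub])
    moreover have "f * (1 - h * Y) + h * (Y * f) = f" for Y
      by (simp add: right_diff_distrib mult_ac)
    ultimately show ?thesis by simp
  qed
  have unit: "c = 0" if "const_poly c \<in> M" for c
  proof (rule ccontr)
    assume "c \<noteq> 0"
    have "const_poly (1 / c) * const_poly c \<in> M" using is_ideal_scale[OF sub that] .
    then show False using M1 \<open>c \<noteq> 0\<close> by (simp flip: const_poly_mult)
  qed
  have root: "\<exists>d. X - const_poly d \<in> M" if "poly_at X p \<in> M" "p \<noteq> 0" for X p
    using that
  proof (induction "degree p" arbitrary: p rule: less_induct)
    case less
    show ?case
    proof (cases "degree p = 0")
      case True
      then obtain a where "p = [:a:]" by (rule degree_eq_zeroE)
      then show ?thesis using less.prems unit[of a] by simp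
    next
      case False
      then obtain d where "poly p d = 0"
        using fundamental_theorem_of_algebra[of p] by (auto simp: constant_degree)
      then obtain q where q: "p = [:- d, 1:] * q" by (auto simp: poly_eq_0_iff_dvd dvd_def)
      have "q \<noteq> 0" using q less.prems by auto
      then have "degree q < degree p" unfolding q by (subst degree_mult_eq) auto
      moreover have "(X - const_poly d) * poly_at X q \<in> M"
        using less.prems(1) unfolding q poly_at_linear_mult .
      ultimately show ?thesis using less.hyps[of q] prime[of X d "poly_at X q"] \<open>q \<noteq> 0\<close> by blast
    qed
  qed
  have "\<exists>d. X - const_poly d \<in> M" for X
  proof (rule ccontr)
    assume none: "\<nexists>d. X - const_poly d \<in> M"
    then have "\<forall>c. \<exists>h. 1 - h * (X - const_poly c) \<in> M" using inverse by blast
    then obtain h where h: "\<And>c. 1 - h c * (X - const_poly c) \<in> M" by metis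
    obtain T z where T: "finite T" and z: "\<exists>c\<in>T. z c \<noteq> 0" "(\<Sum>c\<in>T. const_poly (z c) * h c) = 0"
      using dependent_of_uncountable_family[of h] by blast
    define p where "p = (\<Sum>c\<in>T. smult (z c) (\<Prod>c'\<in>T - {c}. [:- c', 1:]))"
    obtain c0 where c0: "c0 \<in> T" "z c0 \<noteq> 0" using z(1) by blast
    have "poly p c0 = (\<Sum>c\<in>T. if c = c0 then z c * (\<Prod>c'\<in>T - {c}. c0 - c') else 0)"
      unfolding p_def poly_sum
      using T c0 by (intro sum.cong) (auto simp: poly_prod prod_zero_iff)
    also have "\<dots> \<noteq> 0" using T c0 by (simp add: prod_zero_iff)
    finally have "p \<noteq> 0" by auto
    have step: "const_poly (z c) * (\<Prod>c'\<in>T - {c}. X - const_poly c')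
        = const_poly (z c) * (\<Prod>c'\<in>T - {c}. X - const_poly c') * (1 - h c * (X - const_poly c))
          + (\<Prod>c'\<in>T. X - const_poly c') * (const_poly (z c) * h c)" if "c \<in> T" for c
    proof -
      have "z * R = z * R * (1 - h * Y) + Y * R * (z * h)" for z R h Y :: "nat cpoly"
        by (simp add: algebra_simps)
      then show ?thesis unfolding prod.remove[OF T that, of "\<lambda>c'. X - const_poly c'"] .
    qed
    have "poly_at X p = (\<Sum>c\<in>T. const_poly (z c) * (\<Prod>c'\<in>T - {c}. X - const_poly c'))"
      unfolding p_def poly_at_sum poly_at_smult using T by (simp add: poly_at_prod_linear)
    also have "\<dots> = (\<Sum>c\<in>T. const_poly (z c) * (\<Prod>c'\<in>T - {c}. X - const_poly c') * (1 - h c * (X - const_poly c)))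
        + (\<Prod>c'\<in>T. X - const_poly c') * (\<Sum>c\<in>T. const_poly (z c) * h c)"
      unfolding sum_distrib_left sum.distrib[symmetric] by (intro sum.cong refl) (rule step)
    also have "\<dots> = (\<Sum>c\<in>T. const_poly (z c) * (\<Prod>c'\<in>T - {c}. X - const_poly c') * (1 - h c * (X - const_poly c)))"
      by (simp add: z(2))
    also have "\<dots> \<in> M"
      by (intro is_ideal_sum[OF sub] is_ideal_scale[OF sub] h)
    finally show False using root \<open>p \<noteq> 0\<close> none by blast
  qed
  then have "\<forall>i. \<exists>d. var_poly i - const_poly d \<in> M" by blast
  then obtain x where x: "\<And>i. var_poly i - const_poly (x i) \<in> M" by metis
  have residue: "F - const_poly (peval F x) \<in> M" for F
  proof (induction F rule: cpoly_induct)
    case (1 c)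
    then show ?case using is_ideal_0[OF sub] by simp
  next
    case (2 i)
    then show ?case using x by simp
  next
    case (3 F G)
    have eq: "F + G - const_poly (peval (F + G) x) = (F - const_poly (peval F x)) + (G - const_poly (peval G x))"
      by (simp add: peval_add const_poly_add)
    show ?case unfolding eq by (rule is_ideal_add[OF sub 3])
  next
    case (4 F G)
    have "F * G - a * b = G * (F - a) + a * (G - b)" for a b :: "nat cpoly"
      by (simp add: algebra_simps)
    then show ?case
      unfolding peval_mult const_poly_mult
      by (simp only: is_ideal_add[OF sub is_ideal_scale[OF sub 4(1)] is_ideal_scale[OF sub 4(2)]])
  qed
  obtain g where g: "g \<in> G" "peval g x \<noteq> 0" using no_zero by blast
  have "g \<in> M" using g(1) GM by blast
  then have "g - (g - const_poly (peval g x)) \<in> M" by (rule is_ideal_diff[OF sub _ residue])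
  then have "const_poly (peval g x) \<in> M" by simp
  then show False using unit g(2) by blast
qed

section \<open>Linear spaces of matrices of bounded nullity\<close>

text \<open>Contracting a tensor with \<open>x\<close> along its first index gives a linear family of matrices. Both
  \<open>A\<^sub>\<alpha>\<close> and, after exchanging the outer indices of the tensor, \<open>M\<^sub>v\<^sup>t\<close> are families of this form.\<close>

definition contract :: "nat \<Rightarrow> (nat \<times> nat \<times> nat \<Rightarrow> complex) \<Rightarrow> (nat \<Rightarrow> complex) \<Rightarrow> nat \<Rightarrow> nat \<Rightarrow> complex" where
  "contract a \<phi> x j k = (\<Sum>i<a. \<phi> (i, j, k) * x i)"

definition nontrivial :: "nat \<Rightarrow> (nat \<Rightarrow> complex) \<Rightarrow> bool" where
  "nontrivial a x \<longleftrightarrow> (\<exists>i<a. x i \<noteq> 0)"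

text \<open>Along each diagonal the entries are the values of a polynomial at \<open>0, 1, 2, \<dots>\<close>, and the
  parameters belonging to that diagonal are its coefficients. A diagonal of length
  \<open>L\<close> gets \<open>L - (q - k)\<close> of them, for a total of \<open>k (p + k - q)\<close>, and a nonzero polynomial with so few coefficients has at least \<open>q + 1 - k\<close> nonzero
  values. On the first diagonal that is not zero these entries are the diagonal of a triangular
  submatrix, so no nonzero kernel vector is supported on its columns.\<close>

lemma exists_space_of_bounded_nullity:
  assumes a: "a \<le> k * (p + k - q)" and k: "1 \<le> k" "k \<le> q" "q \<le> p + k"
  shows "\<exists>\<phi>. \<forall>x. nontrivial a x \<longrightarrow> \<not> nullity_ge p q k (contract a \<phi> x)"
proof -
  define t where "t = p + k - q"
  define u where "u i = i div k" for i
  define w where "w i = i mod k" for i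
  have u: "u i < t" if "i < a" for i
    unfolding u_def using that a by (intro less_mult_imp_div_less) (simp add: t_def mult.commute)
  have w: "w i < k" for i using k by (simp add: w_def)
  have i_eq: "i = u i * k + w i" for i by (simp add: u_def w_def)
  define \<phi> :: "nat \<times> nat \<times> nat \<Rightarrow> complex"
    where "\<phi> = (\<lambda>(i, j, l). if u i + l = w i + j then of_nat (min j l) ^ min (u i) (w i) else 0)"
  have "\<not> nullity_ge p q k (contract a \<phi> x)" if nt: "nontrivial a x" for x
  proof
    assume null: "nullity_ge p q k (contract a \<phi> x)"
    define diag where "diag i = int (u i) - int (w i)" for i
    let ?S = "{i. i < a \<and> x i \<noteq> 0}"
    have S: "finite ?S" "?S \<noteq> {}" using nt by (auto simp: nontrivial_def)
    obtain i0 where i0: "i0 < a" "x i0 \<noteq> 0" and min0: "\<And>i. i < a \<Longrightarrow> x i \<noteq> 0 \<Longrightarrow> diag i0 \<le> diag i"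
      using ex_is_arg_min_if_finite[OF S, of diag] by (auto simp: is_arg_min_linorder)
    \<comment> \<open>A diagonal starts at row \<open>dp\<close> and column \<open>dm\<close>, one of which is zero.\<close>
    define dp where "dp = nat (diag i0)"
    define dm where "dm = nat (- diag i0)"
    have d0: "dp = 0 \<or> dm = 0" "int dp - int dm = diag i0" by (auto simp: dp_def dm_def)
    let ?s = "\<lambda>i. min (u i) (w i)"
    let ?D = "{i. i < a \<and> diag i = diag i0}"
    have uw: "u i = ?s i + dp" "w i = ?s i + dm" if "i \<in> ?D" for i
      using that d0 by (auto simp: diag_def)
    have inj: "inj_on ?s ?D"
    proof (rule inj_onI)
      fix i i' assume "i \<in> ?D" "i' \<in> ?D" "?s i = ?s i'"
      then have "u i = u i'" "w i = w i'" using uw by metis+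
      then show "i = i'" using i_eq[of i] i_eq[of i'] by simp
    qed
    define P where "P = (\<Sum>i\<in>?D. monom (x i) (?s i))"
    have "coeff P (?s i0) = (\<Sum>i\<in>?D. if i = i0 then x i else 0)"
      unfolding P_def coeff_sum
      by (intro sum.cong) (use inj i0 in \<open>auto simp: inj_on_def\<close>)
    also have "\<dots> = x i0" using i0 by simp
    finally have "P \<noteq> 0" using i0 by auto
    define m where "m = min (t - dp) (k - dm)"
    have s_less: "?s i < m" if "i \<in> ?D" for i
      using uw[OF that] u[of i] w[of i] that unfolding m_def by auto
    have "m \<ge> 1" using s_less[of i0] i0 by simp
    have "degree P \<le> m - 1"
      unfolding P_def by (intro degree_sum_le) (use s_less in \<open>force simp: degree_monom_eq intro: order.trans[OF degree_monom_le]\<close>)+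
    define L where "L = m + q - k"
    define Z where "Z = {\<tau>. \<tau> < L \<and> poly P (of_nat \<tau>) = 0}"
    define N where "N = {\<tau>. \<tau> < L \<and> poly P (of_nat \<tau>) \<noteq> 0}"
    have "card Z \<le> card {z. poly P z = 0}"
      by (rule card_inj_on_le[of "of_nat"]) (use \<open>P \<noteq> 0\<close> poly_roots_finite in \<open>auto simp: Z_def inj_on_def\<close>)
    also have "\<dots> \<le> m - 1" using card_poly_roots_bound[OF \<open>P \<noteq> 0\<close>] \<open>degree P \<le> m - 1\<close> by simp
    finally have "card Z \<le> m - 1" .
    moreover have "card Z + card N = L"
    proof -
      have "Z \<union> N = {..<L}" "Z \<inter> N = {}" by (auto simp: Z_def N_def)
      moreover have "finite Z" "finite N" by (auto simp: Z_def N_def)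
      ultimately show ?thesis using card_Un_disjoint[of Z N] by simp
    qed
    ultimately have cardN: "q < card N + k" using \<open>m \<ge> 1\<close> k by (auto simp: L_def)
    define C where "C = (\<lambda>\<tau>. \<tau> + dm) ` N"
    have "card C = card N" unfolding C_def by (intro card_image) (auto simp: inj_on_def)
    moreover have "C \<subseteq> {..<q}" using k \<open>m \<ge> 1\<close> by (auto simp: C_def N_def L_def m_def)
    ultimately have "\<exists>y. (\<exists>i\<in>C. y i \<noteq> 0) \<and> (\<forall>i. i \<notin> C \<longrightarrow> y i = 0) \<and>
        (\<forall>j<p. (\<Sum>i<q. contract a \<phi> x j i * y i) = 0)"
      using null cardN unfolding nullity_ge_def by metis
    then obtain y where y: "\<exists>i\<in>C. y i \<noteq> 0" "\<And>i. i \<notin> C \<Longrightarrow> y i = 0"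
      and ker: "\<And>j. j < p \<Longrightarrow> (\<Sum>i<q. contract a \<phi> x j i * y i) = 0" by blast
    \<comment> \<open>Triangularity: in the row through the first nonzero coordinate only that coordinate counts.\<close>
    define l where "l = (LEAST i. y i \<noteq> 0)"
    obtain i1 where "y i1 \<noteq> 0" using y(1) by blast
    then have l: "y l \<noteq> 0" unfolding l_def by (rule LeastI)
    have l_min: "\<And>i. i < l \<Longrightarrow> y i = 0"
      unfolding l_def by (auto dest: not_less_Least)
    obtain \<tau> where \<tau>: "\<tau> \<in> N" "l = \<tau> + dm" using l y(2)[of l] by (auto simp: C_def)
    define j where "j = \<tau> + dp"
    have "j < p" using \<tau> k \<open>m \<ge> 1\<close> by (auto simp: j_def N_def L_def m_def t_def)
    have "l < q" using \<tau> k \<open>m \<ge> 1\<close> by (auto simp: N_def L_def m_def)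
    have "min j l = \<tau>" using d0 \<tau> by (auto simp: j_def)
    have zero: "contract a \<phi> x j l' = 0" if "l < l'" for l'
      unfolding contract_def
    proof (rule sum.neutral, intro ballI)
      fix i assume "i \<in> {..<a}"
      show "\<phi> (i, j, l') * x i = 0"
      proof (cases "u i + l' = w i + j")
        case True
        then have "diag i < diag i0" using that \<tau> d0 by (simp add: diag_def j_def)
        then have "x i = 0" using min0[of i] \<open>i \<in> {..<a}\<close> by auto
        then show ?thesis by simp
      qed (simp add: \<phi>_def)
    qed
    have "(\<Sum>i<q. contract a \<phi> x j i * y i) = (\<Sum>i<q. if i = l then contract a \<phi> x j l * y l else 0)"
    proof (intro sum.cong refl)
      fix i assume "i \<in> {..<q}"
      show "contract a \<phi> x j i * y i = (if i = l then contract a \<phi> x j l * y l else 0)"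
        using zero[of i] l_min[of i] by (cases i l rule: linorder_cases) auto
    qed
    then have "contract a \<phi> x j l = 0" using ker[OF \<open>j < p\<close>] l \<open>l < q\<close> by simp
    moreover have "contract a \<phi> x j l = (\<Sum>i\<in>?D. x i * of_nat \<tau> ^ ?s i)"
    proof -
      have "contract a \<phi> x j l = (\<Sum>i<a. if diag i = diag i0 then x i * of_nat \<tau> ^ ?s i else 0)"
        unfolding contract_def
      proof (intro sum.cong refl)
        fix i
        have "u i + l = w i + j \<longleftrightarrow> diag i = diag i0" using d0 \<tau> by (auto simp: diag_def j_def)
        then show "\<phi> (i, j, l) * x i = (if diag i = diag i0 then x i * of_nat \<tau> ^ ?s i else 0)"
          by (simp add: \<phi>_def \<open>min j l = \<tau>\<close>)
      qed
      also have "\<dots> = (\<Sum>i\<in>?D. x i * of_nat \<tau> ^ ?s i)"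
        by (subst sum.inter_filter[symmetric]) (auto intro: sum.cong)
      finally show ?thesis .
    qed
    moreover have "poly P (of_nat \<tau>) = (\<Sum>i\<in>?D. x i * of_nat \<tau> ^ ?s i)"
      by (simp add: P_def poly_sum poly_monom)
    ultimately show False using \<tau> by (simp add: N_def)
  qed
  then show ?thesis by blast
qed

section \<open>Elimination theory for forms\<close>

text \<open>Splitting off the last variable reduces the claim to univariate polynomials, which have
  finitely many roots. It lets identities between functions be compared coefficient by coefficient.\<close>

lemma mono_fun_independent:
  assumes "finite B" "\<And>b i. b \<in> B \<Longrightarrow> i \<ge> d \<Longrightarrow> b i = 0"
    and "\<And>x. (\<Sum>b\<in>B. c b * mono_fun d b x) = 0" "b \<in> B"
  shows "c b = 0"
  using assms
proof (induction d arbitrary: B c b)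
  case 0
  have "b' = b" if "b' \<in> B" for b'
    using 0(2)[of b'] 0(2)[of b] that \<open>b \<in> B\<close> by (auto simp: fun_eq_iff)
  then have "B = {b}" using \<open>b \<in> B\<close> by blast
  then show ?case using 0(3)[of "\<lambda>_. 0"] by (simp add: mono_fun_def)
next
  case (Suc d)
  define n where "n = b d"
  define B' where "B' k = {b\<in>B. b d = k}" for k
  have fin: "finite (B' k)" for k using Suc.prems(1) by (simp add: B'_def)
  define N where "N = Max ((\<lambda>b. b d) ` B)"
  have N: "b d \<le> N" if "b \<in> B" for b using that Suc.prems(1) by (auto simp: N_def)
  have "(\<Sum>b\<in>B' n. c b * mono_fun d b x) = 0" for x
  proof -
    define p where "p = (\<Sum>k\<le>N. monom (\<Sum>b\<in>B' k. c b * mono_fun d b x) k)"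
    have "poly p t = 0" for t
    proof -
      have "poly p t = (\<Sum>k\<le>N. \<Sum>b\<in>B' k. c b * mono_fun d b x * t ^ b d)"
        unfolding p_def poly_sum poly_monom sum_distrib_right
        by (intro sum.cong) (auto simp: B'_def)
      also have "\<dots> = (\<Sum>b\<in>B. c b * mono_fun d b x * t ^ b d)"
        unfolding B'_def by (rule sum.group) (use Suc.prems(1) N in auto)
      also have "\<dots> = (\<Sum>b\<in>B. c b * mono_fun (Suc d) b (x(d := t)))"
        by (intro sum.cong refl) (simp add: mono_fun_def)
      finally show ?thesis using Suc.prems(3) by simp
    qed
    then have "p = 0" using poly_all_0_iff_0 by blast
    then have "coeff p n = 0" by simp
    moreover have "coeff p n = (\<Sum>b\<in>B' n. c b * mono_fun d b x)"
      using N[OF \<open>b \<in> B\<close>] by (simp add: p_def coeff_sum n_def)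
    ultimately show ?thesis by simp
  qed
  \<comment> \<open>Once the exponent of the last variable is fixed, it may be erased.\<close>
  define e where "e b = b(d := 0)" for b :: "nat \<Rightarrow> nat"
  have inj: "inj_on e (B' n)"
    unfolding inj_on_def e_def B'_def by (metis (mono_tags, lifting) fun_upd_triv fun_upd_upd mem_Collect_eq)
  define c' where "c' b = c (b(d := n))" for b
  have c': "c' (e b) = c b" if "b \<in> B' n" for b
    using that by (auto simp: c'_def e_def B'_def)
  have "c' (e b) = 0"
  proof (rule Suc.IH[of "e ` B' n" c' "e b"])
    show "finite (e ` B' n)" using fin by simp
    show "b' i = 0" if "b' \<in> e ` B' n" "i \<ge> d" for b' i
      using that Suc.prems(2) by (cases "i = d") (auto simp: e_def B'_def)
    show "e b \<in> e ` B' n" using \<open>b \<in> B\<close> by (auto simp: B'_def n_def)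
    show "(\<Sum>b\<in>e ` B' n. c' b * mono_fun d b x) = 0" for x
    proof -
      have "mono_fun d (e b) x = mono_fun d b x" for b
        unfolding mono_fun_def e_def by (intro prod.cong) auto
      then have "(\<Sum>b\<in>e ` B' n. c' b * mono_fun d b x) = (\<Sum>b\<in>B' n. c b * mono_fun d b x)"
        using inj by (simp add: sum.reindex c')
      then show ?thesis using \<open>(\<Sum>b\<in>B' n. c b * mono_fun d b x) = 0\<close> by simp
    qed
  qed
  then show ?case using c'[of b] \<open>b \<in> B\<close> by (simp add: B'_def n_def)
qed

text \<open>Large powers of \<open>x i\<close> clear the denominators of \<open>f (x / x i)\<close> and leave a form. Coordinates from
  \<open>a\<close> on are set to zero, as polynomials here may involve any variable.\<close>

definition homogenizable :: "nat \<Rightarrow> nat \<Rightarrow> ((nat \<Rightarrow> complex) \<Rightarrow> complex) \<Rightarrow> bool" where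
  "homogenizable a i f \<longleftrightarrow> (\<exists>N0. \<forall>N\<ge>N0. \<exists>H\<in>formfun a N.
     \<forall>x. x i \<noteq> 0 \<and> (\<forall>j\<ge>a. x j = 0) \<longrightarrow> H x = x i ^ N * f (\<lambda>j. x j / x i))"

lemma homogenizable_peval:
  assumes i: "i < a" shows "homogenizable a i (peval F)"
proof (rule peval_closed[where I = UNIV])
  show "F \<in> poly_in UNIV" by (simp add: poly_in_def)
  show "homogenizable a i (\<lambda>x. c)" for c
    unfolding homogenizable_def
  proof (intro exI[of _ 0] allI impI)
    fix N
    have "(\<lambda>x. c * x i ^ N) \<in> formfun a N"
      using formfun_scale[OF formfun_power[OF formfun_var[OF i], of N], of c] by simp
    then show "\<exists>H\<in>formfun a N. \<forall>x. x i \<noteq> 0 \<and> (\<forall>j\<ge>a. x j = 0) \<longrightarrow> H x = x i ^ N * c"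
      by (rule bexI[rotated]) simp
  qed
  show "homogenizable a i (\<lambda>x. x l)" for l
    unfolding homogenizable_def
  proof (intro exI[of _ 1] allI impI)
    fix N :: nat assume "1 \<le> N"
    then obtain M where N: "N = Suc M" by (cases N) auto
    show "\<exists>H\<in>formfun a N. \<forall>x. x i \<noteq> 0 \<and> (\<forall>j\<ge>a. x j = 0) \<longrightarrow> H x = x i ^ N * (x l / x i)"
    proof (cases "l < a")
      case True
      have "(\<lambda>x. x l * x i ^ M) \<in> formfun a N"
        using formfun_mult[OF formfun_var[OF True] formfun_power[OF formfun_var[OF i], of M]] N by simp
      then show ?thesis by (rule bexI[rotated]) (simp add: N)
    next
      case False
      then show ?thesis by (intro bexI[OF _ formfun_0]) auto
    qed
  qed
  fix f g assume "homogenizable a i f" "homogenizable a i g"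
  then obtain N1 N2
    where f: "\<And>N. N \<ge> N1 \<Longrightarrow> \<exists>H\<in>formfun a N. \<forall>x. x i \<noteq> 0 \<and> (\<forall>j\<ge>a. x j = 0) \<longrightarrow> H x = x i ^ N * f (\<lambda>j. x j / x i)"
      and g: "\<And>N. N \<ge> N2 \<Longrightarrow> \<exists>H\<in>formfun a N. \<forall>x. x i \<noteq> 0 \<and> (\<forall>j\<ge>a. x j = 0) \<longrightarrow> H x = x i ^ N * g (\<lambda>j. x j / x i)"
    unfolding homogenizable_def by blast
  show "homogenizable a i (\<lambda>x. f x + g x)"
    unfolding homogenizable_def
  proof (intro exI[of _ "max N1 N2"] allI impI)
    fix N assume "max N1 N2 \<le> N"
    then obtain H K where H: "H \<in> formfun a N" "\<And>x. x i \<noteq> 0 \<and> (\<forall>j\<ge>a. x j = 0) \<Longrightarrow> H x = x i ^ N * f (\<lambda>j. x j / x i)"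
      and K: "K \<in> formfun a N" "\<And>x. x i \<noteq> 0 \<and> (\<forall>j\<ge>a. x j = 0) \<Longrightarrow> K x = x i ^ N * g (\<lambda>j. x j / x i)"
      using f[of N] g[of N] by auto
    show "\<exists>H\<in>formfun a N. \<forall>x. x i \<noteq> 0 \<and> (\<forall>j\<ge>a. x j = 0) \<longrightarrow>
        H x = x i ^ N * (f (\<lambda>j. x j / x i) + g (\<lambda>j. x j / x i))"
      using H(2) K(2) by (intro bexI[OF _ formfun_add[OF H(1) K(1)]]) (simp add: distrib_left)
  qed
  show "homogenizable a i (\<lambda>x. f x * g x)"
    unfolding homogenizable_def
  proof (intro exI[of _ "N1 + N2"] allI impI)
    fix N assume "N1 + N2 \<le> N"
    then have N: "N - N2 \<ge> N1" "N = (N - N2) + N2" by auto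
    obtain H where H: "H \<in> formfun a (N - N2)" "\<And>x. x i \<noteq> 0 \<and> (\<forall>j\<ge>a. x j = 0) \<Longrightarrow> H x = x i ^ (N - N2) * f (\<lambda>j. x j / x i)"
      using f[OF N(1)] by auto
    obtain K where K: "K \<in> formfun a N2" "\<And>x. x i \<noteq> 0 \<and> (\<forall>j\<ge>a. x j = 0) \<Longrightarrow> K x = x i ^ N2 * g (\<lambda>j. x j / x i)"
      using g[of N2] by auto
    have "x i ^ N = x i ^ (N - N2) * x i ^ N2" for x :: "nat \<Rightarrow> complex"
      using N(2) by (simp flip: power_add)
    then show "\<exists>H\<in>formfun a N. \<forall>x. x i \<noteq> 0 \<and> (\<forall>j\<ge>a. x j = 0) \<longrightarrow>
        H x = x i ^ N * (f (\<lambda>j. x j / x i) * g (\<lambda>j. x j / x i))"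
      using H(2) K(2) formfun_mult[OF H(1) K(1)] N(2)
      by (intro bexI[of _ "\<lambda>x. H x * K x"]) (simp_all add: mult_ac)
  qed
qed

text \<open>On the affine chart where \<open>x i = 1\<close> the forms have no common zero, so the weak Nullstellensatz
  writes \<open>1\<close> as a combination of them. Homogenizing this identity gives a power of \<open>x i\<close>; the bound
  \<open>N0\<close> is uniform so that one exponent serves all variables.\<close>

lemma power_in_ideal:
  fixes f :: "'l \<Rightarrow> (nat \<Rightarrow> complex) \<Rightarrow> complex"
  assumes f: "\<And>l. l \<in> \<Lambda> \<Longrightarrow> f l \<in> formfun a r"
    and no_zero: "\<And>x. nontrivial a x \<Longrightarrow> \<exists>l\<in>\<Lambda>. f l x \<noteq> 0"
    and i: "i < a"
  shows "\<exists>N0. \<forall>N\<ge>N0. \<exists>S H. finite S \<and> S \<subseteq> \<Lambda> \<and> (\<forall>l\<in>S. H l \<in> formfun a N) \<and>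
     (\<forall>x. (\<forall>j\<ge>a. x j = 0) \<longrightarrow> x i ^ (N + r) = (\<Sum>l\<in>S. H l x * f l x))"
proof -
  have "\<forall>l\<in>\<Lambda>. \<exists>F. F \<in> forms a r \<and> peval F = f l" using forms_of_formfun[OF f] by blast
  then obtain F where F: "\<And>l. l \<in> \<Lambda> \<Longrightarrow> peval (F l) = f l" by metis
  define G where "G = insert (var_poly i - const_poly 1) (F ` \<Lambda>)"
  have "1 \<in> ideal_span G"
  proof (rule weak_nullstellensatz)
    fix x :: "nat \<Rightarrow> complex"
    show "\<exists>g\<in>G. peval g x \<noteq> 0"
    proof (cases "x i = 1")
      case True
      then have "nontrivial a x" using i by (auto simp: nontrivial_def)
      then show ?thesis using no_zero[of x] F by (auto simp: G_def)
    next
      case False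
      have "peval (var_poly i - const_poly 1) x + peval (const_poly 1) x = x i"
        unfolding peval_add[symmetric] by simp
      then have "peval (var_poly i - const_poly 1) x \<noteq> 0" using False by auto
      then show ?thesis by (auto simp: G_def)
    qed
  qed
  then obtain T h where T: "finite T" "T \<subseteq> G" and one: "(\<Sum>g\<in>T. h g * g) = 1"
    unfolding ideal_span_explicit by auto
  define T' where "T' = T - {var_poly i - const_poly 1}"
  have "T' \<subseteq> F ` \<Lambda>" "finite T'" using T by (auto simp: T'_def G_def)
  then obtain S where S: "S \<subseteq> \<Lambda>" "finite S" "T' = F ` S" "inj_on F S"
    by (metis finite_image_iff subset_image_inj)
  have chart: "1 = (\<Sum>l\<in>S. peval (h (F l)) x * f l x)" if "x i = 1" for x
  proof -
    have "peval (var_poly i - const_poly 1) x + peval (const_poly 1) x = x i"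
      unfolding peval_add[symmetric] by simp
    then have z: "peval (var_poly i - const_poly 1) x = 0" using that by simp
    have "1 = peval (\<Sum>g\<in>T. h g * g) x" using peval_const[of 1 x] by (simp add: one)
    also have "\<dots> = (\<Sum>g\<in>T. peval (h g) x * peval g x)" by (simp add: peval_sum peval_mult)
    also have "\<dots> = (\<Sum>g\<in>T'. peval (h g) x * peval g x)"
      by (rule sum.mono_neutral_right) (use T z in \<open>auto simp: T'_def\<close>)
    also have "\<dots> = (\<Sum>l\<in>S. peval (h (F l)) x * peval (F l) x)"
      unfolding S(3) using S(4) by (simp add: sum.reindex)
    also have "\<dots> = (\<Sum>l\<in>S. peval (h (F l)) x * f l x)"
      using S(1) F by (intro sum.cong) auto
    finally show ?thesis .
  qed
  have "\<forall>l\<in>S. \<exists>N0. \<forall>N\<ge>N0. \<exists>H\<in>formfun a N.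
      \<forall>x. x i \<noteq> 0 \<and> (\<forall>j\<ge>a. x j = 0) \<longrightarrow> H x = x i ^ N * peval (h (F l)) (\<lambda>j. x j / x i)"
    using homogenizable_peval[OF i] unfolding homogenizable_def by blast
  then obtain N0 where N0: "\<And>l N. l \<in> S \<Longrightarrow> N \<ge> N0 l \<Longrightarrow> \<exists>H\<in>formfun a N.
      \<forall>x. x i \<noteq> 0 \<and> (\<forall>j\<ge>a. x j = 0) \<longrightarrow> H x = x i ^ N * peval (h (F l)) (\<lambda>j. x j / x i)"
    by metis
  define N1 where "N1 = (\<Sum>l\<in>S. N0 l)"
  have "\<exists>S H. finite S \<and> S \<subseteq> \<Lambda> \<and> (\<forall>l\<in>S. H l \<in> formfun a N) \<and>
      (\<forall>x. (\<forall>j\<ge>a. x j = 0) \<longrightarrow> x i ^ (N + r) = (\<Sum>l\<in>S. H l x * f l x))" if "N \<ge> Suc N1" for N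
  proof -
    define M where "M = N - 1"
    have "M \<ge> N0 l" if "l \<in> S" for l
      using member_le_sum[OF that _ S(2), of N0] \<open>N \<ge> Suc N1\<close> by (simp add: N1_def M_def)
    then have "\<forall>l\<in>S. \<exists>H. H \<in> formfun a M \<and>
        (\<forall>x. x i \<noteq> 0 \<and> (\<forall>j\<ge>a. x j = 0) \<longrightarrow> H x = x i ^ M * peval (h (F l)) (\<lambda>j. x j / x i))"
      using N0 by blast
    then obtain H where H: "\<And>l. l \<in> S \<Longrightarrow> H l \<in> formfun a M"
      and Hx: "\<And>l x. l \<in> S \<Longrightarrow> x i \<noteq> 0 \<Longrightarrow> \<forall>j\<ge>a. x j = 0 \<Longrightarrow>
        H l x = x i ^ M * peval (h (F l)) (\<lambda>j. x j / x i)" by metis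
    have "(\<lambda>x. x i * H l x) \<in> formfun a N" if "l \<in> S" for l
      using formfun_mult[OF formfun_var[OF i] H[OF that]] \<open>N \<ge> Suc N1\<close> by (simp add: M_def)
    \<comment> \<open>The extra factor makes the identity true also where the dehomogenizing variable vanishes.\<close>
    moreover have "x i ^ (N + r) = (\<Sum>l\<in>S. x i * H l x * f l x)" if x: "\<forall>j\<ge>a. x j = 0" for x
    proof (cases "x i = 0")
      case False
      have fl: "f l x = x i ^ r * f l (\<lambda>j. x j / x i)" if "l \<in> S" for l
        using formfun_homogeneous[OF f, of l "x i" "\<lambda>j. x j / x i"] that S(1) False by auto
      have "(\<Sum>l\<in>S. x i * H l x * f l x)
          = (\<Sum>l\<in>S. x i ^ (M + 1 + r) * (peval (h (F l)) (\<lambda>j. x j / x i) * f l (\<lambda>j. x j / x i)))"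
        by (intro sum.cong refl) (simp add: fl Hx[OF _ False x] power_add power2_eq_square)
      also have "\<dots> = x i ^ (M + 1 + r)"
        unfolding sum_distrib_left[symmetric] using chart[of "\<lambda>j. x j / x i"] False by simp
      finally show ?thesis using \<open>N \<ge> Suc N1\<close> by (simp add: M_def)
    qed (use \<open>N \<ge> Suc N1\<close> in simp)
    ultimately show ?thesis
      using S by (intro exI[of _ S] exI[of _ "\<lambda>l x. x i * H l x"]) auto
  qed
  then show ?thesis by blast
qed

text \<open>At \<open>\<phi>0\<close> the forms \<open>F l \<phi>0\<close> generate every monomial of a large degree. The same combinations of
  the forms at another \<open>\<phi>\<close> have a matrix of coefficients with respect to the monomials that depends
  polynomially on \<open>\<phi>\<close> and is the identity at \<open>\<phi>0\<close>. Where its determinant \<open>D\<close> is nonzero, a common zero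
  of the forms is a zero of all monomials.\<close>

theorem elimination:
  fixes F :: "'l \<Rightarrow> ('i \<Rightarrow> complex) \<Rightarrow> (nat \<Rightarrow> complex) \<Rightarrow> complex"
  assumes F: "\<And>l. l \<in> \<Lambda> \<Longrightarrow> F l \<in> biform I a r"
    and no_zero: "\<And>x. nontrivial a x \<Longrightarrow> \<exists>l\<in>\<Lambda>. F l \<phi>0 x \<noteq> 0"
  shows "\<exists>D\<in>polyfun I. D \<phi>0 \<noteq> 0 \<and>
    (\<forall>\<phi>. D \<phi> \<noteq> 0 \<longrightarrow> (\<forall>x. nontrivial a x \<longrightarrow> (\<exists>l\<in>\<Lambda>. F l \<phi> x \<noteq> 0)))"
proof -
  have "\<exists>N0. i < a \<longrightarrow> (\<forall>N\<ge>N0. \<exists>S H. finite S \<and> S \<subseteq> \<Lambda> \<and> (\<forall>l\<in>S. H l \<in> formfun a N) \<and>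
     (\<forall>x. (\<forall>j\<ge>a. x j = 0) \<longrightarrow> x i ^ (N + r) = (\<Sum>l\<in>S. H l x * F l \<phi>0 x)))" for i
  proof (cases "i < a")
    case True
    from power_in_ideal[of \<Lambda> "\<lambda>l. F l \<phi>0" a r i, OF formfun_of_biform[OF F] no_zero True]
    show ?thesis by simp
  qed simp
  then have "\<forall>i. \<exists>N0. i < a \<longrightarrow> (\<forall>N\<ge>N0. \<exists>S H. finite S \<and> S \<subseteq> \<Lambda> \<and> (\<forall>l\<in>S. H l \<in> formfun a N) \<and>
     (\<forall>x. (\<forall>j\<ge>a. x j = 0) \<longrightarrow> x i ^ (N + r) = (\<Sum>l\<in>S. H l x * F l \<phi>0 x)))" ..
  from choice[OF this] obtain N0 where N0: "\<forall>i. i < a \<longrightarrow> (\<forall>N\<ge>N0 i. \<exists>S H. finite S \<and> S \<subseteq> \<Lambda> \<and> (\<forall>l\<in>S. H l \<in> formfun a N) \<and>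
     (\<forall>x. (\<forall>j\<ge>a. x j = 0) \<longrightarrow> x i ^ (N + r) = (\<Sum>l\<in>S. H l x * F l \<phi>0 x)))" ..
  define N where "N = (\<Sum>i<a. N0 i)"
  have "\<forall>i. \<exists>S H. i < a \<longrightarrow> finite S \<and> S \<subseteq> \<Lambda> \<and> (\<forall>l\<in>S. H l \<in> formfun a N) \<and>
     (\<forall>x. (\<forall>j\<ge>a. x j = 0) \<longrightarrow> x i ^ (N + r) = (\<Sum>l\<in>S. H l x * F l \<phi>0 x))"
  proof (intro allI)
    fix i
    show "\<exists>S H. i < a \<longrightarrow> finite S \<and> S \<subseteq> \<Lambda> \<and> (\<forall>l\<in>S. H l \<in> formfun a N) \<and>
     (\<forall>x. (\<forall>j\<ge>a. x j = 0) \<longrightarrow> x i ^ (N + r) = (\<Sum>l\<in>S. H l x * F l \<phi>0 x))"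
    proof (cases "i < a")
      case True
      then have "N0 i \<le> N" unfolding N_def by (intro member_le_sum) auto
      then show ?thesis using spec[OF N0, of i] True by simp
    qed blast
  qed
  from choice[OF this] obtain S where "\<forall>i. \<exists>H. i < a \<longrightarrow> finite (S i) \<and> S i \<subseteq> \<Lambda> \<and> (\<forall>l\<in>S i. H l \<in> formfun a N) \<and>
     (\<forall>x. (\<forall>j\<ge>a. x j = 0) \<longrightarrow> x i ^ (N + r) = (\<Sum>l\<in>S i. H l x * F l \<phi>0 x))" ..
  from choice[OF this] obtain H where SH: "\<forall>i. i < a \<longrightarrow> finite (S i) \<and> S i \<subseteq> \<Lambda> \<and> (\<forall>l\<in>S i. H i l \<in> formfun a N) \<and>
     (\<forall>x. (\<forall>j\<ge>a. x j = 0) \<longrightarrow> x i ^ (N + r) = (\<Sum>l\<in>S i. H i l x * F l \<phi>0 x))" ..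
  have S: "\<And>i. i < a \<Longrightarrow> finite (S i)" "\<And>i. i < a \<Longrightarrow> S i \<subseteq> \<Lambda>"
    and H: "\<And>i l. i < a \<Longrightarrow> l \<in> S i \<Longrightarrow> H i l \<in> formfun a N"
    and pow: "\<And>i x. i < a \<Longrightarrow> (\<forall>j\<ge>a. x j = 0) \<Longrightarrow> x i ^ (N + r) = (\<Sum>l\<in>S i. H i l x * F l \<phi>0 x)"
    using SH by simp_all
  define e where "e = N + r"
  define E where "E = expo a (a * e)"
  \<comment> \<open>By the pigeonhole principle a monomial of degree \<open>a * e\<close> is divisible by an \<open>e\<close>-th power.\<close>
  have "\<exists>i<a. e \<le> b i" if "b \<in> E" "a > 0" for b
  proof (rule ccontr)
    assume "\<not> ?thesis"
    then have less: "b i < e" if "i < a" for i using that by auto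
    have "sum b {..<a} < (\<Sum>i<a. e)"
      by (rule sum_strict_mono) (use less \<open>a > 0\<close> in auto)
    then show False using \<open>b \<in> E\<close> by (simp add: E_def expo_def)
  qed
  moreover have "a > 0" if "b \<in> E" "nontrivial a x" for b x
    using that by (auto simp: nontrivial_def)
  ultimately have "\<forall>b. \<exists>i. b \<in> E \<and> a > 0 \<longrightarrow> i < a \<and> e \<le> b i" by blast
  then obtain i where i: "\<And>b. b \<in> E \<Longrightarrow> a > 0 \<Longrightarrow> i b < a" "\<And>b. b \<in> E \<Longrightarrow> a > 0 \<Longrightarrow> e \<le> b (i b)"
    by metis
  show ?thesis
  proof (cases "a = 0")
    case True
    then show ?thesis by (intro bexI[of _ "\<lambda>_. 1"] polyfun_const) (auto simp: nontrivial_def)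
  next
    case False
    then have a: "a > 0" by simp
    define b' where "b' b = b(i b := b (i b) - e)" for b :: "nat \<Rightarrow> nat"
    have b': "b' b \<in> expo a (a * e - e)" "mono_fun a b x = x (i b) ^ e * mono_fun a (b' b) x" if "b \<in> E" for b x
    proof -
      note ib = i[OF that a]
      have "sum b {..<a} = b (i b) + sum b ({..<a} - {i b})"
        using ib(1) by (simp add: sum.remove)
      moreover have "sum (b' b) {..<a} = b' b (i b) + sum (b' b) ({..<a} - {i b})"
        using ib(1) by (simp add: sum.remove)
      moreover have "sum (b' b) ({..<a} - {i b}) = sum b ({..<a} - {i b})"
        by (intro sum.cong) (auto simp: b'_def)
      ultimately show "b' b \<in> expo a (a * e - e)"
        using that ib by (auto simp: expo_def E_def b'_def)
      have "mono_fun a b x = x (i b) ^ b (i b) * (\<Prod>j\<in>{..<a} - {i b}. x j ^ b j)"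
        unfolding mono_fun_def using ib(1) by (simp add: prod.remove)
      moreover have "mono_fun a (b' b) x = x (i b) ^ b' b (i b) * (\<Prod>j\<in>{..<a} - {i b}. x j ^ b' b j)"
        unfolding mono_fun_def using ib(1) by (simp add: prod.remove)
      moreover have "(\<Prod>j\<in>{..<a} - {i b}. x j ^ b' b j) = (\<Prod>j\<in>{..<a} - {i b}. x j ^ b j)"
        by (intro prod.cong) (auto simp: b'_def)
      moreover have "x (i b) ^ b (i b) = x (i b) ^ e * x (i b) ^ b' b (i b)"
        using ib(2) by (simp add: b'_def flip: power_add)
      ultimately show "mono_fun a b x = x (i b) ^ e * mono_fun a (b' b) x" by simp
    qed
    define M where "M b = (\<lambda>\<phi> x. \<Sum>l\<in>S (i b). (H (i b) l x * mono_fun a (b' b) x) * F l \<phi> x)" for b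
    have "M b \<in> biform I a (a * e)" if "b \<in> E" for b
    proof -
      have deg: "N + (a * e - e) + r = a * e"
      proof -
        have "e \<le> a * e" using a by simp
        then show ?thesis unfolding e_def by linarith
      qed
      have mb: "(\<lambda>\<phi>. mono_fun a (b' b)) \<in> biform I a (a * e - e)"
        using formfun_mono[OF b'(1)[OF that]] by (simp add: formfun_iff_biform[where I = I])
      have "(\<lambda>\<phi> x. (H (i b) l x * mono_fun a (b' b) x) * F l \<phi> x) \<in> biform I a (a * e)" if "l \<in> S (i b)" for l
      proof -
        have h: "(\<lambda>\<phi>. H (i b) l) \<in> biform I a N"
          using H[OF i(1)[OF \<open>b \<in> E\<close> a] that] by (simp add: formfun_iff_biform[where I = I])
        have "l \<in> \<Lambda>" using S(2)[OF i(1)[OF \<open>b \<in> E\<close> a]] that by blast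
        from biform_mult[OF biform_mult[OF h mb] F[OF this]] show ?thesis unfolding deg .
      qed
      then show ?thesis unfolding M_def by (rule biform_sum)
    qed
    then have "\<forall>b. \<exists>q. b \<in> E \<longrightarrow> (\<forall>c. q c \<in> polyfun I) \<and> M b = (\<lambda>\<phi> x. \<Sum>c\<in>E. q c \<phi> * mono_fun a c x)"
      unfolding biform_def E_def by blast
    from choice[OF this] obtain Q where
      "\<forall>b. b \<in> E \<longrightarrow> (\<forall>c. Q b c \<in> polyfun I) \<and> M b = (\<lambda>\<phi> x. \<Sum>c\<in>E. Q b c \<phi> * mono_fun a c x)" ..
    then have Q: "\<And>b c. b \<in> E \<Longrightarrow> Q b c \<in> polyfun I"
      and MQ: "\<And>b. b \<in> E \<Longrightarrow> M b = (\<lambda>\<phi> x. \<Sum>c\<in>E. Q b c \<phi> * mono_fun a c x)"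
      by simp_all
    have M0: "M b \<phi>0 x = mono_fun a b x" if "b \<in> E" "\<forall>j\<ge>a. x j = 0" for b x
    proof -
      have "M b \<phi>0 x = mono_fun a (b' b) x * (\<Sum>l\<in>S (i b). H (i b) l x * F l \<phi>0 x)"
        by (simp add: M_def sum_distrib_left mult_ac)
      also have "\<dots> = mono_fun a b x"
        using pow[OF i(1)[OF that(1) a] that(2)] b'(2)[OF that(1), of x] by (simp add: e_def)
      finally show ?thesis .
    qed
    have Q0: "Q b c \<phi>0 = (if c = b then 1 else 0)" if bc: "b \<in> E" "c \<in> E" for b c
    proof -
      have "Q b c \<phi>0 - (if c = b then 1 else 0) = 0"
      proof (rule mono_fun_independent[of E a "\<lambda>c. Q b c \<phi>0 - (if c = b then 1 else 0)" c])
        show "finite E" by (simp add: E_def)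
        show "b i = 0" if "b \<in> E" "i \<ge> a" for b i using that by (simp add: E_def expo_def)
        show "c \<in> E" by fact
        fix x :: "nat \<Rightarrow> complex"
        define x' where "x' j = (if j < a then x j else 0)" for j
        have x': "mono_fun a c x = mono_fun a c x'" for c
          unfolding mono_fun_def x'_def by (intro prod.cong) auto
        have "(\<Sum>c\<in>E. (Q b c \<phi>0 - (if c = b then 1 else 0)) * mono_fun a c x)
            = M b \<phi>0 x' - (\<Sum>c\<in>E. if c = b then mono_fun a c x' else 0)"
          unfolding MQ[OF bc(1)] x' sum_subtractf[symmetric] by (intro sum.cong) (auto simp: algebra_simps)
        also have "\<dots> = 0"
          using bc M0[OF bc(1), of x'] by (simp add: x'_def E_def)
        finally show "(\<Sum>c\<in>E. (Q b c \<phi>0 - (if c = b then 1 else 0)) * mono_fun a c x) = 0" .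
      qed
      then show ?thesis by simp
    qed
    obtain en where en: "bij_betw en {0..<card E} E"
      using ex_bij_betw_nat_finite[of E] by (auto simp: E_def)
    define K where "K = card E"
    have enE: "en j \<in> E" if "j < K" for j using en that by (auto simp: bij_betw_def K_def)
    define A where "A \<phi> = mat K K (\<lambda>(j, j'). Q (en j) (en j') \<phi>)" for \<phi>
    have A: "A \<phi> \<in> carrier_mat K K" for \<phi> by (simp add: A_def)
    have "(\<lambda>\<phi>. Determinant.det (A \<phi>)) \<in> polyfun I"
      unfolding A_def by (rule polyfun_det) (use Q enE in simp)
    moreover have "A \<phi>0 = 1\<^sub>m K"
    proof (rule eq_matI)
      fix j j' assume "j < dim_row (1\<^sub>m K :: complex mat)" "j' < dim_col (1\<^sub>m K :: complex mat)"
      then have jj: "j < K" "j' < K" by auto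
      have "en j' = en j \<longleftrightarrow> j' = j"
        using en jj by (auto simp: bij_betw_def inj_on_def K_def)
      then show "A \<phi>0 $$ (j, j') = 1\<^sub>m K $$ (j, j')"
        using jj Q0[OF enE[of j] enE[of j']] by (auto simp: A_def)
    qed (auto simp: A_def)
    then have "Determinant.det (A \<phi>0) \<noteq> 0" by simp
    moreover have "\<exists>l\<in>\<Lambda>. F l \<phi> x \<noteq> 0" if D: "Determinant.det (A \<phi>) \<noteq> 0" and x: "nontrivial a x" for \<phi> x
    proof (rule ccontr)
      assume "\<not> ?thesis"
      then have zero: "F l \<phi> x = 0" if "l \<in> \<Lambda>" for l using that by blast
      have M_zero: "M b \<phi> x = 0" if "b \<in> E" for b
        unfolding M_def using zero S(2)[OF i(1)[OF that a]] by (intro sum.neutral) auto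
      define v where "v = vec K (\<lambda>j. mono_fun a (en j) x)"
      obtain i0 where i0: "i0 < a" "x i0 \<noteq> 0" using x by (auto simp: nontrivial_def)
      define b0 where "b0 j = (if j = i0 then a * e else 0)" for j
      have "b0 \<in> E" using i0 by (auto simp: b0_def E_def expo_def)
      then have "b0 \<in> en ` {0..<K}" using en unfolding bij_betw_def K_def by simp
      then obtain j0 where j0: "j0 < K" "en j0 = b0" by auto
      have "mono_fun a b0 x = (\<Prod>j<a. if j = i0 then x j ^ (a * e) else 1)"
        unfolding mono_fun_def b0_def by (intro prod.cong) auto
      then have "mono_fun a b0 x \<noteq> 0" using i0 by simp
      then have "v $ j0 \<noteq> 0" using j0 by (simp add: v_def)
      then have "v \<noteq> 0\<^sub>v K" using j0 by auto
      moreover have "A \<phi> *\<^sub>v v = 0\<^sub>v K"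
      proof (rule eq_vecI)
        fix j assume "j < dim_vec (0\<^sub>v K :: complex vec)"
        then have j: "j < K" by simp
        have "(A \<phi> *\<^sub>v v) $ j = (\<Sum>j'\<in>{0..<K}. Q (en j) (en j') \<phi> * mono_fun a (en j') x)"
          using j by (simp add: A_def v_def scalar_prod_def)
        also have "\<dots> = (\<Sum>c\<in>E. Q (en j) c \<phi> * mono_fun a c x)"
          using sum.reindex_bij_betw[OF en, of "\<lambda>c. Q (en j) c \<phi> * mono_fun a c x"] by (simp add: K_def)
        also have "\<dots> = M (en j) \<phi> x" using MQ[OF enE[OF j]] by simp
        finally show "(A \<phi> *\<^sub>v v) $ j = 0\<^sub>v K $ j" using M_zero[OF enE[OF j]] j by simp
      qed (simp add: A_def)
      moreover have "v \<in> carrier_vec K" by (simp add: v_def)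
      ultimately show False using det_0_iff_vec_prod_zero[OF A] D by blast
    qed
    ultimately show ?thesis by (intro bexI[of _ "\<lambda>\<phi>. Determinant.det (A \<phi>)"]) auto
  qed
qed

text \<open>Allowing all combinations \<open>P\<close> of the rows, and not only choices of rows, lets a left inverse
  serve as the witness for a minor that does not vanish.\<close>

lemma nullity_ge_iff_minors:
  assumes k: "1 \<le> k" "k \<le> q"
  defines "r \<equiv> q + 1 - k"
  shows "nullity_ge p q k T \<longleftrightarrow> (\<forall>en P. inj_on en {..<r} \<and> en ` {..<r} \<subseteq> {..<q} \<longrightarrow>
    Determinant.det (mat r r (\<lambda>(i, i'). \<Sum>j<p. P i j * T j (en i'))) = 0)" (is "?L \<longleftrightarrow> ?R")
proof
  assume null: ?L
  show ?R
  proof (intro allI impI, elim conjE)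
    fix en :: "nat \<Rightarrow> nat" and P :: "nat \<Rightarrow> nat \<Rightarrow> complex"
    assume inj: "inj_on en {..<r}" and im: "en ` {..<r} \<subseteq> {..<q}"
    have "card (en ` {..<r}) = r" using card_image[OF inj] by simp
    then have "q < card (en ` {..<r}) + k" using k by (simp add: r_def)
    with null im have "\<exists>y. (\<exists>i\<in>en ` {..<r}. y i \<noteq> 0) \<and> (\<forall>i. i \<notin> en ` {..<r} \<longrightarrow> y i = 0)
        \<and> (\<forall>j<p. (\<Sum>i<q. T j i * y i) = 0)"
      unfolding nullity_ge_def by blast
    then obtain y where y: "\<exists>c<r. y (en c) \<noteq> 0" "\<And>i. i \<notin> en ` {..<r} \<Longrightarrow> y i = 0"
      and ker: "\<And>j. j < p \<Longrightarrow> (\<Sum>i<q. T j i * y i) = 0" by blast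
    define A where "A = mat r r (\<lambda>(i, i'). \<Sum>j<p. P i j * T j (en i'))"
    define v where "v = vec r (\<lambda>c. y (en c))"
    have "v \<noteq> 0\<^sub>v r"
    proof
      assume "v = 0\<^sub>v r"
      obtain c where "c < r" "y (en c) \<noteq> 0" using y(1) by blast
      then have "v $ c \<noteq> 0" by (simp add: v_def)
      then show False using \<open>v = 0\<^sub>v r\<close> \<open>c < r\<close> by simp
    qed
    moreover have "A *\<^sub>v v = 0\<^sub>v r"
    proof (rule eq_vecI)
      fix i assume "i < dim_vec (0\<^sub>v r :: complex vec)"
      then have i: "i < r" by simp
      have "(\<Sum>c<r. T j (en c) * y (en c)) = 0" if "j < p" for j
      proof -
        have "(\<Sum>c<r. T j (en c) * y (en c)) = (\<Sum>i\<in>en ` {..<r}. T j i * y i)"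
          by (simp add: sum.reindex[OF inj])
        also have "\<dots> = (\<Sum>i<q. T j i * y i)"
          by (rule sum.mono_neutral_left) (use im y(2) in auto)
        finally show ?thesis using ker[OF that] by simp
      qed
      then have z: "(\<Sum>j<p. P i j * (\<Sum>c<r. T j (en c) * y (en c))) = 0" by simp
      have "(A *\<^sub>v v) $ i = (\<Sum>c<r. (\<Sum>j<p. P i j * T j (en c)) * y (en c))"
        using i by (simp add: A_def v_def scalar_prod_def atLeast0LessThan)
      also have "\<dots> = (\<Sum>j<p. P i j * (\<Sum>c<r. T j (en c) * y (en c)))"
        unfolding sum_distrib_left sum_distrib_right mult.assoc by (rule sum.swap)
      finally show "(A *\<^sub>v v) $ i = 0\<^sub>v r $ i" using z i by simp
    qed (simp add: A_def)
    moreover have "A \<in> carrier_mat r r" "v \<in> carrier_vec r" by (auto simp: A_def v_def)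
    ultimately have "Determinant.det A = 0" using det_0_iff_vec_prod_zero by blast
    then show "Determinant.det (mat r r (\<lambda>(i, i'). \<Sum>j<p. P i j * T j (en i'))) = 0" by (simp add: A_def)
  qed
next
  assume R: ?R
  show ?L
  proof (rule ccontr)
    assume not_null: "\<not> ?L"
    obtain C where C: "C \<subseteq> {..<q}" "q < card C + k"
      and none: "\<And>y. (\<exists>i\<in>C. y i \<noteq> 0) \<Longrightarrow> (\<forall>i. i \<notin> C \<longrightarrow> y i = 0) \<Longrightarrow> (\<forall>j<p. (\<Sum>i<q. T j i * y i) = 0) \<Longrightarrow> False"
      using not_null unfolding nullity_ge_def by blast
    have "r \<le> card C" using C k by (simp add: r_def)
    then obtain C' where C': "C' \<subseteq> C" "card C' = r" by (rule obtain_subset_with_card_n)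
    have "finite C'" using C' C by (meson finite_lessThan finite_subset)
    then obtain en where en: "bij_betw en {..<r} C'"
      using ex_bij_betw_nat_finite[of C'] C'(2) by (auto simp: atLeast0LessThan)
    have inj: "inj_on en {..<r}" and im: "en ` {..<r} = C'" using en by (auto simp: bij_betw_def)
    have "\<exists>P. \<forall>c\<in>{..<r}. \<forall>c'\<in>{..<r}. (\<Sum>j\<in>{..<p}. P c j * T j (en c')) = (if c = c' then 1 else 0)"
    proof (rule left_inverse_of_injective)
      fix z assume z: "\<And>j. j \<in> {..<p} \<Longrightarrow> (\<Sum>c<r. T j (en c) * z c) = 0"
      define y where "y i = (if i \<in> C' then z (the_inv_into {..<r} en i) else 0)" for i
      have y_en: "y (en c) = z c" if "c < r" for c
        using that im inj by (auto simp: y_def the_inv_into_f_f)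
      have "(\<Sum>i<q. T j i * y i) = 0" if "j < p" for j
      proof -
        have "(\<Sum>i<q. T j i * y i) = (\<Sum>i\<in>C'. T j i * y i)"
          by (rule sum.mono_neutral_right) (use C C' in \<open>auto simp: y_def\<close>)
        also have "\<dots> = (\<Sum>c<r. T j (en c) * y (en c))"
          by (rule sum.reindex_bij_betw[OF en, symmetric])
        also have "\<dots> = (\<Sum>c<r. T j (en c) * z c)" by (intro sum.cong) (auto simp: y_en)
        finally show ?thesis using z that by simp
      qed
      moreover have "\<forall>i. i \<notin> C \<longrightarrow> y i = 0" using C'(1) by (auto simp: y_def)
      ultimately have "\<not> (\<exists>i\<in>C. y i \<noteq> 0)" using none[of y] by blast
      then show "\<forall>c\<in>{..<r}. z c = 0" using y_en im C'(1) by (metis image_subset_iff lessThan_iff)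
    qed auto
    then obtain P where P: "\<And>c c'. c < r \<Longrightarrow> c' < r \<Longrightarrow> (\<Sum>j<p. P c j * T j (en c')) = (if c = c' then 1 else 0)"
      by blast
    have "mat r r (\<lambda>(i, i'). \<Sum>j<p. P i j * T j (en i')) = 1\<^sub>m r"
      by (rule eq_matI) (auto simp: P)
    moreover have "en ` {..<r} \<subseteq> {..<q}" using im C C' by auto
    ultimately show False using R[rule_format, of en P] inj by simp
  qed
qed

theorem bounded_nullity_is_open:
  assumes k: "1 \<le> k" "k \<le> q"
    and no: "\<And>x. nontrivial a x \<Longrightarrow> \<not> nullity_ge p q k (contract a \<phi>0 x)"
  shows "\<exists>D\<in>polyfun ({..<a} \<times> {..<p} \<times> {..<q}). D \<phi>0 \<noteq> 0 \<and>
    (\<forall>\<phi>. D \<phi> \<noteq> 0 \<longrightarrow> (\<forall>x. nontrivial a x \<longrightarrow> \<not> nullity_ge p q k (contract a \<phi> x)))"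
proof -
  define r where "r = q + 1 - k"
  define \<Lambda> where "\<Lambda> = {en :: nat \<Rightarrow> nat. inj_on en {..<r} \<and> en ` {..<r} \<subseteq> {..<q}} \<times> (UNIV :: (nat \<Rightarrow> nat \<Rightarrow> complex) set)"
  define F where "F = (\<lambda>(en, P) \<phi> x. Determinant.det (mat r r (\<lambda>(i, i'). \<Sum>j<p. P i j * contract a \<phi> x j (en i'))))"
  have iff: "nullity_ge p q k (contract a \<phi> x) \<longleftrightarrow> (\<forall>l\<in>\<Lambda>. F l \<phi> x = 0)" for \<phi> x
    unfolding nullity_ge_iff_minors[OF k] r_def[symmetric] by (auto simp: \<Lambda>_def F_def)
  have "\<exists>D\<in>polyfun ({..<a} \<times> {..<p} \<times> {..<q}). D \<phi>0 \<noteq> 0 \<and>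
    (\<forall>\<phi>. D \<phi> \<noteq> 0 \<longrightarrow> (\<forall>x. nontrivial a x \<longrightarrow> (\<exists>l\<in>\<Lambda>. F l \<phi> x \<noteq> 0)))"
  proof (rule elimination)
    fix l assume "l \<in> \<Lambda>"
    then obtain en P where l: "l = (en, P)" "en ` {..<r} \<subseteq> {..<q}" by (auto simp: \<Lambda>_def)
    have "(\<lambda>\<phi> x. \<Sum>j<p. P i j * contract a \<phi> x j (en i')) \<in> biform ({..<a} \<times> {..<p} \<times> {..<q}) a 1"
      if "i < r" "i' < r" for i i'
      unfolding contract_def
      by (intro biform_sum biform_scale biform_linear polyfun_const polyfun_var) (use that l in auto)
    from biform_det[of r "\<lambda>i i' \<phi> x. \<Sum>j<p. P i j * contract a \<phi> x j (en i')", OF this]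
    show "F l \<in> biform ({..<a} \<times> {..<p} \<times> {..<q}) a r" by (simp add: F_def l)
  next
    fix x assume "nontrivial a x"
    from no[OF this] show "\<exists>l\<in>\<Lambda>. F l \<phi>0 x \<noteq> 0" unfolding iff by blast
  qed
  then show ?thesis unfolding iff by blast
qed

section \<open>Existence of degenerate points by deformation\<close>

text \<open>Continuity along curves that are continuous in each coordinate is all that the limit below
  needs, and makes a topology on the space of parameters unnecessary.\<close>

definition cont_along_curves :: "(('i \<Rightarrow> complex) \<Rightarrow> complex) \<Rightarrow> bool" where
  "cont_along_curves f \<longleftrightarrow> (\<forall>c. (\<forall>i. isCont (\<lambda>t::complex. c t i) 0) \<longrightarrow> isCont (\<lambda>t. f (c t)) 0)"

text \<open>The Taylor expansion at \<open>x\<close> by degree: \<open>De e\<close> is the homogeneous part of degree \<open>e\<close>, but only its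
  continuity matters.\<close>

lemma polyfun_expansion:
  assumes "D \<in> polyfun I"
  shows "\<exists>n De. (\<forall>u t. D (\<lambda>i. x i + t * u i) = (\<Sum>e<n. t ^ e * De e u)) \<and> (\<forall>e. cont_along_curves (De e))"
  using assms
proof (rule polyfun_closed)
  show "\<exists>n De. (\<forall>u t. c = (\<Sum>e<n. t ^ e * De e u)) \<and> (\<forall>e. cont_along_curves (De e))" for c
    by (rule exI[of _ 1], rule exI[of _ "\<lambda>_ _. c"]) (simp add: cont_along_curves_def)
  show "\<exists>n De. (\<forall>u t. x i + t * u i = (\<Sum>e<n. t ^ e * De e u)) \<and> (\<forall>e. cont_along_curves (De e))" for i
  proof (intro exI conjI allI)
    show "x i + t * u i = (\<Sum>e<2. t ^ e * (if e = 0 then x i else u i))" for u t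
      by (simp add: numeral_2_eq_2)
    show "cont_along_curves (\<lambda>u. if e = 0 then x i else u i)" for e :: nat
      by (cases "e = 0") (simp_all add: cont_along_curves_def)
  qed
next
  fix f g
  assume "\<exists>n De. (\<forall>u t. f (\<lambda>i. x i + t * u i) = (\<Sum>e<n. t ^ e * De e u)) \<and> (\<forall>e. cont_along_curves (De e))"
    and "\<exists>n De. (\<forall>u t. g (\<lambda>i. x i + t * u i) = (\<Sum>e<n. t ^ e * De e u)) \<and> (\<forall>e. cont_along_curves (De e))"
  then obtain n A m B where A: "\<And>u t. f (\<lambda>i. x i + t * u i) = (\<Sum>e<n. t ^ e * A e u)" "\<And>e. cont_along_curves (A e)"
    and B: "\<And>u t. g (\<lambda>i. x i + t * u i) = (\<Sum>e<m. t ^ e * B e u)" "\<And>e. cont_along_curves (B e)"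
    by blast
  show "\<exists>n De. (\<forall>u t. f (\<lambda>i. x i + t * u i) + g (\<lambda>i. x i + t * u i) = (\<Sum>e<n. t ^ e * De e u)) \<and> (\<forall>e. cont_along_curves (De e))"
  proof (intro exI conjI allI)
    fix u t
    have "(\<Sum>e<n. t ^ e * A e u) = (\<Sum>e<max n m. t ^ e * (if e < n then A e u else 0))"
      by (rule sum.mono_neutral_cong_left) auto
    moreover have "(\<Sum>e<m. t ^ e * B e u) = (\<Sum>e<max n m. t ^ e * (if e < m then B e u else 0))"
      by (rule sum.mono_neutral_cong_left) auto
    ultimately show "f (\<lambda>i. x i + t * u i) + g (\<lambda>i. x i + t * u i)
        = (\<Sum>e<max n m. t ^ e * ((if e < n then A e u else 0) + (if e < m then B e u else 0)))"
      by (simp only: A B sum.distrib distrib_left)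
    show "cont_along_curves (\<lambda>u. (if e < n then A e u else 0) + (if e < m then B e u else 0))" for e
      using A(2)[of e] B(2)[of e]
      by (cases "e < n"; cases "e < m") (auto simp: cont_along_curves_def intro!: continuous_intros)
  qed
  show "\<exists>n De. (\<forall>u t. f (\<lambda>i. x i + t * u i) * g (\<lambda>i. x i + t * u i) = (\<Sum>e<n. t ^ e * De e u)) \<and> (\<forall>e. cont_along_curves (De e))"
  proof (intro exI conjI allI)
    fix u t
    let ?S = "\<lambda>d. {s \<in> {..<n} \<times> {..<m}. fst s + snd s = d}"
    have "f (\<lambda>i. x i + t * u i) * g (\<lambda>i. x i + t * u i)
        = (\<Sum>s\<in>{..<n} \<times> {..<m}. t ^ (fst s + snd s) * (A (fst s) u * B (snd s) u))"
      by (auto simp: A B sum_product sum.cartesian_product power_add mult_ac intro!: sum.cong)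
    also have "\<dots> = (\<Sum>d<n + m. \<Sum>s\<in>?S d. t ^ (fst s + snd s) * (A (fst s) u * B (snd s) u))"
      by (rule sum.group[symmetric]) auto
    also have "\<dots> = (\<Sum>d<n + m. t ^ d * (\<Sum>s\<in>?S d. A (fst s) u * B (snd s) u))"
      unfolding sum_distrib_left by (intro sum.cong) auto
    finally show "f (\<lambda>i. x i + t * u i) * g (\<lambda>i. x i + t * u i)
      = (\<Sum>d<n + m. t ^ d * (\<Sum>s\<in>?S d. A (fst s) u * B (snd s) u))" .
    show "cont_along_curves (\<lambda>u. \<Sum>s\<in>?S d. A (fst s) u * B (snd s) u)" for d
      using A(2) B(2) by (auto simp: cont_along_curves_def intro!: continuous_intros)
  qed
qed

text \<open>Let \<open>e\<close> be the order of \<open>D\<close> at \<open>x\<close>. Dividing by \<open>t ^ e\<close> along a curve with velocity \<open>u\<close> and letting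
  \<open>t\<close> tend to \<open>0\<close> leaves the value at \<open>u\<close> of the part of degree \<open>e\<close>. So that part is zero for all \<open>u\<close>,
  against the choice of \<open>e\<close>.\<close>

lemma polyfun_zero_of_curves:
  assumes D: "D \<in> polyfun I"
    and curves: "\<And>u. \<exists>c. c 0 = u \<and> (\<forall>i. isCont (\<lambda>t. c t i) 0) \<and> (\<forall>t::complex. D (\<lambda>i. x i + t * c t i) = 0)"
  shows "D y = 0"
proof (rule ccontr)
  assume y: "D y \<noteq> 0"
  obtain n De where De: "\<And>u t. D (\<lambda>i. x i + t * u i) = (\<Sum>e<n. t ^ e * De e u)"
    and cont: "\<And>e. cont_along_curves (De e)"
    using polyfun_expansion[OF D, of x] by blast
  have "D y = (\<Sum>e<n. De e (\<lambda>i. y i - x i))"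
    using De[of 1 "\<lambda>i. y i - x i"] by simp
  then have "\<exists>e\<in>{..<n}. De e (\<lambda>i. y i - x i) \<noteq> 0" using y sum.neutral[of "{..<n}"] by force
  then have ex: "\<exists>e. e < n \<and> (\<exists>u. De e u \<noteq> 0)" by auto
  define e where "e = (LEAST e. e < n \<and> (\<exists>u. De e u \<noteq> 0))"
  from LeastI_ex[OF ex] obtain u where e: "e < n" "De e u \<noteq> 0" unfolding e_def by blast
  have lower: "De e' v = 0" if "e' < e" for e' v
    using not_less_Least[of e' "\<lambda>e. e < n \<and> (\<exists>u. De e u \<noteq> 0)"] that e(1) unfolding e_def[symmetric] by auto
  obtain c where c: "c 0 = u" "\<And>i. isCont (\<lambda>t. c t i) 0" "\<And>t. D (\<lambda>i. x i + t * c t i) = 0"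
    using curves[of u] by blast
  define g where "g t = (\<Sum>e'\<in>{e..<n}. t ^ (e' - e) * De e' (c t))" for t
  have "g t = 0" if "t \<noteq> 0" for t
  proof -
    have "0 = (\<Sum>e'<n. t ^ e' * De e' (c t))" using c(3)[of t] De[of t "c t"] by simp
    also have "\<dots> = (\<Sum>e'\<in>{e..<n}. t ^ e' * De e' (c t))"
      by (rule sum.mono_neutral_right) (auto simp: lower)
    also have "\<dots> = (\<Sum>e'\<in>{e..<n}. t ^ e * (t ^ (e' - e) * De e' (c t)))"
      by (intro sum.cong refl) (simp add: mult.assoc[symmetric] power_add[symmetric])
    also have "\<dots> = t ^ e * g t" by (simp add: g_def sum_distrib_left)
    finally show ?thesis using that by simp
  qed
  then have "eventually (\<lambda>t. g t = 0) (at 0)" by (auto simp: eventually_at_filter)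
  then have "(g \<longlongrightarrow> 0) (at 0)" by (rule tendsto_eventually)
  moreover have "isCont (\<lambda>t. De e' (c t)) 0" for e'
    using cont[of e'] c(2) unfolding cont_along_curves_def by blast
  then have "isCont g 0" unfolding g_def by (intro continuous_intros)
  then have "(g \<longlongrightarrow> g 0) (at 0)" by (simp add: isCont_def)
  ultimately have "g 0 = 0" using LIM_unique by blast
  moreover have "g 0 = (\<Sum>e'\<in>{e..<n}. if e' = e then De e' u else 0)"
    unfolding g_def c(1) by (intro sum.cong) auto
  ultimately show False using e by simp
qed

text \<open>Otherwise a polynomial \<open>D\<close> with \<open>D \<phi> \<noteq> 0\<close> vanishes at every tensor that has a member of nullity at
  least \<open>k\<close>. The tensor \<open>\<phi>0\<close> has one: its member at the first unit vector is zero in the first \<open>k\<close>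
  columns and an identity block in the others. It is chosen so that the linearized equations for the
  motion of the parameter and of its kernel, as many equations as unknowns, form a permutation
  matrix. So every velocity \<open>u\<close> of the tensor is compatible with a first-order motion, and the
  entries \<open>(0, j, l)\<close> with \<open>l < k\<close>, on which the equations depend by the coefficient \<open>1\<close>, absorb the
  terms of higher order.\<close>

theorem exists_point_of_nullity:
  assumes k: "1 \<le> k" "k \<le> q" "q \<le> p + k" and a: "a = k * (p + k - q) + 1"
  shows "\<exists>x. nontrivial a x \<and> nullity_ge p q k (contract a \<phi> x)"
proof (rule ccontr)
  assume none: "\<not> ?thesis"
  obtain D where D: "D \<in> polyfun ({..<a} \<times> {..<p} \<times> {..<q})" "D \<phi> \<noteq> 0"
    and Dnull: "\<And>\<phi> x. D \<phi> \<noteq> 0 \<Longrightarrow> nontrivial a x \<Longrightarrow> \<not> nullity_ge p q k (contract a \<phi> x)"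
    using bounded_nullity_is_open[OF k(1,2), of a p \<phi>] none by blast
  define s where "s = q - k"
  define t where "t = p + k - q"
  have st: "q = s + k" "p = s + t" "a = k * t + 1" using k a by (auto simp: s_def t_def)
  define \<phi>0 :: "nat \<times> nat \<times> nat \<Rightarrow> complex" where "\<phi>0 = (\<lambda>(i, j, l).
    if i = 0 then (if l = j + k then 1 else 0)
    else (if l < k \<and> s \<le> j \<and> i = Suc ((j - s) * k + l) then 1 else 0))"
  have "D \<phi> = 0"
  proof (rule polyfun_zero_of_curves[OF D(1), of \<phi>0])
    fix u :: "nat \<times> nat \<times> nat \<Rightarrow> complex"
    \<comment> \<open>First-order motion of the point and of its kernel, solving the linearized equations.\<close>
    define x' where "x' i = - u (0, s + (i - 1) div k, (i - 1) mod k)" for i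
    define Y where "Y \<kappa> l = - u (0, \<kappa> - k, l)" for \<kappa> l
    define \<psi> where "\<psi> \<epsilon> idx = \<phi>0 idx + \<epsilon> * u idx" for \<epsilon> idx
    \<comment> \<open>\<open>- R\<close> is the velocity of the absorbing entries that makes the equations hold exactly.\<close>
    define R where "R \<epsilon> j l = (\<Sum>i=1..<a. \<psi> \<epsilon> (i, j, l) * x' i) + (\<Sum>\<kappa>=k..<q. \<psi> \<epsilon> (0, j, \<kappa>) * Y \<kappa> l)
      + \<epsilon> * (\<Sum>\<kappa>=k..<q. \<Sum>i=1..<a. \<psi> \<epsilon> (i, j, \<kappa>) * x' i * Y \<kappa> l)" for \<epsilon> j l
    define c where "c \<epsilon> = (\<lambda>(i, j, l). if i = 0 \<and> j < p \<and> l < k then - R \<epsilon> j l else u (i, j, l))" for \<epsilon>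
    show "\<exists>c. c 0 = u \<and> (\<forall>i. isCont (\<lambda>\<epsilon>. c \<epsilon> i) 0) \<and> (\<forall>\<epsilon>::complex. D (\<lambda>i. \<phi>0 i + \<epsilon> * c \<epsilon> i) = 0)"
    proof (intro exI[of _ c] conjI allI)
      have "R 0 j l = - u (0, j, l)" if jl: "j < p" "l < k" for j l
      proof (cases "j < s")
        case True
        have "(\<Sum>i=1..<a. \<psi> 0 (i, j, l) * x' i) = 0"
          by (rule sum.neutral) (use True in \<open>auto simp: \<psi>_def \<phi>0_def\<close>)
        moreover have "(\<Sum>\<kappa>=k..<q. \<psi> 0 (0, j, \<kappa>) * Y \<kappa> l) = (\<Sum>\<kappa>=k..<q. if \<kappa> = j + k then Y \<kappa> l else 0)"
          by (intro sum.cong) (auto simp: \<psi>_def \<phi>0_def)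
        ultimately show ?thesis using True st by (simp add: R_def Y_def)
      next
        case False
        define i0 where "i0 = Suc ((j - s) * k + l)"
        have "(j - s) * k + l < t * k"
        proof -
          have "Suc (j - s) * k \<le> t * k" using False jl st by (intro mult_right_mono) auto
          then show ?thesis using jl by simp
        qed
        then have "i0 \<in> {1..<a}" by (simp add: i0_def st mult.commute)
        moreover have "x' i0 = - u (0, j, l)"
          using False jl by (simp add: x'_def i0_def)
        moreover have "(\<Sum>i=1..<a. \<psi> 0 (i, j, l) * x' i) = (\<Sum>i=1..<a. if i = i0 then x' i else 0)"
          by (intro sum.cong) (use False jl in \<open>auto simp: \<psi>_def \<phi>0_def i0_def\<close>)
        moreover have "(\<Sum>\<kappa>=k..<q. \<psi> 0 (0, j, \<kappa>) * Y \<kappa> l) = 0"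
          by (rule sum.neutral) (use False st in \<open>auto simp: \<psi>_def \<phi>0_def\<close>)
        ultimately show ?thesis by (simp add: R_def)
      qed
      then show "c 0 = u" by (auto simp: c_def fun_eq_iff)
      show "isCont (\<lambda>\<epsilon>. c \<epsilon> idx) 0" for idx
      proof -
        obtain i j l where idx: "idx = (i, j, l)" by (cases idx)
        have "isCont (\<lambda>\<epsilon>. - R \<epsilon> j l) 0" unfolding R_def \<psi>_def by (intro continuous_intros)
        then show ?thesis by (cases "i = 0 \<and> j < p \<and> l < k") (auto simp: c_def idx)
      qed
      fix \<epsilon> :: complex
      define \<Phi> where "\<Phi> = (\<lambda>idx. \<phi>0 idx + \<epsilon> * c \<epsilon> idx)"
      define x where "x i = (if i = 0 then 1 else \<epsilon> * x' i)" for i :: nat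
      define y where "y l \<kappa> = (if \<kappa> < k then if \<kappa> = l then 1 else 0 else if \<kappa> < q then \<epsilon> * Y \<kappa> l else 0)" for l \<kappa>
      have ker: "(\<Sum>\<kappa><q. contract a \<Phi> x j \<kappa> * y l \<kappa>) = 0" if jl: "j < p" "l < k" for j l
      proof -
        have ctr: "contract a \<Phi> x j \<kappa> = \<Phi> (0, j, \<kappa>) + \<epsilon> * (\<Sum>i=1..<a. \<Phi> (i, j, \<kappa>) * x' i)" for \<kappa>
        proof -
          have "{..<a} = insert 0 {1..<a}" using st by auto
          then show ?thesis
            by (simp add: contract_def x_def sum_distrib_left mult_ac)
        qed
        have \<Phi>1: "\<Phi> (i, j, \<kappa>) = \<psi> \<epsilon> (i, j, \<kappa>)" if "i \<noteq> 0 \<or> k \<le> \<kappa>" for i \<kappa>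
          using that by (auto simp: \<Phi>_def \<psi>_def c_def)
        have \<Phi>0: "\<Phi> (0, j, l) = - \<epsilon> * R \<epsilon> j l"
          using jl by (simp add: \<Phi>_def c_def \<phi>0_def)
        have "(\<Sum>\<kappa><q. contract a \<Phi> x j \<kappa> * y l \<kappa>)
            = (\<Sum>\<kappa><k. contract a \<Phi> x j \<kappa> * y l \<kappa>) + (\<Sum>\<kappa>=k..<q. contract a \<Phi> x j \<kappa> * y l \<kappa>)"
          using sum.union_disjoint[of "{..<k}" "{k..<q}"] k(2)
          by (simp add: ivl_disj_un_one ivl_disj_int_one)
        also have "(\<Sum>\<kappa><k. contract a \<Phi> x j \<kappa> * y l \<kappa>) = (\<Sum>\<kappa><k. if \<kappa> = l then contract a \<Phi> x j l else 0)"
          by (intro sum.cong) (auto simp: y_def)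
        also have "\<dots> = contract a \<Phi> x j l" using jl by simp
        also have "(\<Sum>\<kappa>=k..<q. contract a \<Phi> x j \<kappa> * y l \<kappa>)
            = \<epsilon> * (\<Sum>\<kappa>=k..<q. \<psi> \<epsilon> (0, j, \<kappa>) * Y \<kappa> l) + \<epsilon> * (\<epsilon> * (\<Sum>\<kappa>=k..<q. \<Sum>i=1..<a. \<psi> \<epsilon> (i, j, \<kappa>) * x' i * Y \<kappa> l))"
          unfolding sum_distrib_left sum.distrib[symmetric]
        proof (intro sum.cong refl)
          fix \<kappa> assume "\<kappa> \<in> {k..<q}"
          then have \<kappa>: "k \<le> \<kappa>" "\<kappa> < q" by auto
          show "contract a \<Phi> x j \<kappa> * y l \<kappa> = \<epsilon> * (\<psi> \<epsilon> (0, j, \<kappa>) * Y \<kappa> l)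
              + (\<Sum>i=1..<a. \<epsilon> * (\<epsilon> * (\<psi> \<epsilon> (i, j, \<kappa>) * x' i * Y \<kappa> l)))"
            using \<kappa> by (simp add: ctr \<Phi>1 y_def algebra_simps sum_distrib_left sum_distrib_right)
        qed
        also have "contract a \<Phi> x j l = - \<epsilon> * R \<epsilon> j l + \<epsilon> * (\<Sum>i=1..<a. \<psi> \<epsilon> (i, j, l) * x' i)"
        proof -
          have "(\<Sum>i=1..<a. \<Phi> (i, j, l) * x' i) = (\<Sum>i=1..<a. \<psi> \<epsilon> (i, j, l) * x' i)"
            by (intro sum.cong) (auto simp: \<Phi>1)
          then show ?thesis by (simp add: ctr \<Phi>0)
        qed
        finally show ?thesis by (simp add: R_def algebra_simps)
      qed
      have "nullity_ge p q k (contract a \<Phi> x)"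
        unfolding nullity_ge_def
      proof (intro allI impI)
        fix C assume C: "C \<subseteq> {..<q} \<and> q < card C + k"
        \<comment> \<open>The \<open>k\<close>-dimensional kernel meets the coordinate subspace of \<open>C\<close> for dimension reasons.\<close>
        have "card ({..<q} - C) < card {..<k}"
          using C k(1) card_Diff_subset[of C "{..<q}"] finite_subset[of C "{..<q}"] by auto
        then obtain z where z: "\<exists>l\<in>{..<k}. z l \<noteq> 0" "\<forall>\<kappa>\<in>{..<q} - C. (\<Sum>l<k. y l \<kappa> * z l) = 0"
          using underdetermined_system[of "{..<q} - C" "{..<k}" "\<lambda>\<kappa> l. y l \<kappa>"] by auto
        define w where "w \<kappa> = (\<Sum>l<k. y l \<kappa> * z l)" for \<kappa>
        have w_out: "w \<kappa> = 0" if "\<kappa> \<notin> C" for \<kappa>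
        proof (cases "\<kappa> < q")
          case True
          then show ?thesis using z(2) that by (simp add: w_def)
        next
          case False
          then show ?thesis using k(2) by (simp add: w_def y_def)
        qed
        obtain l0 where l0: "l0 < k" "z l0 \<noteq> 0" using z(1) by blast
        have "w l0 = (\<Sum>l<k. if l = l0 then z l else 0)"
          unfolding w_def by (intro sum.cong) (use l0 in \<open>auto simp: y_def\<close>)
        then have "w l0 = z l0" using l0 by simp
        then have "\<exists>i\<in>C. w i \<noteq> 0" using l0 w_out[of l0] by (intro bexI[of _ l0]) auto
        moreover have "(\<Sum>\<kappa><q. contract a \<Phi> x j \<kappa> * w \<kappa>) = 0" if "j < p" for j
        proof -
          have "(\<Sum>\<kappa><q. contract a \<Phi> x j \<kappa> * w \<kappa>) = (\<Sum>\<kappa><q. \<Sum>l<k. contract a \<Phi> x j \<kappa> * y l \<kappa> * z l)"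
            by (simp add: w_def sum_distrib_left mult.assoc)
          also have "\<dots> = (\<Sum>l<k. (\<Sum>\<kappa><q. contract a \<Phi> x j \<kappa> * y l \<kappa>) * z l)"
            unfolding sum_distrib_right by (rule sum.swap)
          also have "\<dots> = 0" using ker[OF that] by simp
          finally show ?thesis .
        qed
        ultimately show "\<exists>y. (\<exists>i\<in>C. y i \<noteq> 0) \<and> (\<forall>i. i \<notin> C \<longrightarrow> y i = 0) \<and> (\<forall>j<p. (\<Sum>i<q. contract a \<Phi> x j i * y i) = 0)"
          using w_out by blast
      qed
      moreover have "nontrivial a x" using st by (auto simp: nontrivial_def x_def intro!: exI[of _ 0])
      ultimately have "D \<Phi> = 0" using Dnull by blast
      then show "D (\<lambda>i. \<phi>0 i + \<epsilon> * c \<epsilon> i) = 0" by (simp add: \<Phi>_def)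
    qed
  qed
  then show False using D(2) by simp
qed

section \<open>Krull dimension of projective spaces\<close>

lemma expo_zero: "expo d 0 = {\<lambda>_. 0}"
proof (intro equalityI subsetI)
  fix b assume b: "b \<in> expo d 0"
  have "b i = 0" for i using b by (cases "i < d") (auto simp: expo_def)
  then show "b \<in> {\<lambda>_. 0}" by auto
qed (simp add: expo_def)

text \<open>The two bounds below are crude, but show that the number of monomials of degree \<open>N\<close> in \<open>d + 1\<close>
  variables grows like the \<open>d\<close>-th power of \<open>N\<close>.\<close>

lemma card_expo_le: "card (expo (Suc d) N) \<le> (N + 1) ^ d"
proof -
  have "card (expo (Suc d) N) \<le> card (PiE {..<d} (\<lambda>_. {..N}))"
  proof (rule card_inj_on_le)
    show "inj_on (\<lambda>b. restrict b {..<d}) (expo (Suc d) N)"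
    proof (rule inj_onI, rule ext)
      fix b c i assume bc: "b \<in> expo (Suc d) N" "c \<in> expo (Suc d) N"
        and eq: "restrict b {..<d} = restrict c {..<d}"
      have low: "b i = c i" if "i < d" for i using fun_cong[OF eq, of i] that by simp
      then have "sum b {..<d} = sum c {..<d}" by (intro sum.cong) auto
      then have "b d = c d" using bc by (simp add: expo_def)
      then show "b i = c i" using bc low[of i] by (cases i d rule: linorder_cases) (auto simp: expo_def)
    qed
    show "(\<lambda>b. restrict b {..<d}) ` expo (Suc d) N \<subseteq> PiE {..<d} (\<lambda>_. {..N})"
    proof (rule image_subsetI)
      fix b assume b: "b \<in> expo (Suc d) N"
      have "b i \<le> N" if "i < d" for i
        using b member_le_sum[of i "{..<Suc d}" b] that by (simp add: expo_def)
      then show "restrict b {..<d} \<in> PiE {..<d} (\<lambda>_. {..N})" by auto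
    qed
    show "finite (PiE {..<d} (\<lambda>_. {..N}))" by (intro finite_PiE) auto
  qed
  then show ?thesis by (simp add: card_PiE)
qed

lemma card_expo_ge: "(M + 1) ^ k \<le> card (expo (Suc k) (k * M))"
proof -
  define g where "g f i = (if i < k then f i else if i = k then k * M - sum f {..<k} else (0::nat))" for f i
  have "card (PiE {..<k} (\<lambda>_. {..M})) \<le> card (expo (Suc k) (k * M))"
  proof (rule card_inj_on_le)
    show "inj_on g (PiE {..<k} (\<lambda>_. {..M}))"
    proof (rule inj_onI)
      fix f f' assume f: "f \<in> PiE {..<k} (\<lambda>_. {..M})" "f' \<in> PiE {..<k} (\<lambda>_. {..M})" and eq: "g f = g f'"
      have "f i = f' i" if "i < k" for i using fun_cong[OF eq, of i] that by (simp add: g_def)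
      then show "f = f'" by (intro PiE_ext[OF f]) auto
    qed
    show "g ` PiE {..<k} (\<lambda>_. {..M}) \<subseteq> expo (Suc k) (k * M)"
    proof (rule image_subsetI)
      fix f assume f: "f \<in> PiE {..<k} (\<lambda>_. {..M})"
      have "sum f {..<k} \<le> (\<Sum>i<k. M)" using f by (intro sum_mono) (auto simp: PiE_def Pi_def)
      moreover have "sum (g f) {..<k} = sum f {..<k}" by (intro sum.cong) (auto simp: g_def)
      ultimately show "g f \<in> expo (Suc k) (k * M)"
        by (simp add: expo_def) (simp add: g_def)
    qed
  qed simp
  then show ?thesis by (simp add: card_PiE)
qed

lemma more_monomials:
  assumes "d < k" "1 \<le> e"
  shows "\<exists>D. card (expo (Suc d) (e * D)) < card (expo (Suc k) D)"
proof -
  define M where "M = (e * k) ^ d"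
  have ek: "1 \<le> e * k" using assms by (metis less_one mult_is_0 not_less not_less_zero)
  have "card (expo (Suc d) (e * (k * M))) \<le> (e * (k * M) + 1) ^ d" by (rule card_expo_le)
  also have "\<dots> \<le> (e * k * (M + 1)) ^ d"
    by (rule power_mono) (use ek in \<open>simp_all add: distrib_left mult.assoc\<close>)
  also have "\<dots> = M * (M + 1) ^ d" by (simp only: power_mult_distrib M_def)
  also have "\<dots> < (M + 1) ^ Suc d" by simp
  also have "\<dots> \<le> (M + 1) ^ k" using assms by (intro power_increasing) auto
  also have "\<dots> \<le> card (expo (Suc k) (k * M))" by (rule card_expo_ge)
  finally show ?thesis by blast
qed

text \<open>In large degree \<open>D\<close> there are more monomials in the \<open>k + 1\<close> forms than monomials of degree \<open>e D\<close>
  in the \<open>d + 1\<close> variables.\<close>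

lemma algebraically_dependent_forms:
  assumes "d < k" "1 \<le> e" and G: "\<And>j. j \<le> k \<Longrightarrow> G j \<in> formfun (Suc d) e"
  shows "\<exists>D a. (\<exists>b\<in>expo (Suc k) D. a b \<noteq> 0) \<and>
    (\<forall>x. (\<Sum>b\<in>expo (Suc k) D. a b * mono_fun (Suc k) b (\<lambda>j. G j x)) = 0)"
proof -
  obtain D where D: "card (expo (Suc d) (e * D)) < card (expo (Suc k) D)"
    using more_monomials[OF assms(1,2)] by blast
  have "(\<lambda>x. mono_fun (Suc k) b (\<lambda>j. G j x)) \<in> formfun (Suc d) (D * e)" if "b \<in> expo (Suc k) D" for b
    by (rule formfun_mono_compose[OF that]) (simp add: G)
  then have "\<forall>b. \<exists>w. b \<in> expo (Suc k) D \<longrightarrow> (\<lambda>x. mono_fun (Suc k) b (\<lambda>j. G j x)) =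
      (\<lambda>x. \<Sum>c\<in>expo (Suc d) (D * e). w c * mono_fun (Suc d) c x)"
    unfolding formfun_def by blast
  from choice[OF this] obtain w where w: "\<And>b x. b \<in> expo (Suc k) D \<Longrightarrow> mono_fun (Suc k) b (\<lambda>j. G j x) =
      (\<Sum>c\<in>expo (Suc d) (D * e). w b c * mono_fun (Suc d) c x)"
    unfolding fun_eq_iff by auto
  obtain a where a: "\<exists>b\<in>expo (Suc k) D. a b \<noteq> 0"
    "\<forall>c\<in>expo (Suc d) (D * e). (\<Sum>b\<in>expo (Suc k) D. w b c * a b) = 0"
    using underdetermined_system[of "expo (Suc d) (D * e)" "expo (Suc k) D" "\<lambda>c b. w b c"] D
    by (auto simp: mult.commute)
  have "(\<Sum>b\<in>expo (Suc k) D. a b * mono_fun (Suc k) b (\<lambda>j. G j x)) = 0" for x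
  proof -
    have "(\<Sum>b\<in>expo (Suc k) D. a b * mono_fun (Suc k) b (\<lambda>j. G j x))
        = (\<Sum>b\<in>expo (Suc k) D. \<Sum>c\<in>expo (Suc d) (D * e). w b c * a b * mono_fun (Suc d) c x)"
      by (intro sum.cong refl) (simp add: w sum_distrib_left mult_ac)
    also have "\<dots> = (\<Sum>c\<in>expo (Suc d) (D * e). (\<Sum>b\<in>expo (Suc k) D. w b c * a b) * mono_fun (Suc d) c x)"
      unfolding sum_distrib_right by (rule sum.swap)
    also have "\<dots> = 0" using a(2) by simp
    finally show ?thesis .
  qed
  then show ?thesis using a(1) by blast
qed

text \<open>The space is given abstractly by coordinate vectors \<open>c p\<close> of its points, so that the theorem
  applies at once to linear subspaces of a projective space.

  For a chain \<open>Z\<close> of length \<open>k\<close>, choose for each step a form that vanishes on \<open>Z i\<close> but not on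
  \<open>Z (Suc i)\<close>, and a coordinate that does not vanish on \<open>Z 0\<close>. These forms are algebraically
  independent: by irreducibility a relation on \<open>Z (Suc i)\<close> may be divided by the last form, and
  restricting to \<open>Z i\<close> removes the last form. Hence \<open>k \<le> d\<close>. A flag of coordinate subspaces attains
  the bound.\<close>

theorem krull_dim_projective:
  fixes T :: "'p topology" and c :: "'p \<Rightarrow> nat \<Rightarrow> complex"
  assumes top: "topspace T = X"
    and nt: "\<And>p. p \<in> X \<Longrightarrow> nontrivial (Suc d) (c p)"
    and surj: "\<And>x. nontrivial (Suc d) x \<Longrightarrow> \<exists>p\<in>X. \<exists>z. z \<noteq> 0 \<and> (\<forall>i<Suc d. c p i = z * x i)"
    and closed: "\<And>Z. closedin T Z \<longleftrightarrow> Z \<subseteq> X \<and>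
      (\<forall>p\<in>X - Z. \<exists>e. \<exists>g\<in>formfun (Suc d) e. g (c p) \<noteq> 0 \<and> (\<forall>p'\<in>Z. g (c p') = 0))"
  shows "krull_dim T = ereal (real d)"
proof -
  have sep: "\<exists>e. \<exists>g\<in>formfun (Suc d) e. g (c p) \<noteq> 0 \<and> (\<forall>p'\<in>Z. g (c p') = 0)"
    if "closedin T Z" "p \<in> X" "p \<notin> Z" for Z p
    using bspec[OF conjunct2[OF closed[THEN iffD1, OF that(1)]], of p] that(2,3) by simp
  have sub: "closedin T {p\<in>Z. f (c p) = 0}" if "closedin T Z" "f \<in> formfun (Suc d) e" for Z f e
    unfolding closed
  proof (intro conjI ballI)
    show "{p\<in>Z. f (c p) = 0} \<subseteq> X" using that(1) closed by auto
    fix p assume p: "p \<in> X - {p\<in>Z. f (c p) = 0}"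
    show "\<exists>e. \<exists>g\<in>formfun (Suc d) e. g (c p) \<noteq> 0 \<and> (\<forall>p'\<in>{p\<in>Z. f (c p) = 0}. g (c p') = 0)"
    proof (cases "p \<in> Z")
      case True
      then show ?thesis using that(2) p by (intro exI bexI[of _ f]) auto
    next
      case False
      then show ?thesis using sep[OF that(1), of p] p by auto
    qed
  qed
  have upper: "krull_dim T \<le> ereal (real d)"
    unfolding krull_dim_def
  proof (rule SUP_least)
    fix k assume "k \<in> {k. \<exists>Z. irreducible_chain T k Z}"
    then obtain Z where Z: "irreducible_chain T k Z" by blast
    have cl: "closedin T (Z i)" and irr: "irreducible_space (subtopology T (Z i))" if "i \<le> k" for i
      using Z that by (auto simp: irreducible_chain_def)
    have strict: "Z i \<subset> Z (Suc i)" if "i < k" for i using Z that by (auto simp: irreducible_chain_def)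
    have ZX: "Z i \<subseteq> X" if "i \<le> k" for i using cl[OF that] closed by blast
    have ne: "Z i \<noteq> {}" if "i \<le> k" for i
      using irr[OF that] by (auto simp: irreducible_space_def)
    have prime: "(\<forall>p\<in>Z i. g (c p) = 0)"
      if i: "i \<le> k" and f: "f \<in> formfun (Suc d) e" and g: "g \<in> formfun (Suc d) e'"
        and prod: "\<forall>p\<in>Z i. f (c p) * g (c p) = 0" and nz: "\<exists>p\<in>Z i. f (c p) \<noteq> 0" for i f g e e'
    proof -
      let ?C = "{p\<in>Z i. f (c p) = 0}" and ?D = "{p\<in>Z i. g (c p) = 0}"
      have "topspace (subtopology T (Z i)) = Z i" using ZX[OF i] top by auto
      moreover have "closedin (subtopology T (Z i)) ?C" "closedin (subtopology T (Z i)) ?D"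
        using sub[OF cl[OF i] f] sub[OF cl[OF i] g] by (auto intro!: closedin_closed_subtopology[THEN iffD2, OF cl[OF i]])
      moreover have "?C \<union> ?D = Z i" using prod by auto
      ultimately have "?C = Z i \<or> ?D = Z i" using irr[OF i] unfolding irreducible_space_def by auto
      then show ?thesis using nz by auto
    qed
    have "\<forall>i. \<exists>e g. i < k \<longrightarrow> g \<in> formfun (Suc d) e \<and> (\<forall>p\<in>Z i. g (c p) = 0) \<and> (\<exists>p\<in>Z (Suc i). g (c p) \<noteq> 0)"
    proof
      fix i
      show "\<exists>e g. i < k \<longrightarrow> g \<in> formfun (Suc d) e \<and> (\<forall>p\<in>Z i. g (c p) = 0) \<and> (\<exists>p\<in>Z (Suc i). g (c p) \<noteq> 0)"
      proof (cases "i < k")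
        case True
        then obtain p where "p \<in> Z (Suc i)" "p \<notin> Z i" using strict by blast
        moreover have "p \<in> X" using \<open>p \<in> Z (Suc i)\<close> ZX[of "Suc i"] True by auto
        ultimately obtain e g where "g \<in> formfun (Suc d) e" "g (c p) \<noteq> 0" "\<forall>p'\<in>Z i. g (c p') = 0"
          using sep[OF cl[of i], of p] True \<open>p \<notin> Z i\<close> by auto
        then show ?thesis using \<open>p \<in> Z (Suc i)\<close> by blast
      qed auto
    qed
    from choice[OF this] obtain de where "\<forall>i. \<exists>g. i < k \<longrightarrow> g \<in> formfun (Suc d) (de i) \<and> (\<forall>p\<in>Z i. g (c p) = 0) \<and> (\<exists>p\<in>Z (Suc i). g (c p) \<noteq> 0)" ..
    from choice[OF this] obtain g where "\<forall>i. i < k \<longrightarrow> g i \<in> formfun (Suc d) (de i) \<and> (\<forall>p\<in>Z i. g i (c p) = 0) \<and> (\<exists>p\<in>Z (Suc i). g i (c p) \<noteq> 0)" ..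
    then have g: "\<And>i. i < k \<Longrightarrow> g i \<in> formfun (Suc d) (de i)" "\<And>i p. i < k \<Longrightarrow> p \<in> Z i \<Longrightarrow> g i (c p) = 0"
      "\<And>i. i < k \<Longrightarrow> \<exists>p\<in>Z (Suc i). g i (c p) \<noteq> 0" by blast+
    have de: "1 \<le> de i" if "i < k" for i
    proof (rule ccontr)
      assume "\<not> ?thesis"
      then have "de i = 0" by simp
      obtain p p' where p: "p \<in> Z i" "p' \<in> Z (Suc i)" "g i (c p') \<noteq> 0" using ne[of i] g(3)[OF \<open>i < k\<close>] \<open>i < k\<close> by auto
      have gi: "g i \<in> formfun (Suc d) 0" using g(1)[OF that] \<open>de i = 0\<close> by simp
      have "g i (\<lambda>j. 0 * c p j) = g i (c p)" "g i (\<lambda>j. 0 * c p' j) = g i (c p')"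
        using formfun_homogeneous[OF gi, of 0] by simp_all
      then show False using g(2)[OF that p(1)] p(3) by simp
    qed
    obtain p0 where p0: "p0 \<in> Z 0" using ne[of 0] by auto
    obtain j0 where j0: "j0 < Suc d" "c p0 j0 \<noteq> 0" using nt[of p0] p0 ZX[of 0] by (auto simp: nontrivial_def)
    \<comment> \<open>Taking powers gives all the separating forms one degree.\<close>
    define e where "e = (\<Prod>i<k. de i)"
    have e: "1 \<le> e" unfolding e_def using de by (simp add: Suc_le_eq prod_pos)
    have dvd: "de i dvd e" if "i < k" for i unfolding e_def using that by (intro dvd_prodI) auto
    define G where "G j = (\<lambda>x. if j = 0 then x j0 ^ e else g (j - 1) x ^ (e div de (j - 1)))" for j :: nat
    have G: "G j \<in> formfun (Suc d) e" if "j \<le> k" for j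
    proof (cases "j = 0")
      case True
      then show ?thesis using formfun_power[OF formfun_var[OF j0(1)], of e] by (simp add: G_def)
    next
      case False
      then have "j - 1 < k" using that by simp
      then show ?thesis using formfun_power[OF g(1), of "j - 1" "e div de (j - 1)"] dvd[of "j - 1"] False by (simp add: G_def)
    qed
    have G0: "\<exists>p\<in>Z 0. G 0 (c p) \<noteq> 0" using p0 j0 by (auto simp: G_def)
    have G_zero: "G (Suc i) (c p) = 0" if "i < k" "p \<in> Z i" for i p
    proof -
      have "e div de i \<noteq> 0" using dvd[OF that(1)] e de[OF that(1)] by (simp add: dvd_div_eq_0_iff)
      then show ?thesis using g(2)[OF that] by (simp add: G_def)
    qed
    have G_nz: "\<exists>p\<in>Z (Suc i). G (Suc i) (c p) \<noteq> 0" if "i < k" for i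
      using g(3)[OF that] by (auto simp: G_def)
    \<comment> \<open>Algebraic independence of the first \<open>i + 1\<close> forms as functions on \<open>Z i\<close>.\<close>
    define Ind where "Ind i \<longleftrightarrow> (\<forall>D a. (\<forall>p\<in>Z i. (\<Sum>b\<in>expo (Suc i) D. a b * mono_fun (Suc i) b (\<lambda>j. G j (c p))) = 0)
      \<longrightarrow> (\<forall>b\<in>expo (Suc i) D. a b = 0))" for i
    have Ind0: "Ind 0"
      unfolding Ind_def
    proof (intro allI impI)
      fix D a
      assume z: "\<forall>p\<in>Z 0. (\<Sum>b\<in>expo (Suc 0) D. a b * mono_fun (Suc 0) b (\<lambda>j. G j (c p))) = 0"
      have E: "expo (Suc 0) D = {\<lambda>j. if j = 0 then D else 0}"
        by (auto simp: expo_def fun_eq_iff)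
      obtain p where p: "p \<in> Z 0" "G 0 (c p) \<noteq> 0" using G0 by blast
      then show "\<forall>b\<in>expo (Suc 0) D. a b = 0" using bspec[OF z p(1)] by (simp add: E mono_fun_def)
    qed
    have Ind_Suc: "Ind (Suc i)" if IH: "Ind i" and i: "i < k" for i
    proof -
      have last: "mono_fun (Suc (Suc i)) b y = mono_fun (Suc i) b y * y (Suc i) ^ b (Suc i)" for b y
        by (simp add: mono_fun_def)
      have "\<forall>b\<in>expo (Suc (Suc i)) D. a b = 0"
        if "\<forall>p\<in>Z (Suc i). (\<Sum>b\<in>expo (Suc (Suc i)) D. a b * mono_fun (Suc (Suc i)) b (\<lambda>j. G j (c p))) = 0" for D a
        using that
      proof (induction D arbitrary: a)
        case 0
        have E: "expo (Suc (Suc i)) 0 = {\<lambda>_. 0}" by (rule expo_zero)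
        obtain p where "p \<in> Z (Suc i)" using ne[of "Suc i"] i by auto
        from bspec[OF 0 this] show ?case by (simp add: E mono_fun_def)
      next
        case (Suc D)
        define E0 where "E0 = {b\<in>expo (Suc (Suc i)) (Suc D). b (Suc i) = 0}"
        define E1 where "E1 = {b\<in>expo (Suc (Suc i)) (Suc D). b (Suc i) \<noteq> 0}"
        have E0: "E0 = expo (Suc i) (Suc D)"
          by (auto simp: E0_def expo_def) (metis le_antisym not_less_eq_eq)
        have split: "(\<Sum>b\<in>expo (Suc (Suc i)) (Suc D). h b) = (\<Sum>b\<in>E0. h b) + (\<Sum>b\<in>E1. h b)" for h :: "_ \<Rightarrow> complex"
        proof -
          have "expo (Suc (Suc i)) (Suc D) = E0 \<union> E1" "E0 \<inter> E1 = {}" "finite E0" "finite E1"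
            by (auto simp: E0_def E1_def)
          then show ?thesis by (simp add: sum.union_disjoint)
        qed
        have "\<forall>p\<in>Z i. (\<Sum>b\<in>expo (Suc i) (Suc D). a b * mono_fun (Suc i) b (\<lambda>j. G j (c p))) = 0"
        proof
          fix p assume p: "p \<in> Z i"
          then have "p \<in> Z (Suc i)" using strict[OF i] by blast
          then have "0 = (\<Sum>b\<in>E0. a b * mono_fun (Suc (Suc i)) b (\<lambda>j. G j (c p)))
              + (\<Sum>b\<in>E1. a b * mono_fun (Suc (Suc i)) b (\<lambda>j. G j (c p)))"
            using Suc.prems unfolding split by simp
          also have "(\<Sum>b\<in>E1. a b * mono_fun (Suc (Suc i)) b (\<lambda>j. G j (c p))) = 0"
            by (rule sum.neutral) (auto simp: last E1_def G_zero[OF i p])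
          also have "(\<Sum>b\<in>E0. a b * mono_fun (Suc (Suc i)) b (\<lambda>j. G j (c p)))
              = (\<Sum>b\<in>E0. a b * mono_fun (Suc i) b (\<lambda>j. G j (c p)))"
            by (intro sum.cong refl) (auto simp: last E0_def)
          finally show "(\<Sum>b\<in>expo (Suc i) (Suc D). a b * mono_fun (Suc i) b (\<lambda>j. G j (c p))) = 0"
            by (simp add: E0)
        qed
        then have a0: "a b = 0" if "b \<in> E0" for b
          using IH that unfolding Ind_def E0 by blast
        define sh where "sh b = b(Suc i := Suc (b (Suc i)))" for b :: "nat \<Rightarrow> nat"
        have sum_low: "sum (b(Suc i := x)) {..<Suc i} = sum b {..<Suc i}" for b :: "nat \<Rightarrow> nat" and x
          by (intro sum.cong) auto
        have bij: "bij_betw sh (expo (Suc (Suc i)) D) E1"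
        proof (rule bij_betw_byWitness[where f' = "\<lambda>b. b(Suc i := b (Suc i) - 1)"])
          show "sh ` expo (Suc (Suc i)) D \<subseteq> E1"
            by (auto simp: sh_def E1_def expo_def sum_low simp del: sum.lessThan_Suc simp add: sum.lessThan_Suc[of _ "Suc i"])
          show "(\<lambda>b. b(Suc i := b (Suc i) - 1)) ` E1 \<subseteq> expo (Suc (Suc i)) D"
            by (auto simp: E1_def expo_def sum_low simp del: sum.lessThan_Suc simp add: sum.lessThan_Suc[of _ "Suc i"])
        qed (auto simp: sh_def E1_def)
        define P where "P x = (\<Sum>b\<in>expo (Suc (Suc i)) D. a (sh b) * mono_fun (Suc (Suc i)) b (\<lambda>j. G j x))" for x
        have P: "P \<in> formfun (Suc d) (D * e)"
          unfolding P_def by (intro formfun_sum formfun_scale formfun_mono_compose G) (use i in auto)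
        have "\<forall>p\<in>Z (Suc i). P (c p) = 0"
        proof (rule prime[OF _ G P])
          show "\<forall>p\<in>Z (Suc i). G (Suc i) (c p) * P (c p) = 0"
          proof
            fix p assume p: "p \<in> Z (Suc i)"
            have "0 = (\<Sum>b\<in>E0. a b * mono_fun (Suc (Suc i)) b (\<lambda>j. G j (c p)))
                + (\<Sum>b\<in>E1. a b * mono_fun (Suc (Suc i)) b (\<lambda>j. G j (c p)))"
              using Suc.prems p unfolding split by simp
            also have "(\<Sum>b\<in>E0. a b * mono_fun (Suc (Suc i)) b (\<lambda>j. G j (c p))) = 0"
              using a0 by simp
            also have "(\<Sum>b\<in>E1. a b * mono_fun (Suc (Suc i)) b (\<lambda>j. G j (c p)))
                = (\<Sum>b\<in>expo (Suc (Suc i)) D. a (sh b) * mono_fun (Suc (Suc i)) (sh b) (\<lambda>j. G j (c p)))"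
              by (rule sum.reindex_bij_betw[OF bij, symmetric])
            also have "\<dots> = G (Suc i) (c p) * P (c p)"
            proof -
              have "mono_fun (Suc (Suc i)) (sh b) y = y (Suc i) * mono_fun (Suc (Suc i)) b y" for b y
              proof -
                have "mono_fun (Suc i) (sh b) y = mono_fun (Suc i) b y"
                  unfolding mono_fun_def sh_def by (intro prod.cong) auto
                then show ?thesis by (simp add: last sh_def)
              qed
              then show ?thesis by (simp add: P_def sum_distrib_left mult_ac)
            qed
            finally show "G (Suc i) (c p) * P (c p) = 0" by simp
          qed
          show "\<exists>p\<in>Z (Suc i). G (Suc i) (c p) \<noteq> 0" by (rule G_nz[OF i])
        qed (use i in auto)
        then have a1: "a (sh b) = 0" if "b \<in> expo (Suc (Suc i)) D" for b
          using Suc.IH[of "\<lambda>b. a (sh b)"] that unfolding P_def by blast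
        show ?case
        proof
          fix b assume b: "b \<in> expo (Suc (Suc i)) (Suc D)"
          show "a b = 0"
          proof (cases "b \<in> E0")
            case False
            then have "b \<in> sh ` expo (Suc (Suc i)) D"
              using b bij by (auto simp: bij_betw_def E0_def E1_def)
            then show ?thesis using a1 by blast
          qed (rule a0)
        qed
      qed
      then show ?thesis unfolding Ind_def by blast
    qed
    have "Ind i" if "i \<le> k" for i
      using that by (induction i) (auto intro: Ind0 Ind_Suc)
    then have indep: "Ind k" by simp
    show "ereal (real k) \<le> ereal (real d)"
    proof (rule ccontr)
      assume "\<not> ?thesis"
      then have "d < k" by simp
      then have "\<exists>D a. (\<exists>b\<in>expo (Suc k) D. a b \<noteq> 0) \<and>
          (\<forall>x. (\<Sum>b\<in>expo (Suc k) D. a b * mono_fun (Suc k) b (\<lambda>j. G j x)) = 0)"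
        by (rule algebraically_dependent_forms[OF _ e G])
      then obtain D a where nz: "\<exists>b\<in>expo (Suc k) D. a b \<noteq> 0"
        and z: "\<forall>x. (\<Sum>b\<in>expo (Suc k) D. a b * mono_fun (Suc k) b (\<lambda>j. G j x)) = 0" by (elim exE conjE)
      have "\<forall>b\<in>expo (Suc k) D. a b = 0"
        by (rule mp[OF spec[OF spec[OF indep[unfolded Ind_def], of D], of a]]) (simp add: z)
      then show False using nz by simp
    qed
  qed
  define Z where "Z i = {p\<in>X. \<forall>j<Suc d. i < j \<longrightarrow> c p j = 0}" for i
  have clZ: "closedin T (Z i)" for i
    unfolding closed
  proof (intro conjI ballI)
    fix p assume "p \<in> X - Z i"
    then obtain j where "j < Suc d" "i < j" "c p j \<noteq> 0" by (auto simp: Z_def)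
    then show "\<exists>e. \<exists>g\<in>formfun (Suc d) e. g (c p) \<noteq> 0 \<and> (\<forall>p'\<in>Z i. g (c p') = 0)"
      by (intro exI[of _ 1] bexI[OF _ formfun_var[of j]]) (auto simp: Z_def)
  qed (auto simp: Z_def)
  have unit: "\<exists>p\<in>X. \<forall>j<Suc d. c p j \<noteq> 0 \<longleftrightarrow> j = i" if "i < Suc d" for i
  proof -
    have "nontrivial (Suc d) (\<lambda>j. if j = i then 1 else 0)" using that by (auto simp: nontrivial_def)
    from surj[OF this] obtain p z where "p \<in> X" "z \<noteq> 0"
      "\<forall>j<Suc d. c p j = z * (if j = i then 1 else 0)" by blast
    then show ?thesis by (intro bexI[of _ p]) auto
  qed
  have "irreducible_chain T d Z"
    unfolding irreducible_chain_def
  proof (intro conjI allI impI)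
    fix i assume i: "i \<le> d"
    show "closedin T (Z i)" by (rule clZ)
    have topZ: "topspace (subtopology T (Z i)) = Z i" using top by (auto simp: Z_def)
    show "irreducible_space (subtopology T (Z i))"
      unfolding irreducible_space_def topZ
    proof (intro conjI allI impI)
      show "Z i \<noteq> {}" using unit[of i] i by (fastforce simp: Z_def)
      fix C D assume "closedin (subtopology T (Z i)) C \<and> closedin (subtopology T (Z i)) D \<and> C \<union> D = Z i"
      then have C: "closedin T C" and D: "closedin T D" and CD: "C \<union> D = Z i"
        using closedin_trans_full[OF _ clZ] by blast+
      show "C = Z i \<or> D = Z i"
      proof (rule ccontr)
        assume "\<not> ?thesis"
        then obtain p1 p2 where p1: "p1 \<in> Z i" "p1 \<notin> C" and p2: "p2 \<in> Z i" "p2 \<notin> D" using CD by blast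
        have X12: "p1 \<in> X" "p2 \<in> X" using p1 p2 by (auto simp: Z_def)
        obtain e1 f where f: "f \<in> formfun (Suc d) e1" "f (c p1) \<noteq> 0" "\<forall>p\<in>C. f (c p) = 0"
          using sep[OF C X12(1) p1(2)] by blast
        obtain e2 g where g: "g \<in> formfun (Suc d) e2" "g (c p2) \<noteq> 0" "\<forall>p\<in>D. g (c p) = 0"
          using sep[OF D X12(2) p2(2)] by blast
        obtain j1 where j1: "j1 < Suc d" "c p1 j1 \<noteq> 0" using nt[OF X12(1)] by (auto simp: nontrivial_def)
        have f': "(\<lambda>x. f x * x j1) \<in> formfun (Suc d) (e1 + 1)" by (rule formfun_mult[OF f(1) formfun_var[OF j1(1)]])
        define x where "x t = (\<lambda>j. c p1 j + t * (c p2 j - c p1 j))" for t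
        obtain t where t: "f (x t) * x t j1 \<noteq> 0" "g (x t) \<noteq> 0"
          using polyfun_common_nonzero[OF formfun_polyfun[OF f'] _ formfun_polyfun[OF g(1)], of "c p1" "c p2"]
            f(2) j1(2) g(2) unfolding x_def by auto
        have "nontrivial (Suc d) (x t)" using t j1 by (auto simp: nontrivial_def)
        from surj[OF this] obtain p z where p: "p \<in> X" "z \<noteq> 0" "\<forall>i<Suc d. c p i = z * x t i" by blast
        have "p \<in> Z i" using p p1 p2 by (auto simp: Z_def x_def)
        moreover have "f (c p) = z ^ e1 * f (x t)"
          using formfun_cong[OF f(1), of "c p" "\<lambda>i. z * x t i"] p(3) formfun_homogeneous[OF f(1)] by simp
        moreover have "g (c p) = z ^ e2 * g (x t)"
          using formfun_cong[OF g(1), of "c p" "\<lambda>i. z * x t i"] p(3) formfun_homogeneous[OF g(1)] by simp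
        moreover have "p \<in> C \<or> p \<in> D" using \<open>p \<in> Z i\<close> CD by blast
        ultimately show False using t p(2) f(3) g(3) by auto
      qed
    qed
  next
    fix i assume i: "i < d"
    obtain p where p: "p \<in> X" "\<forall>j<Suc d. c p j \<noteq> 0 \<longleftrightarrow> j = Suc i" using unit[of "Suc i"] i by auto
    then have "p \<in> Z (Suc i)" "p \<notin> Z i" using i by (auto simp: Z_def)
    moreover have "Z i \<subseteq> Z (Suc i)" by (auto simp: Z_def)
    ultimately show "Z i \<subset> Z (Suc i)" by blast
  qed
  then have "ereal (real d) \<le> krull_dim T"
    unfolding krull_dim_def by (intro SUP_upper) blast
  with upper show ?thesis by (rule antisym)
qed

section \<open>Rank and nullity\<close>

definition entries :: "complex mat \<Rightarrow> nat \<Rightarrow> nat \<Rightarrow> complex" where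
  "entries A j i = A $$ (j, i)"

lemma lin_dep_columns_iff:
  assumes A: "A \<in> carrier_mat p q" and C: "C \<subseteq> {..<q}" and inj: "inj_on (col A) C"
  shows "module.lin_dep class_ring (module_vec TYPE(complex) p) (col A ` C) \<longleftrightarrow>
    (\<exists>y. (\<exists>i\<in>C. y i \<noteq> 0) \<and> (\<forall>i. i \<notin> C \<longrightarrow> y i = 0) \<and> (\<forall>j<p. (\<Sum>i<q. entries A j i * y i) = 0))"
    (is "?L \<longleftrightarrow> ?R")
proof -
  interpret V: vec_space "TYPE(complex)" p .
  have fin: "finite C" using C finite_subset by blast
  have colsC: "col A ` C \<subseteq> carrier_vec p" using A C by auto
  have eq: "V.lincomb a (col A ` C) = 0\<^sub>v p \<longleftrightarrow> (\<forall>j<p. (\<Sum>i<q. entries A j i * (if i \<in> C then a (col A i) else 0)) = 0)" for a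
  proof -
    have "V.lincomb a (col A ` C) $ j = (\<Sum>i<q. entries A j i * (if i \<in> C then a (col A i) else 0))" if "j < p" for j
    proof -
      have "V.lincomb a (col A ` C) $ j = (\<Sum>v\<in>col A ` C. a v * v $ j)"
        using V.lincomb_index[OF that colsC] .
      also have "\<dots> = (\<Sum>i\<in>C. a (col A i) * entries A j i)"
        unfolding sum.reindex[OF inj] comp_def
        by (intro sum.cong) (use A C that in \<open>auto simp: entries_def\<close>)
      also have "\<dots> = (\<Sum>i<q. entries A j i * (if i \<in> C then a (col A i) else 0))"
        by (rule sum.mono_neutral_cong_left) (use C in auto)
      finally show ?thesis .
    qed
    moreover have "dim_vec (V.lincomb a (col A ` C)) = p"
      using V.lincomb_dim[OF _ colsC] fin by simp
    ultimately show ?thesis by (auto intro!: eq_vecI)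
  qed
  show ?thesis
  proof
    assume ?L
    then obtain a v where av: "V.lincomb a (col A ` C) = 0\<^sub>v p" "v \<in> col A ` C" "a v \<noteq> 0"
      using V.finite_lin_dep[of "col A ` C"] fin colsC by auto
    then show ?R using av(2,3) unfolding eq
      by (intro exI[of _ "\<lambda>i. if i \<in> C then a (col A i) else 0"]) auto
  next
    assume ?R
    then obtain y where y: "\<exists>i\<in>C. y i \<noteq> 0" "\<forall>i. i \<notin> C \<longrightarrow> y i = 0" "\<forall>j<p. (\<Sum>i<q. entries A j i * y i) = 0" by blast
    define a where "a v = y (the_inv_into C (col A) v)" for v
    have ay: "(if i \<in> C then a (col A i) else 0) = y i" for i
      using y(2) by (auto simp: a_def the_inv_into_f_f[OF inj])
    have "V.lincomb a (col A ` C) = 0\<^sub>v p" unfolding eq ay by (rule y(3))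
    moreover obtain i where "i \<in> C" "y i \<noteq> 0" using y(1) by blast
    moreover have "a (col A i) \<noteq> 0" using ay[of i] \<open>i \<in> C\<close> \<open>y i \<noteq> 0\<close> by simp
    ultimately show ?L unfolding V.lin_dep_def using fin by (intro exI[of _ "col A ` C"] exI[of _ a] exI[of _ "col A i"]) auto
  qed
qed

lemma rank_le_iff_nullity_ge:
  assumes A: "A \<in> carrier_mat p q"
  shows "vec_space.rank p A + k \<le> q \<longleftrightarrow> nullity_ge p q k (entries A)"
proof -
  interpret V: vec_space "TYPE(complex)" p .
  have colsp: "set (cols A) \<subseteq> carrier_vec p" using A cols_dim by blast
  have cols: "set (cols A) = col A ` {..<q}" using A by (auto simp: cols_def)
  show ?thesis
  proof
    assume rank: "V.rank A + k \<le> q"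
    show "nullity_ge p q k (entries A)"
      unfolding nullity_ge_def
    proof (intro allI impI, elim conjE)
      fix C assume C: "C \<subseteq> {..<q}" "q < card C + k"
      have finC: "finite C" using C finite_subset by blast
      show "\<exists>y. (\<exists>i\<in>C. y i \<noteq> 0) \<and> (\<forall>i. i \<notin> C \<longrightarrow> y i = 0) \<and> (\<forall>j<p. (\<Sum>i<q. entries A j i * y i) = 0)"
      proof (cases "inj_on (col A) C")
        case True
        have "V.lin_dep (col A ` C)"
        proof (rule ccontr)
          assume "\<not> V.lin_dep (col A ` C)"
          then have "card (col A ` C) \<le> V.rank A"
            by (intro V.rank_ge_card_indpt[OF A]) (use C cols in auto)
          then show False using card_image[OF True] C rank by simp
        qed
        then show ?thesis using lin_dep_columns_iff[OF A C(1) True] by simp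
      next
        case False
        then obtain i i' where i: "i \<in> C" "i' \<in> C" "i \<noteq> i'" "col A i = col A i'" by (auto simp: inj_on_def)
        have "entries A j i = entries A j i'" if "j < p" for j
        proof -
          have "entries A j i = col A i $ j" "entries A j i' = col A i' $ j"
            using A C(1) i(1,2) that by (auto simp: entries_def)
          then show ?thesis using i(4) by simp
        qed
        define y where "y l = (if l = i then 1 else if l = i' then - 1 else (0::complex))" for l
        have "(\<Sum>l<q. entries A j l * y l) = 0" if "j < p" for j
        proof -
          have "(\<Sum>l<q. entries A j l * y l) = (\<Sum>l\<in>{i, i'}. entries A j l * y l)"
            by (rule sum.mono_neutral_right) (use i C in \<open>auto simp: y_def\<close>)
          also have "\<dots> = entries A j i - entries A j i'" using i(3) by (simp add: y_def)
          finally show ?thesis using \<open>\<And>j. j < p \<Longrightarrow> entries A j i = entries A j i'\<close>[OF that] by simp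
        qed
        then show ?thesis using i by (intro exI[of _ y]) (auto simp: y_def)
      qed
    qed
  next
    assume null: "nullity_ge p q k (entries A)"
    obtain U where U: "finite U" "maximal U (\<lambda>T. T \<subseteq> set (cols A) \<and> V.lin_indpt T)"
      using maximal_exists_superset[of "set (cols A)" "\<lambda>T. T \<subseteq> set (cols A) \<and> V.lin_indpt T" "{}"]
      by (auto simp: V.lin_dep_def)
    have rank: "V.rank A = card U" by (rule V.rank_card_indpt[OF A U(2)])
    have Uc: "U \<subseteq> col A ` {..<q}" and ind: "V.lin_indpt U" using U(2) cols unfolding maximal_def by auto
    then obtain C where C: "C \<subseteq> {..<q}" "inj_on (col A) C" "U = col A ` C"
      by (metis subset_image_inj)
    show "V.rank A + k \<le> q"
    proof (rule ccontr)
      assume "\<not> ?thesis"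
      then have "q < card C + k" using rank C card_image[OF C(2)] by simp
      then have "V.lin_dep U"
        using null C(1) unfolding C(3) lin_dep_columns_iff[OF A C(1,2)] nullity_ge_def by blast
      then show False using ind by simp
    qed
  qed
qed

text \<open>If no nonzero row vector annihilates \<open>A\<close>, then its transpose has a left inverse, that is, \<open>A\<close> has
  a right inverse, and its columns span.\<close>

lemma rank_less_iff_left_kernel:
  assumes A: "A \<in> carrier_mat p q"
  shows "vec_space.rank p A < p \<longleftrightarrow> (\<exists>x. nontrivial p x \<and> (\<forall>i<q. (\<Sum>j<p. entries A j i * x j) = 0))"
proof -
  interpret V: vec_space "TYPE(complex)" p .
  have cols: "set (cols A) \<subseteq> carrier_vec p" using A cols_dim by blast
  show ?thesis
  proof
    assume rank: "V.rank A < p"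
    show "\<exists>x. nontrivial p x \<and> (\<forall>i<q. (\<Sum>j<p. entries A j i * x j) = 0)"
    proof (rule ccontr)
      assume none: "\<not> ?thesis"
      have "\<exists>P. \<forall>c\<in>{..<p}. \<forall>c'\<in>{..<p}. (\<Sum>i\<in>{..<q}. P c i * entries A c' i) = (if c = c' then 1 else 0)"
        by (rule left_inverse_of_injective[of "{..<p}" "{..<q}" "\<lambda>i c. entries A c i"])
          (use none in \<open>auto simp: nontrivial_def\<close>)
      then obtain P where P: "\<And>c c'. c < p \<Longrightarrow> c' < p \<Longrightarrow> (\<Sum>i<q. P c i * entries A c' i) = (if c = c' then 1 else 0)"
        by auto
      define X where "X = mat q p (\<lambda>(i, c). P c i)"
      have X: "X \<in> carrier_mat q p" by (simp add: X_def)
      have AX: "A * X = 1\<^sub>m p"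
      proof (rule eq_matI)
        fix c' c assume "c' < dim_row (1\<^sub>m p :: complex mat)" "c < dim_col (1\<^sub>m p :: complex mat)"
        then have cc: "c' < p" "c < p" by auto
        have "(A * X) $$ (c', c) = (\<Sum>i<q. P c i * entries A c' i)"
          using cc A by (simp add: X_def scalar_prod_def entries_def atLeast0LessThan mult.commute)
        then show "(A * X) $$ (c', c) = 1\<^sub>m p $$ (c', c)" using P cc by auto
      qed (use A in \<open>auto simp: X_def\<close>)
      have "V.span (set (cols A)) = carrier_vec p"
      proof
        show "V.span (set (cols A)) \<subseteq> carrier_vec p" using V.span_closed[OF cols] by auto
        show "carrier_vec p \<subseteq> V.span (set (cols A))"
        proof
          fix v :: "complex vec" assume v: "v \<in> carrier_vec p"
          have "A *\<^sub>v (X *\<^sub>v v) = v"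
            using assoc_mult_mat_vec[OF A X v] AX v by simp
          moreover have "A *\<^sub>v (X *\<^sub>v v) \<in> V.span (set (cols A))"
          proof -
            have "X *\<^sub>v v \<in> carrier_vec q" using X v by simp
            then have "vec q (\<lambda>i. (X *\<^sub>v v) $ i) = X *\<^sub>v v" using X by (intro eq_vecI) auto
            moreover have "mat_of_cols p (cols A) = A" using A mat_of_cols_cols[of A] by simp
            moreover have "\<forall>w\<in>set (cols A). dim_vec w = p" using cols by auto
            moreover have "length (cols A) = q" using A by simp
            ultimately have "A *\<^sub>v (X *\<^sub>v v) = V.lincomb_list (\<lambda>i. (X *\<^sub>v v) $ i) (cols A)"
              using V.lincomb_list_as_mat_mult[of "cols A" "\<lambda>i. (X *\<^sub>v v) $ i"] by simp
            then show ?thesis using V.span_list_as_span[OF cols] by (auto simp: V.span_list_def)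
          qed
          ultimately show "v \<in> V.span (set (cols A))" by simp
        qed
      qed
      moreover have "V.vs (carrier_vec p) = module_vec TYPE(complex) p"
        by (simp add: module_vec_def)
      ultimately have "V.rank A = vectorspace.dim class_ring (module_vec TYPE(complex) p)"
        by (simp only: V.rank_def)
      then have "V.rank A = p" using V.dim_is_n by simp
      then show False using rank by simp
    qed
  next
    assume "\<exists>x. nontrivial p x \<and> (\<forall>i<q. (\<Sum>j<p. entries A j i * x j) = 0)"
    then obtain x where x: "nontrivial p x" "\<And>i. i < q \<Longrightarrow> (\<Sum>j<p. entries A j i * x j) = 0" by blast
    obtain U where U: "finite U" "maximal U (\<lambda>T. T \<subseteq> set (cols A) \<and> V.lin_indpt T)"
      using maximal_exists_superset[of "set (cols A)" "\<lambda>T. T \<subseteq> set (cols A) \<and> V.lin_indpt T" "{}"]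
      by (auto simp: V.lin_dep_def)
    have rank: "V.rank A = card U" by (rule V.rank_card_indpt[OF A U(2)])
    have Uc: "U \<subseteq> set (cols A)" and ind: "V.lin_indpt U" using U(2) unfolding maximal_def by auto
    have Ucar: "U \<subseteq> carrier_vec p" using Uc cols by blast
    have le: "card U \<le> p" using V.li_le_dim(2)[OF V.fin_dim Ucar ind] V.dim_is_n by simp
    have "card U \<noteq> p"
    proof
      assume "card U = p"
      then have "V.basis U" using V.dim_li_is_basis[OF V.fin_dim U(1) Ucar ind] V.dim_is_n by simp
      then have span: "V.span U = carrier_vec p" unfolding V.basis_def by simp
      obtain j0 where j0: "j0 < p" "x j0 \<noteq> 0" using x(1) by (auto simp: nontrivial_def)
      have "unit_vec p j0 \<in> V.span U" using span by simp
      then obtain a where "V.lincomb a U = unit_vec p j0"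
        using V.finite_in_span[OF U(1) Ucar, of "unit_vec p j0"] by blast
      note a = this[symmetric]
      have kill: "(\<Sum>j<p. u $ j * x j) = 0" if "u \<in> U" for u
      proof -
        have "u \<in> col A ` {0..<q}" using that Uc A by (auto simp: cols_def)
        then obtain i where "i < q" "u = col A i" by auto
        then show ?thesis using x(2)[of i] A by (simp add: entries_def)
      qed
      have "x j0 = (\<Sum>j<p. unit_vec p j0 $ j * x j)"
      proof -
        have "(\<Sum>j<p. unit_vec p j0 $ j * x j) = (\<Sum>j<p. if j = j0 then x j else 0)"
          by (intro sum.cong) (use j0 in auto)
        then show ?thesis using j0 by simp
      qed
      also have "\<dots> = (\<Sum>j<p. (\<Sum>u\<in>U. a u * u $ j) * x j)"
        unfolding a by (intro sum.cong refl) (use V.lincomb_index[OF _ Ucar] in auto)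
      also have "\<dots> = (\<Sum>u\<in>U. a u * (\<Sum>j<p. u $ j * x j))"
        unfolding sum_distrib_left sum_distrib_right mult.assoc by (rule sum.swap)
      also have "\<dots> = 0" using kill by simp
      finally show False using j0 by simp
    qed
    then show "V.rank A < p" using rank le by simp
  qed
qed

section \<open>Projective spaces in homogeneous coordinates\<close>

definition line :: "nat \<Rightarrow> (nat \<Rightarrow> complex) \<Rightarrow> complex vec set" where
  "line d x = range (\<lambda>c. c \<cdot>\<^sub>v vec d x)"

text \<open>A chosen vector on the line \<open>l\<close>, at which forms are evaluated. Whether a form vanishes, and
  quotients of forms of equal degree, do not depend on the choice.\<close>

definition rep :: "nat \<Rightarrow> complex vec set \<Rightarrow> nat \<Rightarrow> complex" where
  "rep d l = (SOME x. nontrivial d x \<and> (\<forall>i\<ge>d. x i = 0) \<and> line d x = l)"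

lemma mem_line: "v \<in> line d x \<longleftrightarrow> (\<exists>c. v = vec d (\<lambda>i. c * x i))"
proof -
  have "c \<cdot>\<^sub>v vec d x = vec d (\<lambda>i. c * x i)" for c by (rule eq_vecI) auto
  then show ?thesis by (auto simp: line_def)
qed

lemma line_cong: "(\<And>i. i < d \<Longrightarrow> x i = y i) \<Longrightarrow> line d x = line d y"
  unfolding line_def by (intro arg_cong[where f = range] ext arg_cong2[where f = smult_vec] refl eq_vecI) auto

lemma line_scale:
  assumes "c \<noteq> 0" "\<And>i. i < d \<Longrightarrow> y i = c * x i" shows "line d y = line d x"
proof -
  have "vec d (\<lambda>i. a * y i) = vec d (\<lambda>i. (a * c) * x i)" for a
    using assms(2) by (intro eq_vecI) auto
  moreover have "vec d (\<lambda>i. a * x i) = vec d (\<lambda>i. (a / c) * y i)" for a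
    using assms by (intro eq_vecI) auto
  ultimately show ?thesis unfolding set_eq_iff mem_line by metis
qed

lemma line_eqD:
  assumes "line d x = line d y" "nontrivial d x"
  shows "\<exists>c. c \<noteq> 0 \<and> (\<forall>i<d. x i = c * y i)"
proof -
  have "vec d (\<lambda>i. 1 * x i) \<in> line d x" unfolding mem_line by blast
  then obtain c where "vec d (\<lambda>i. 1 * x i) = vec d (\<lambda>i. c * y i)" unfolding assms(1) mem_line by blast
  note eq = this
  have c: "x i = c * y i" if "i < d" for i
    using arg_cong[OF eq, of "\<lambda>v. v $ i"] that by simp
  then have "c \<noteq> 0" using assms(2) by (auto simp: nontrivial_def)
  then show ?thesis using c by blast
qed

lemma proj_space_iff: "l \<in> proj_space d \<longleftrightarrow> (\<exists>x. nontrivial d x \<and> (\<forall>i\<ge>d. x i = 0) \<and> line d x = l)"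
proof
  assume "l \<in> proj_space d"
  then obtain v where v: "v \<in> carrier_vec d" "v \<noteq> 0\<^sub>v d" "l = range (\<lambda>c. c \<cdot>\<^sub>v v)" by (auto simp: proj_space_def)
  define x where "x i = (if i < d then v $ i else 0)" for i
  have "vec d x = v" using v by (intro eq_vecI) (auto simp: x_def)
  moreover have "nontrivial d x"
  proof (rule ccontr)
    assume "\<not> nontrivial d x"
    then have "v = 0\<^sub>v d" using v by (intro eq_vecI) (auto simp: nontrivial_def x_def)
    then show False using v by simp
  qed
  ultimately show "\<exists>x. nontrivial d x \<and> (\<forall>i\<ge>d. x i = 0) \<and> line d x = l"
    using v by (intro exI[of _ x]) (auto simp: line_def x_def)
next
  assume "\<exists>x. nontrivial d x \<and> (\<forall>i\<ge>d. x i = 0) \<and> line d x = l"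
  then obtain x where x: "nontrivial d x" "line d x = l" by blast
  obtain i where i: "i < d" "x i \<noteq> 0" using x by (auto simp: nontrivial_def)
  have "vec d x \<noteq> 0\<^sub>v d"
  proof
    assume "vec d x = 0\<^sub>v d"
    then have "vec d x $ i = 0\<^sub>v d $ i" by simp
    then show False using i by simp
  qed
  then show "l \<in> proj_space d" using x(2) unfolding proj_space_def line_def by (auto intro!: exI[of _ "vec d x"])
qed

lemma rep:
  assumes "l \<in> proj_space d"
  shows "nontrivial d (rep d l)" "\<And>i. i \<ge> d \<Longrightarrow> rep d l i = 0" "line d (rep d l) = l"
  using someI_ex[OF assms[unfolded proj_space_iff]] by (auto simp: rep_def)

lemma line_in_proj_space: "nontrivial d x \<Longrightarrow> line d x \<in> proj_space d"
proof -
  assume "nontrivial d x"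
  moreover have "line d (\<lambda>i. if i < d then x i else 0) = line d x" by (rule line_cong) simp
  ultimately show ?thesis
    unfolding proj_space_iff
    by (intro exI[of _ "\<lambda>i. if i < d then x i else 0"]) (auto simp: nontrivial_def)
qed

lemma rep_line:
  assumes "nontrivial d x" obtains c where "c \<noteq> 0" "\<And>i. i < d \<Longrightarrow> rep d (line d x) i = c * x i"
  using line_eqD[OF rep(3)[OF line_in_proj_space[OF assms]] rep(1)[OF line_in_proj_space[OF assms]]] that by blast

lemma nonzero_in_line:
  assumes "l \<in> proj_space d"
  shows "v \<in> l - {0\<^sub>v d} \<longleftrightarrow> (\<exists>c. c \<noteq> 0 \<and> v = vec d (\<lambda>i. c * rep d l i))"
proof -
  obtain i where i: "i < d" "rep d l i \<noteq> 0" using rep(1)[OF assms] by (auto simp: nontrivial_def)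
  define W where "W c = vec d (\<lambda>i. c * rep d l i)" for c
  have W0: "W c = 0\<^sub>v d \<longleftrightarrow> c = 0" for c
  proof
    assume "W c = 0\<^sub>v d"
    then have "W c $ i = 0\<^sub>v d $ i" by simp
    then show "c = 0" using i by (simp add: W_def)
  next
    assume "c = 0"
    then show "W c = 0\<^sub>v d" by (intro eq_vecI) (simp_all add: W_def)
  qed
  have mem: "v \<in> l \<longleftrightarrow> (\<exists>c. v = W c)"
    using mem_line[of v d "rep d l"] rep(3)[OF assms] by (simp add: W_def)
  show ?thesis
    unfolding W_def[symmetric]
  proof
    assume v: "v \<in> l - {0\<^sub>v d}"
    then obtain c where "v = W c" using mem by blast
    then show "\<exists>c. c \<noteq> 0 \<and> v = W c" using v W0[of c] by (intro exI[of _ c]) simp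
  next
    assume "\<exists>c. c \<noteq> 0 \<and> v = W c"
    then obtain c where c: "c \<noteq> 0" "v = W c" by blast
    then have "v \<in> l" using mem by blast
    then show "v \<in> l - {0\<^sub>v d}" using c W0[of c] by simp
  qed
qed

lemma form_at_scaled:
  assumes "F \<in> forms d e"
  shows "form_at F (vec d (\<lambda>i. c * x i)) = c ^ e * peval F x"
proof -
  have "form_at F (vec d (\<lambda>i. c * x i)) = peval F (\<lambda>i. c * x i)"
    by (rule formfun_cong[OF formfun_of_forms[OF assms]]) simp
  then show ?thesis using formfun_homogeneous[OF formfun_of_forms[OF assms], of c x] by simp
qed

lemma form_nonzero_iff:
  assumes "F \<in> forms d e" "l \<in> proj_space d"
  shows "(\<forall>v\<in>l - {0\<^sub>v d}. form_at F v \<noteq> 0) \<longleftrightarrow> peval F (rep d l) \<noteq> 0"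
proof
  assume "\<forall>v\<in>l - {0\<^sub>v d}. form_at F v \<noteq> 0"
  moreover have "vec d (\<lambda>i. 1 * rep d l i) \<in> l - {0\<^sub>v d}"
    unfolding nonzero_in_line[OF assms(2)] by (intro exI[of _ 1]) simp
  ultimately have "form_at F (vec d (\<lambda>i. 1 * rep d l i)) \<noteq> 0" by blast
  then show "peval F (rep d l) \<noteq> 0" unfolding form_at_scaled[OF assms(1)] by simp
next
  assume "peval F (rep d l) \<noteq> 0"
  show "\<forall>v\<in>l - {0\<^sub>v d}. form_at F v \<noteq> 0"
  proof
    fix v assume "v \<in> l - {0\<^sub>v d}"
    then obtain c where "c \<noteq> 0" "v = vec d (\<lambda>i. c * rep d l i)" unfolding nonzero_in_line[OF assms(2)] by blast
    then show "form_at F v \<noteq> 0" using \<open>peval F (rep d l) \<noteq> 0\<close> form_at_scaled[OF assms(1)] by simp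
  qed
qed

lemma zariski_eq:
  "zariski d = topology_generated_by {{l \<in> proj_space d. f (rep d l) \<noteq> 0} | f e. f \<in> formfun d e}"
proof -
  have eq: "{l \<in> proj_space d. \<forall>v\<in>l - {0\<^sub>v d}. form_at F v \<noteq> 0} = {l \<in> proj_space d. peval F (rep d l) \<noteq> 0}"
    if "F \<in> forms d e" for F e using form_nonzero_iff[OF that] by blast
  have "{{l \<in> proj_space d. \<forall>v\<in>l - {0\<^sub>v d}. form_at F v \<noteq> 0} | F e. F \<in> forms d e}
      = {{l \<in> proj_space d. f (rep d l) \<noteq> 0} | f e. f \<in> formfun d e}" (is "?A = ?B")
  proof (intro equalityI subsetI)
    fix S assume "S \<in> ?A"
    then obtain F e where F: "F \<in> forms d e" "S = {l \<in> proj_space d. \<forall>v\<in>l - {0\<^sub>v d}. form_at F v \<noteq> 0}" by blast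
    show "S \<in> ?B" unfolding F(2) eq[OF F(1)] using formfun_of_forms[OF F(1)] by blast
  next
    fix S assume "S \<in> ?B"
    then obtain f e where f: "f \<in> formfun d e" "S = {l \<in> proj_space d. f (rep d l) \<noteq> 0}" by blast
    obtain F where F: "F \<in> forms d e" "peval F = f" using forms_of_formfun[OF f(1)] by blast
    show "S \<in> ?A" unfolding f(2) F(2)[symmetric] eq[OF F(1), symmetric] using F(1) by blast
  qed
  then show ?thesis unfolding zariski_def by (rule arg_cong)
qed

lemma topspace_zariski [simp]: "topspace (zariski d) = proj_space d"
proof -
  have "proj_space d = {l \<in> proj_space d. (\<lambda>_. 1::complex) (rep d l) \<noteq> 0}" by simp
  then have "proj_space d \<in> {{l \<in> proj_space d. f (rep d l) \<noteq> 0} | f e. f \<in> formfun d e}"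
    by (intro CollectI exI[of _ "\<lambda>_. 1"] exI[of _ 0] conjI formfun_const)
  then show ?thesis unfolding zariski_eq topology_generated_by_topspace by auto
qed

lemma openin_zariski_iff:
  "openin (zariski d) U \<longleftrightarrow> U \<subseteq> proj_space d \<and> (\<forall>l\<in>U. \<exists>e. \<exists>f\<in>formfun d e. f (rep d l) \<noteq> 0 \<and>
     (\<forall>l'\<in>proj_space d. f (rep d l') \<noteq> 0 \<longrightarrow> l' \<in> U))" (is "?L \<longleftrightarrow> ?R")
proof
  assume L: ?L
  have "generate_topology_on {{l \<in> proj_space d. f (rep d l) \<noteq> 0} | f e. f \<in> formfun d e} U"
    using L unfolding zariski_eq openin_topology_generated_by_iff .
  then have "\<forall>l\<in>U. \<exists>e. \<exists>f\<in>formfun d e. f (rep d l) \<noteq> 0 \<and> (\<forall>l'\<in>proj_space d. f (rep d l') \<noteq> 0 \<longrightarrow> l' \<in> U)"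
  proof (induction rule: generate_topology_on.induct)
    case Empty
    then show ?case by simp
  next
    case (Int A B)
    show ?case
    proof
      fix l assume l: "l \<in> A \<inter> B"
      obtain e f where f: "f \<in> formfun d e" "f (rep d l) \<noteq> 0" "\<forall>l'\<in>proj_space d. f (rep d l') \<noteq> 0 \<longrightarrow> l' \<in> A"
        using Int(3) l by blast
      obtain e' g where g: "g \<in> formfun d e'" "g (rep d l) \<noteq> 0" "\<forall>l'\<in>proj_space d. g (rep d l') \<noteq> 0 \<longrightarrow> l' \<in> B"
        using Int(4) l by blast
      show "\<exists>e. \<exists>f\<in>formfun d e. f (rep d l) \<noteq> 0 \<and> (\<forall>l'\<in>proj_space d. f (rep d l') \<noteq> 0 \<longrightarrow> l' \<in> A \<inter> B)"
        using f g by (intro exI[of _ "e + e'"] bexI[of _ "\<lambda>x. f x * g x"] formfun_mult) auto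
    qed
  next
    case (UN K)
    show ?case
    proof
      fix l assume "l \<in> \<Union>K"
      then obtain k where k: "k \<in> K" "l \<in> k" by blast
      from bspec[OF UN(2)[OF k(1)] k(2)] show "\<exists>e. \<exists>f\<in>formfun d e. f (rep d l) \<noteq> 0 \<and> (\<forall>l'\<in>proj_space d. f (rep d l') \<noteq> 0 \<longrightarrow> l' \<in> \<Union>K)"
        using k(1) by blast
    qed
  next
    case (Basis s)
    then obtain f e where "f \<in> formfun d e" "s = {l \<in> proj_space d. f (rep d l) \<noteq> 0}" by blast
    then show ?case by blast
  qed
  moreover have "U \<subseteq> proj_space d" using openin_subset[OF L] by simp
  ultimately show ?R by blast
next
  assume R: ?R
  show ?L
  proof (subst openin_subopen, intro ballI)
    fix l assume l: "l \<in> U"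
    with R obtain e f where f: "f \<in> formfun d e" "f (rep d l) \<noteq> 0" "\<forall>l'\<in>proj_space d. f (rep d l') \<noteq> 0 \<longrightarrow> l' \<in> U" by blast
    let ?T = "{l \<in> proj_space d. f (rep d l) \<noteq> 0}"
    have "openin (zariski d) ?T"
      unfolding zariski_eq by (rule topology_generated_by_Basis) (use f(1) in blast)
    moreover have "l \<in> ?T" "?T \<subseteq> U" using l f R by auto
    ultimately show "\<exists>T. openin (zariski d) T \<and> l \<in> T \<and> T \<subseteq> U" by blast
  qed
qed

lemma openin_nonvanishing: "f \<in> formfun d e \<Longrightarrow> openin (zariski d) {l \<in> proj_space d. f (rep d l) \<noteq> 0}"
  unfolding zariski_eq by (rule topology_generated_by_Basis) blast

lemma closedin_zariski_subtopology_iff: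
  assumes X: "X \<subseteq> proj_space d"
  shows "closedin (subtopology (zariski d) X) Z \<longleftrightarrow>
    Z \<subseteq> X \<and> (\<forall>l\<in>X - Z. \<exists>e. \<exists>f\<in>formfun d e. f (rep d l) \<noteq> 0 \<and> (\<forall>l'\<in>Z. f (rep d l') = 0))" (is "?L \<longleftrightarrow> ?R")
proof
  assume ?L
  then obtain S where S: "closedin (zariski d) S" "Z = S \<inter> X" by (auto simp: closedin_subtopology)
  have op: "openin (zariski d) (proj_space d - S)" using S(1) by (auto simp: closedin_def)
  show ?R
  proof (intro conjI ballI)
    show "Z \<subseteq> X" using S by simp
    fix l assume "l \<in> X - Z"
    then have "l \<in> proj_space d - S" using X S by auto
    then obtain e f where f: "f \<in> formfun d e" "f (rep d l) \<noteq> 0" "\<forall>l'\<in>proj_space d. f (rep d l') \<noteq> 0 \<longrightarrow> l' \<in> proj_space d - S"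
      using op unfolding openin_zariski_iff by blast
    have "\<forall>l'\<in>Z. f (rep d l') = 0" using f(3) S(2) X by blast
    then show "\<exists>e. \<exists>f\<in>formfun d e. f (rep d l) \<noteq> 0 \<and> (\<forall>l'\<in>Z. f (rep d l') = 0)" using f(1,2) by blast
  qed
next
  assume R: ?R
  define U where "U = {l \<in> proj_space d. \<exists>e. \<exists>f\<in>formfun d e. f (rep d l) \<noteq> 0 \<and> (\<forall>l'\<in>Z. f (rep d l') = 0)}"
  have "openin (zariski d) U"
    unfolding openin_zariski_iff
  proof (intro conjI ballI)
    fix l assume "l \<in> U"
    then obtain e f where f: "f \<in> formfun d e" "f (rep d l) \<noteq> 0" "\<forall>l'\<in>Z. f (rep d l') = 0" by (auto simp: U_def)
    then show "\<exists>e. \<exists>f\<in>formfun d e. f (rep d l) \<noteq> 0 \<and> (\<forall>l'\<in>proj_space d. f (rep d l') \<noteq> 0 \<longrightarrow> l' \<in> U)"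
      by (intro exI[of _ e] bexI[of _ f]) (auto simp: U_def)
  qed (auto simp: U_def)
  then have "closedin (zariski d) (proj_space d - U)" using openin_closedin_eq[of "zariski d" U] by simp
  moreover have "Z = (proj_space d - U) \<inter> X" using R X by (auto simp: U_def)
  ultimately show ?L by (auto simp: closedin_subtopology)
qed

text \<open>A coordinate subspace \<open>C\<close> of codimension \<open>d + 1\<close> that misses the kernel makes the coordinates
  outside \<open>C\<close> linear coordinates on the kernel, and forms on the kernel correspond to forms in these
  coordinates.\<close>

lemma krull_dim_linear_subspace:
  assumes null: "nullity_ge p q (Suc d) T" and not: "\<not> nullity_ge p q (Suc (Suc d)) T"
  shows "krull_dim (subtopology (zariski q) {l \<in> proj_space q. \<forall>j<p. (\<Sum>i<q. T j i * rep q l i) = 0}) = ereal (real d)"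
proof -
  define X where "X = {l \<in> proj_space q. \<forall>j<p. (\<Sum>i<q. T j i * rep q l i) = 0}"
  have dq: "Suc d \<le> q" using null nullity_ge_mono[of p q "Suc d" T "Suc q"] not_nullity_ge_Suc not_less_eq_eq by blast
  obtain C0 where C0: "C0 \<subseteq> {..<q}" "q < card C0 + Suc (Suc d)"
    and none0: "\<nexists>y. (\<exists>i\<in>C0. y i \<noteq> 0) \<and> (\<forall>i. i \<notin> C0 \<longrightarrow> y i = 0) \<and> (\<forall>j<p. (\<Sum>i<q. T j i * y i) = 0)"
    using not unfolding nullity_ge_def by blast
  have "q - Suc d \<le> card C0" using C0 by simp
  then obtain C where C: "C \<subseteq> C0" "card C = q - Suc d" by (rule obtain_subset_with_card_n)
  have Cq: "C \<subseteq> {..<q}" using C C0 by blast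
  have none: "y i = 0" if y: "\<And>i. i \<notin> C \<Longrightarrow> y i = 0" "\<And>j. j < p \<Longrightarrow> (\<Sum>i<q. T j i * y i) = 0" for y i
  proof (rule ccontr)
    assume nz: "y i \<noteq> 0"
    then have "i \<in> C0" using y(1)[of i] C(1) by blast
    moreover have "\<forall>i. i \<notin> C0 \<longrightarrow> y i = 0" using y(1) C(1) by blast
    ultimately show False using none0 nz y(2) by blast
  qed
  have finC: "finite C" using Cq finite_subset by blast
  define B where "B = {..<q} - C"
  have "card B = Suc d" unfolding B_def using card_Diff_subset[OF finC Cq] C(2) dq by simp
  then obtain en where en: "bij_betw en {..<Suc d} B"
    using ex_bij_betw_nat_finite[of B] by (auto simp: B_def atLeast0LessThan)
  have enB: "en i \<in> B" if "i < Suc d" for i using en that by (auto simp: bij_betw_def)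
  have en_inj: "en i = en j \<longleftrightarrow> i = j" if "i < Suc d" "j < Suc d" for i j
    using en that by (auto simp: bij_betw_def inj_on_def)
  \<comment> \<open>The coordinates outside \<open>C\<close> are coordinates on the kernel; here is the dual basis.\<close>
  have "\<exists>y. y (en k) = 1 \<and> (\<forall>i. i \<notin> insert (en k) C \<longrightarrow> y i = 0) \<and> (\<forall>j<p. (\<Sum>i<q. T j i * y i) = 0)" if k: "k < Suc d" for k
  proof -
    have "en k \<notin> C" "en k < q" using enB[OF k] by (auto simp: B_def)
    then have "insert (en k) C \<subseteq> {..<q}" "q < card (insert (en k) C) + Suc d"
      using finC Cq C(2) dq by auto
    then obtain y where y: "\<exists>i\<in>insert (en k) C. y i \<noteq> 0" "\<forall>i. i \<notin> insert (en k) C \<longrightarrow> y i = 0"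
        "\<forall>j<p. (\<Sum>i<q. T j i * y i) = 0"
      using null unfolding nullity_ge_def by blast
    have "y (en k) \<noteq> 0"
    proof
      assume "y (en k) = 0"
      then have out: "y i = 0" if "i \<notin> C" for i using y(2) that by (cases "i = en k") auto
      have "y i = 0" for i by (rule none[OF out]) (use y(3) in auto)
      then show False using y(1) by blast
    qed
    moreover have "(\<Sum>i<q. T j i * (y i / y (en k))) = 0" if "j < p" for j
      using y(3) that by (simp add: sum_divide_distrib[symmetric])
    ultimately show ?thesis using y(2) by (intro exI[of _ "\<lambda>i. y i / y (en k)"]) auto
  qed
  then have "\<forall>k. \<exists>y. k < Suc d \<longrightarrow> y (en k) = 1 \<and> (\<forall>i. i \<notin> insert (en k) C \<longrightarrow> y i = 0) \<and> (\<forall>j<p. (\<Sum>i<q. T j i * y i) = 0)"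
    by blast
  from choice[OF this] obtain Y where
    Y: "\<And>k. k < Suc d \<Longrightarrow> Y k (en k) = 1" "\<And>k i. k < Suc d \<Longrightarrow> i \<notin> insert (en k) C \<Longrightarrow> Y k i = 0"
      "\<And>k j. k < Suc d \<Longrightarrow> j < p \<Longrightarrow> (\<Sum>i<q. T j i * Y k i) = 0" by auto
  define \<theta> where "\<theta> x i = (\<Sum>k<Suc d. Y k i * x k)" for x :: "nat \<Rightarrow> complex" and i
  have \<theta>_en: "\<theta> x (en k) = x k" if k: "k < Suc d" for x k
  proof -
    have "Y k' (en k) * x k' = (if k' = k then x k else 0)" if "k' < Suc d" for k'
      using Y(1)[OF k] Y(2)[OF that, of "en k"] en_inj[OF k that] enB[OF k] by (auto simp: B_def)
    then have "\<theta> x (en k) = (\<Sum>k'<Suc d. if k' = k then x k else 0)"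
      unfolding \<theta>_def by (intro sum.cong) auto
    then show ?thesis using k by simp
  qed
  have \<theta>_ker: "(\<Sum>i<q. T j i * \<theta> x i) = 0" if "j < p" for x j
  proof -
    have "(\<Sum>i<q. T j i * \<theta> x i) = (\<Sum>i<q. \<Sum>k<Suc d. T j i * Y k i * x k)"
      by (simp add: \<theta>_def sum_distrib_left mult.assoc del: sum.lessThan_Suc)
    also have "\<dots> = (\<Sum>k<Suc d. (\<Sum>i<q. T j i * Y k i) * x k)"
      unfolding sum_distrib_right by (rule sum.swap)
    also have "\<dots> = 0" using Y(3)[OF _ that] by simp
    finally show ?thesis .
  qed
  have \<theta>_out: "\<theta> x i = 0" if "q \<le> i" for x i
    unfolding \<theta>_def
  proof (rule sum.neutral, intro ballI)
    fix k assume "k \<in> {..<Suc d}"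
    then have "k < Suc d" by simp
    moreover have "i \<notin> insert (en k) C" using enB[OF \<open>k < Suc d\<close>] Cq that by (auto simp: B_def)
    ultimately show "Y k i * x k = 0" using Y(2) by simp
  qed
  define c where "c l k = rep q l (en k)" for l k
  have \<theta>_c: "\<theta> (c l) i = rep q l i" if l: "l \<in> X" for l i
  proof -
    have lp: "l \<in> proj_space q" using l by (simp add: X_def)
    have "\<theta> (c l) i - rep q l i = 0"
    proof (rule none[of "\<lambda>i. \<theta> (c l) i - rep q l i"])
      fix i assume "i \<notin> C"
      show "\<theta> (c l) i - rep q l i = 0"
      proof (cases "i < q")
        case True
        then have "i \<in> en ` {..<Suc d}" using en \<open>i \<notin> C\<close> by (simp add: bij_betw_def B_def)
        then show ?thesis using \<theta>_en by (auto simp: c_def)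
      next
        case False
        then show ?thesis using \<theta>_out rep(2)[OF lp] by simp
      qed
    next
      fix j assume "j < p"
      then show "(\<Sum>i<q. T j i * (\<theta> (c l) i - rep q l i)) = 0"
        using \<theta>_ker[of j "c l"] l by (simp add: right_diff_distrib sum_subtractf X_def)
    qed
    then show ?thesis by simp
  qed
  have Xp: "X \<subseteq> proj_space q" by (auto simp: X_def)
  have "krull_dim (subtopology (zariski q) X) = ereal (real d)"
  proof (rule krull_dim_projective[where X = X and c = c])
    show "topspace (subtopology (zariski q) X) = X" using Xp by auto
    show "nontrivial (Suc d) (c l)" if l: "l \<in> X" for l
    proof (rule ccontr)
      assume "\<not> nontrivial (Suc d) (c l)"
      then have "\<theta> (c l) i = 0" for i by (auto simp: \<theta>_def nontrivial_def)
      then show False using \<theta>_c[OF l] rep(1)[of l q] l Xp by (auto simp: nontrivial_def)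
    qed
    show "\<exists>l\<in>X. \<exists>z. z \<noteq> 0 \<and> (\<forall>i<Suc d. c l i = z * x i)" if x: "nontrivial (Suc d) x" for x
    proof -
      obtain k where k: "k < Suc d" "x k \<noteq> 0" using x by (auto simp: nontrivial_def)
      have nt: "nontrivial q (\<theta> x)"
        using \<theta>_en[OF k(1), of x] k enB[OF k(1)] by (auto simp: nontrivial_def B_def intro!: exI[of _ "en k"])
      obtain z where z: "z \<noteq> 0" "\<And>i. i < q \<Longrightarrow> rep q (line q (\<theta> x)) i = z * \<theta> x i" using rep_line[OF nt] by blast
      have "(\<Sum>i<q. T j i * rep q (line q (\<theta> x)) i) = 0" if "j < p" for j
      proof -
        have "(\<Sum>i<q. T j i * rep q (line q (\<theta> x)) i) = z * (\<Sum>i<q. T j i * \<theta> x i)"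
          unfolding sum_distrib_left by (intro sum.cong) (auto simp: z(2))
        then show ?thesis using \<theta>_ker[OF that] by simp
      qed
      then have "line q (\<theta> x) \<in> X" using line_in_proj_space[OF nt] by (simp add: X_def)
      moreover have "c (line q (\<theta> x)) i = z * x i" if "i < Suc d" for i
        using z(2)[of "en i"] enB[OF that] \<theta>_en[OF that] by (simp add: c_def B_def)
      ultimately show ?thesis using z(1) by blast
    qed
    fix Z
    have "(\<exists>e. \<exists>f\<in>formfun q e. f (rep q l) \<noteq> 0 \<and> (\<forall>l'\<in>Z. f (rep q l') = 0)) \<longleftrightarrow>
        (\<exists>e. \<exists>g\<in>formfun (Suc d) e. g (c l) \<noteq> 0 \<and> (\<forall>l'\<in>Z. g (c l') = 0))"
      if Z: "Z \<subseteq> X" and l: "l \<in> X" for l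
    proof
      assume "\<exists>e. \<exists>f\<in>formfun q e. f (rep q l) \<noteq> 0 \<and> (\<forall>l'\<in>Z. f (rep q l') = 0)"
      then obtain e f where f: "f \<in> formfun q e" "f (rep q l) \<noteq> 0" "\<forall>l'\<in>Z. f (rep q l') = 0" by blast
      have "(\<lambda>x. \<theta> x i) \<in> formfun (Suc d) 1" for i
        unfolding \<theta>_def by (intro formfun_sum formfun_scale formfun_var) simp
      from formfun_compose[OF f(1) this] have "(\<lambda>x. f (\<theta> x)) \<in> formfun (Suc d) e" by simp
      moreover have "\<theta> (c l') = rep q l'" if "l' \<in> X" for l' using \<theta>_c[OF that] by (simp add: fun_eq_iff)
      ultimately show "\<exists>e. \<exists>g\<in>formfun (Suc d) e. g (c l) \<noteq> 0 \<and> (\<forall>l'\<in>Z. g (c l') = 0)"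
        using f(2,3) l Z by (intro exI[of _ e] bexI[of _ "\<lambda>x. f (\<theta> x)"]) auto
    next
      assume "\<exists>e. \<exists>g\<in>formfun (Suc d) e. g (c l) \<noteq> 0 \<and> (\<forall>l'\<in>Z. g (c l') = 0)"
      then obtain e g where g: "g \<in> formfun (Suc d) e" "g (c l) \<noteq> 0" "\<forall>l'\<in>Z. g (c l') = 0" by blast
      have "(\<lambda>y. y (en k)) \<in> formfun q 1" if "k < Suc d" for k
        using formfun_var[of "en k" q] enB[OF that] by (simp add: B_def)
      from formfun_compose[OF g(1), of "\<lambda>y k. y (en k)", OF this] have "(\<lambda>y. g (\<lambda>k. y (en k))) \<in> formfun q e" by simp
      then show "\<exists>e. \<exists>f\<in>formfun q e. f (rep q l) \<noteq> 0 \<and> (\<forall>l'\<in>Z. f (rep q l') = 0)"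
        using g(2,3) by (intro exI[of _ e] bexI[of _ "\<lambda>y. g (\<lambda>k. y (en k))"]) (auto simp: c_def[abs_def])
    qed
    then show "closedin (subtopology (zariski q) X) Z \<longleftrightarrow> Z \<subseteq> X \<and>
        (\<forall>l\<in>X - Z. \<exists>e. \<exists>g\<in>formfun (Suc d) e. g (c l) \<noteq> 0 \<and> (\<forall>l'\<in>Z. g (c l') = 0))"
      unfolding closedin_zariski_subtopology_iff[OF Xp] by blast
  qed
  then show ?thesis by (simp add: X_def)
qed

section \<open>Maps given locally by forms\<close>

lemma openin_zariski_subtopology_iff:
  assumes X: "X \<subseteq> proj_space d"
  shows "openin (subtopology (zariski d) X) V \<longleftrightarrow>
    V \<subseteq> X \<and> (\<forall>l\<in>V. \<exists>e. \<exists>f\<in>formfun d e. f (rep d l) \<noteq> 0 \<and> (\<forall>l'\<in>X. f (rep d l') \<noteq> 0 \<longrightarrow> l' \<in> V))" (is "?L \<longleftrightarrow> ?R")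
proof -
  have top: "topspace (subtopology (zariski d) X) = X" using X by auto
  have "?L \<longleftrightarrow> V \<subseteq> X \<and> closedin (subtopology (zariski d) X) (X - V)"
    unfolding openin_closedin_eq top by simp
  also have "\<dots> \<longleftrightarrow> ?R"
    unfolding closedin_zariski_subtopology_iff[OF X] by (auto simp: double_diff) blast+
  finally show ?thesis .
qed

lemma regular_on_iff:
  assumes U: "U \<subseteq> proj_space d"
  shows "regular_on d U g \<longleftrightarrow> (\<forall>p\<in>U. \<exists>k e. \<exists>D\<in>formfun d k. \<exists>f\<in>formfun d e. \<exists>h\<in>formfun d e.
    D (rep d p) \<noteq> 0 \<and> (\<forall>l\<in>U. D (rep d l) \<noteq> 0 \<longrightarrow> h (rep d l) \<noteq> 0 \<and> g l = f (rep d l) / h (rep d l)))" (is "?L \<longleftrightarrow> ?R")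
proof
  assume L: ?L
  show ?R
  proof
    fix p assume p: "p \<in> U"
    obtain W e F G where W: "openin (zariski d) W" "p \<in> W" and F: "F \<in> forms d e" and G: "G \<in> forms d e"
      and eq: "\<And>l v. l \<in> W \<inter> U \<Longrightarrow> v \<in> l - {0\<^sub>v d} \<Longrightarrow> form_at G v \<noteq> 0 \<and> g l = form_at F v / form_at G v"
      using L[unfolded regular_on_def, rule_format, OF p] by blast
    obtain k D where D: "D \<in> formfun d k" "D (rep d p) \<noteq> 0" "\<forall>l'\<in>proj_space d. D (rep d l') \<noteq> 0 \<longrightarrow> l' \<in> W"
      using W unfolding openin_zariski_iff by blast
    have "peval G (rep d l) \<noteq> 0 \<and> g l = peval F (rep d l) / peval G (rep d l)" if l: "l \<in> U" "D (rep d l) \<noteq> 0" for l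
    proof -
      have lp: "l \<in> proj_space d" and lW: "l \<in> W \<inter> U" using l U D(3) by auto
      have "vec d (\<lambda>i. 1 * rep d l i) \<in> l - {0\<^sub>v d}"
        unfolding nonzero_in_line[OF lp] by (intro exI[of _ 1]) simp
      from eq[OF lW this] show ?thesis unfolding form_at_scaled[OF F] form_at_scaled[OF G] by simp
    qed
    then show "\<exists>k e. \<exists>D\<in>formfun d k. \<exists>f\<in>formfun d e. \<exists>h\<in>formfun d e.
      D (rep d p) \<noteq> 0 \<and> (\<forall>l\<in>U. D (rep d l) \<noteq> 0 \<longrightarrow> h (rep d l) \<noteq> 0 \<and> g l = f (rep d l) / h (rep d l))"
      using D(1,2) formfun_of_forms[OF F] formfun_of_forms[OF G] by blast
  qed
next
  assume R: ?R
  show ?L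
    unfolding regular_on_def
  proof
    fix p assume p: "p \<in> U"
    obtain k e D f h where D: "D \<in> formfun d k" "D (rep d p) \<noteq> 0" and f: "f \<in> formfun d e" and h: "h \<in> formfun d e"
      and eq: "\<And>l. l \<in> U \<Longrightarrow> D (rep d l) \<noteq> 0 \<Longrightarrow> h (rep d l) \<noteq> 0 \<and> g l = f (rep d l) / h (rep d l)"
      using R[rule_format, OF p] by blast
    obtain F where F: "F \<in> forms d e" "peval F = f" using forms_of_formfun[OF f] by blast
    obtain G where G: "G \<in> forms d e" "peval G = h" using forms_of_formfun[OF h] by blast
    let ?W = "{l \<in> proj_space d. D (rep d l) \<noteq> 0}"
    have "openin (zariski d) ?W" by (rule openin_nonvanishing[OF D(1)])
    moreover have "p \<in> ?W" using p U D by auto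
    moreover have "form_at G v \<noteq> 0 \<and> g l = form_at F v / form_at G v"
      if l: "l \<in> ?W \<inter> U" and v: "v \<in> l - {0\<^sub>v d}" for l v
    proof -
      have lp: "l \<in> proj_space d" using l by simp
      obtain c where c: "c \<noteq> 0" "v = vec d (\<lambda>i. c * rep d l i)" using v unfolding nonzero_in_line[OF lp] by blast
      have "form_at F v = c ^ e * f (rep d l)" "form_at G v = c ^ e * h (rep d l)"
        unfolding c(2) by (subst form_at_scaled[OF F(1)], simp only: F(2))
          (subst form_at_scaled[OF G(1)], simp only: G(2))
      then show ?thesis using eq[of l] l c(1) by simp
    qed
    ultimately show "\<exists>W e F G. openin (zariski d) W \<and> p \<in> W \<and> F \<in> forms d e \<and> G \<in> forms d e \<and>
        (\<forall>l \<in> W \<inter> U. \<forall>v \<in> l - {0\<^sub>v d}. form_at G v \<noteq> 0 \<and> g l = form_at F v / form_at G v)"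
      using F(1) G(1) by blast
  qed
qed

text \<open>Near each point, that is, where some form \<open>D\<close> does not vanish, the map is given by forms \<open>\<sigma>\<close> of one
  degree in homogeneous coordinates.\<close>

definition locally_by_forms where
  "locally_by_forms a X b f \<longleftrightarrow> (\<forall>p\<in>X. \<exists>k e \<sigma>. \<exists>D\<in>formfun a k. D (rep a p) \<noteq> 0 \<and> (\<forall>i<b. (\<lambda>x. \<sigma> x i) \<in> formfun a e) \<and>
     (\<forall>q\<in>X. D (rep a q) \<noteq> 0 \<longrightarrow> nontrivial b (\<sigma> (rep a q)) \<and> f q = line b (\<sigma> (rep a q))))"

lemma forms_on_line:
  assumes "nontrivial b y"
  obtains c where "c \<noteq> 0" "\<And>k h. h \<in> formfun b k \<Longrightarrow> h (rep b (line b y)) = c ^ k * h y"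
proof -
  obtain c where c: "c \<noteq> 0" "\<And>i. i < b \<Longrightarrow> rep b (line b y) i = c * y i" using rep_line[OF assms] by blast
  have "h (rep b (line b y)) = c ^ k * h y" if "h \<in> formfun b k" for k h
    using formfun_cong[OF that, of "rep b (line b y)" "\<lambda>i. c * y i"] c(2) formfun_homogeneous[OF that, of c y] by simp
  then show thesis using that c(1) by blast
qed

lemma locally_by_forms_image:
  assumes "locally_by_forms a X b f" "p \<in> X" shows "f p \<in> proj_space b"
  using bspec[OF assms(1)[unfolded locally_by_forms_def] assms(2)] assms(2)
  by (elim exE bexE conjE) (auto intro: line_in_proj_space)

lemma locally_by_forms_continuous:
  assumes X: "X \<subseteq> proj_space a" and f: "locally_by_forms a X b f"
  shows "continuous_map (subtopology (zariski a) X) (zariski b) f"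
  unfolding continuous_map_def
proof (intro conjI allI impI)
  have top: "topspace (subtopology (zariski a) X) = X" using X by auto
  show "f \<in> topspace (subtopology (zariski a) X) \<rightarrow> topspace (zariski b)"
    using locally_by_forms_image[OF f] top by auto
  fix U assume U: "openin (zariski b) U"
  show "openin (subtopology (zariski a) X) {x \<in> topspace (subtopology (zariski a) X). f x \<in> U}"
    unfolding top openin_zariski_subtopology_iff[OF X]
  proof (intro conjI ballI)
    fix p assume p: "p \<in> {x \<in> X. f x \<in> U}"
    then have pX: "p \<in> X" by simp
    obtain m h where h: "h \<in> formfun b m" "h (rep b (f p)) \<noteq> 0" "\<forall>l\<in>proj_space b. h (rep b l) \<noteq> 0 \<longrightarrow> l \<in> U"
      using U p unfolding openin_zariski_iff by blast
    obtain k e \<sigma> D where D: "D \<in> formfun a k" "D (rep a p) \<noteq> 0" and "\<forall>i<b. (\<lambda>x. \<sigma> x i) \<in> formfun a e"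
      and loc: "\<forall>q\<in>X. D (rep a q) \<noteq> 0 \<longrightarrow> nontrivial b (\<sigma> (rep a q)) \<and> f q = line b (\<sigma> (rep a q))"
      using bspec[OF f[unfolded locally_by_forms_def] pX] by (elim exE bexE conjE)
    then have \<sigma>: "\<And>i. i < b \<Longrightarrow> (\<lambda>x. \<sigma> x i) \<in> formfun a e" by blast
    have nt: "nontrivial b (\<sigma> (rep a q))" and fq: "f q = line b (\<sigma> (rep a q))"
      if "q \<in> X" "D (rep a q) \<noteq> 0" for q using bspec[OF loc that(1)] that(2) by auto
    have iff: "h (rep b (f q)) \<noteq> 0 \<longleftrightarrow> h (\<sigma> (rep a q)) \<noteq> 0" if q: "q \<in> X" "D (rep a q) \<noteq> 0" for q
    proof -
      obtain c where "c \<noteq> 0" "h (rep b (line b (\<sigma> (rep a q)))) = c ^ m * h (\<sigma> (rep a q))"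
        using forms_on_line[OF nt[OF q]] h(1) by metis
      then show ?thesis using fq[OF q] by simp
    qed
    have "(\<lambda>x. D x * h (\<sigma> x)) \<in> formfun a (k + m * e)"
      by (intro formfun_mult D(1) formfun_compose[OF h(1)] \<sigma>)
    moreover have "D (rep a p) * h (\<sigma> (rep a p)) \<noteq> 0" using iff[of p] p D(2) h(2) by simp
    moreover have "q \<in> {x \<in> X. f x \<in> U}" if "q \<in> X" "D (rep a q) * h (\<sigma> (rep a q)) \<noteq> 0" for q
      using iff[of q] that h(3) locally_by_forms_image[OF f, of q] by auto
    ultimately show "\<exists>e. \<exists>g\<in>formfun a e. g (rep a p) \<noteq> 0 \<and> (\<forall>l'\<in>X. g (rep a l') \<noteq> 0 \<longrightarrow> l' \<in> {x \<in> X. f x \<in> U})"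
      by (intro exI[of _ "k + m * e"] bexI[of _ "\<lambda>x. D x * h (\<sigma> x)"] conjI ballI impI)
  qed simp
qed

lemma locally_by_forms_morphism:
  assumes X: "X \<subseteq> proj_space a" and f: "locally_by_forms a X b f"
  shows "morphism_to_proj a X b f"
  unfolding morphism_to_proj_def
proof (intro conjI allI impI)
  show "continuous_map (subtopology (zariski a) X) (zariski b) f" by (rule locally_by_forms_continuous[OF X f])
  fix V h assume Vh: "openin (zariski b) V \<and> regular_on b V h"
  then have V: "V \<subseteq> proj_space b" using openin_subset by force
  have X': "{p \<in> X. f p \<in> V} \<subseteq> proj_space a" using X by auto
  show "regular_on a {p \<in> X. f p \<in> V} (h \<circ> f)"
    unfolding regular_on_iff[OF X']
  proof
    fix p assume p: "p \<in> {p \<in> X. f p \<in> V}"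
    then have pX: "p \<in> X" and pV: "f p \<in> V" by auto
    obtain k1 e1 D1 u w where D1: "D1 \<in> formfun b k1" "D1 (rep b (f p)) \<noteq> 0" and u: "u \<in> formfun b e1" and w: "w \<in> formfun b e1"
      and eq': "\<forall>l\<in>V. D1 (rep b l) \<noteq> 0 \<longrightarrow> w (rep b l) \<noteq> 0 \<and> h l = u (rep b l) / w (rep b l)"
      using bspec[OF conjunct2[OF Vh, unfolded regular_on_iff[OF V]] pV] by (elim exE bexE conjE)
    have eq: "\<And>l. l \<in> V \<Longrightarrow> D1 (rep b l) \<noteq> 0 \<Longrightarrow> w (rep b l) \<noteq> 0 \<and> h l = u (rep b l) / w (rep b l)"
      using eq' by blast
    obtain k e \<sigma> D where D: "D \<in> formfun a k" "D (rep a p) \<noteq> 0" and "\<forall>i<b. (\<lambda>x. \<sigma> x i) \<in> formfun a e"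
      and loc: "\<forall>q\<in>X. D (rep a q) \<noteq> 0 \<longrightarrow> nontrivial b (\<sigma> (rep a q)) \<and> f q = line b (\<sigma> (rep a q))"
      using bspec[OF f[unfolded locally_by_forms_def] pX] by (elim exE bexE conjE)
    then have \<sigma>: "\<And>i. i < b \<Longrightarrow> (\<lambda>x. \<sigma> x i) \<in> formfun a e" by blast
    have nt: "nontrivial b (\<sigma> (rep a q))" and fq: "f q = line b (\<sigma> (rep a q))"
      if "q \<in> X" "D (rep a q) \<noteq> 0" for q using bspec[OF loc that(1)] that(2) by auto
    have DD: "(\<lambda>x. D x * D1 (\<sigma> x)) \<in> formfun a (k + k1 * e)"
      by (intro formfun_mult D(1) formfun_compose[OF D1(1)] \<sigma>)
    have u': "(\<lambda>x. u (\<sigma> x)) \<in> formfun a (e1 * e)" and w': "(\<lambda>x. w (\<sigma> x)) \<in> formfun a (e1 * e)"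
      by (intro formfun_compose[OF u] formfun_compose[OF w] \<sigma>; assumption)+
    have nz: "D (rep a p) * D1 (\<sigma> (rep a p)) \<noteq> 0"
    proof -
      obtain c where "D1 (rep b (line b (\<sigma> (rep a p)))) = c ^ k1 * D1 (\<sigma> (rep a p))"
        using forms_on_line[OF nt[OF _ D(2)]] D1(1) p by (metis (lifting) mem_Collect_eq)
      then show ?thesis using D(2) D1(2) fq[OF _ D(2)] p by auto
    qed
    have val: "w (\<sigma> (rep a q)) \<noteq> 0 \<and> (h \<circ> f) q = u (\<sigma> (rep a q)) / w (\<sigma> (rep a q))"
      if q: "q \<in> {p \<in> X. f p \<in> V}" "D (rep a q) * D1 (\<sigma> (rep a q)) \<noteq> 0" for q
    proof -
      have qX: "q \<in> X" and Dq: "D (rep a q) \<noteq> 0" and D1q: "D1 (\<sigma> (rep a q)) \<noteq> 0" using q by auto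
      obtain c where c: "c \<noteq> 0" "\<And>k g. g \<in> formfun b k \<Longrightarrow> g (rep b (line b (\<sigma> (rep a q)))) = c ^ k * g (\<sigma> (rep a q))"
        using forms_on_line[OF nt[OF qX Dq]] by blast
      have "D1 (rep b (f q)) \<noteq> 0" using c(1) c(2)[OF D1(1)] D1q fq[OF qX Dq] by simp
      from eq[OF _ this] q(1) have "w (rep b (f q)) \<noteq> 0 \<and> h (f q) = u (rep b (f q)) / w (rep b (f q))" by simp
      then show ?thesis using c(1) c(2)[OF u] c(2)[OF w] fq[OF qX Dq] by simp
    qed
    show "\<exists>k e. \<exists>D\<in>formfun a k. \<exists>f'\<in>formfun a e. \<exists>g\<in>formfun a e. D (rep a p) \<noteq> 0 \<and>
        (\<forall>l\<in>{p \<in> X. f p \<in> V}. D (rep a l) \<noteq> 0 \<longrightarrow> g (rep a l) \<noteq> 0 \<and> (h \<circ> f) l = f' (rep a l) / g (rep a l))"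
    proof (rule exI[of _ "k + k1 * e"], rule exI[of _ "e1 * e"], rule bexI[OF _ DD],
        rule bexI[OF _ u'], rule bexI[OF _ w'], intro conjI ballI impI)
      show "D (rep a p) * D1 (\<sigma> (rep a p)) \<noteq> 0" by (rule nz)
      fix l assume l: "l \<in> {p \<in> X. f p \<in> V}" "D (rep a l) * D1 (\<sigma> (rep a l)) \<noteq> 0"
      show "w (\<sigma> (rep a l)) \<noteq> 0" "(h \<circ> f) l = u (\<sigma> (rep a l)) / w (\<sigma> (rep a l))"
        using val[OF l] by (rule conjunct1, rule conjunct2)
    qed
  qed
qed

text \<open>A regular function near \<open>p\<close> becomes, after substitution of the forms that describe the inverse
  map, a quotient of forms on an open set of the target, defined also off the image.\<close>

theorem closed_immersion_of_local_inverse: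
  assumes X: "X \<subseteq> proj_space a" and f: "locally_by_forms a X b f"
    and g: "locally_by_forms b (f ` X) a g" and gf: "\<And>p. p \<in> X \<Longrightarrow> g (f p) = p"
    and cl: "closedin (zariski b) (f ` X)"
  shows "closed_immersion a X b f"
  unfolding closed_immersion_def
proof (intro conjI allI impI)
  have top: "topspace (subtopology (zariski a) X) = X" using X by auto
  have fX: "f ` X \<subseteq> proj_space b" using locally_by_forms_image[OF f] by auto
  have topf: "topspace (subtopology (zariski b) (f ` X)) = f ` X" using fX by auto
  show "morphism_to_proj a X b f" by (rule locally_by_forms_morphism[OF X f])
  have cont_f: "continuous_map (subtopology (zariski a) X) (zariski b) f" by (rule locally_by_forms_continuous[OF X f])
  have cont_g: "continuous_map (subtopology (zariski b) (f ` X)) (zariski a) g" by (rule locally_by_forms_continuous[OF fX g])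
  have "homeomorphic_maps (subtopology (zariski a) X) (subtopology (zariski b) (f ` X)) f g"
    unfolding homeomorphic_maps_def top topf
    using cont_f cont_g gf by (auto simp: continuous_map_in_subtopology top topf)
  then show "embedding_map (subtopology (zariski a) X) (zariski b) f"
    unfolding embedding_map_def top homeomorphic_map_maps by blast
  show "closedin (zariski b) (f ` X)" by fact
  fix p U r
  assume A: "openin (subtopology (zariski a) X) U \<and> p \<in> U \<and> regular_on a U r"
  then have U: "openin (subtopology (zariski a) X) U" and pU: "p \<in> U" and r: "regular_on a U r" by auto
  have UX: "U \<subseteq> X" using openin_subset[OF U] top by simp
  then have Up: "U \<subseteq> proj_space a" and pX: "p \<in> X" using X pU by auto
  obtain k1 e1 D1 u w where D1: "D1 \<in> formfun a k1" "D1 (rep a p) \<noteq> 0" and u: "u \<in> formfun a e1" and w: "w \<in> formfun a e1"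
    and eq': "\<forall>l\<in>U. D1 (rep a l) \<noteq> 0 \<longrightarrow> w (rep a l) \<noteq> 0 \<and> r l = u (rep a l) / w (rep a l)"
    using bspec[OF r[unfolded regular_on_iff[OF Up]] pU] by (elim exE bexE conjE)
  have eq: "\<And>l. l \<in> U \<Longrightarrow> D1 (rep a l) \<noteq> 0 \<Longrightarrow> w (rep a l) \<noteq> 0 \<and> r l = u (rep a l) / w (rep a l)"
    using eq' by blast
  obtain k e \<sigma> D where D: "D \<in> formfun b k" "D (rep b (f p)) \<noteq> 0" and "\<forall>i<a. (\<lambda>x. \<sigma> x i) \<in> formfun b e"
    and loc: "\<forall>q\<in>f ` X. D (rep b q) \<noteq> 0 \<longrightarrow> nontrivial a (\<sigma> (rep b q)) \<and> g q = line a (\<sigma> (rep b q))"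
    using bspec[OF g[unfolded locally_by_forms_def] imageI[OF pX]] by (elim exE bexE conjE)
  then have \<sigma>: "\<And>i. i < a \<Longrightarrow> (\<lambda>x. \<sigma> x i) \<in> formfun b e" by blast
  have nt: "nontrivial a (\<sigma> (rep b q))" and gq: "g q = line a (\<sigma> (rep b q))"
    if "q \<in> f ` X" "D (rep b q) \<noteq> 0" for q using bspec[OF loc that(1)] that(2) by auto
  \<comment> \<open>Through the inverse map, forms at \<open>q\<close> are forms at the image of \<open>q\<close>, up to a scalar.\<close>
  have trans: "\<exists>c. c \<noteq> 0 \<and> (\<forall>k h. h \<in> formfun a k \<longrightarrow> h (rep a q) = c ^ k * h (\<sigma> (rep b (f q))))"
    if q: "q \<in> X" "D (rep b (f q)) \<noteq> 0" for q
  proof -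
    have "q = line a (\<sigma> (rep b (f q)))" using gq[of "f q"] q gf by auto
    moreover have "nontrivial a (\<sigma> (rep b (f q)))" using nt[of "f q"] q by auto
    ultimately show ?thesis using forms_on_line by metis
  qed
  define E where "E x = D x * w (\<sigma> x)" for x
  have E: "E \<in> formfun b (k + e1 * e)"
    unfolding E_def by (intro formfun_mult D(1) formfun_compose[OF w] \<sigma>)
  define V where "V = {l \<in> proj_space b. E (rep b l) \<noteq> 0}"
  define h where "h l = u (\<sigma> (rep b l)) / w (\<sigma> (rep b l))" for l
  define U' where "U' = U \<inter> {q \<in> X. D1 (rep a q) \<noteq> 0} \<inter> {q \<in> X. f q \<in> V}"
  have V: "openin (zariski b) V" unfolding V_def by (rule openin_nonvanishing[OF E])
  have Vp: "V \<subseteq> proj_space b" by (auto simp: V_def)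
  have "regular_on b V h"
    unfolding regular_on_iff[OF Vp]
  proof
    fix l assume "l \<in> V"
    show "\<exists>k e. \<exists>D\<in>formfun b k. \<exists>f\<in>formfun b e. \<exists>g\<in>formfun b e. D (rep b l) \<noteq> 0 \<and>
        (\<forall>l\<in>V. D (rep b l) \<noteq> 0 \<longrightarrow> g (rep b l) \<noteq> 0 \<and> h l = f (rep b l) / g (rep b l))"
    proof (rule exI[of _ "k + e1 * e"], rule exI[of _ "e1 * e"], rule bexI[of _ E],
        rule bexI[of _ "\<lambda>x. u (\<sigma> x)"], rule bexI[of _ "\<lambda>x. w (\<sigma> x)"], intro conjI ballI impI)
      show "E (rep b l) \<noteq> 0" using \<open>l \<in> V\<close> by (simp add: V_def)
      show "(\<lambda>x. u (\<sigma> x)) \<in> formfun b (e1 * e)" "(\<lambda>x. w (\<sigma> x)) \<in> formfun b (e1 * e)"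
        by (intro formfun_compose[OF u] formfun_compose[OF w] \<sigma>; assumption)+
      show "E \<in> formfun b (k + e1 * e)" by (rule E)
    qed (auto simp: V_def E_def h_def)
  qed
  moreover have "f p \<in> V"
  proof -
    obtain c where "c \<noteq> 0" "w (rep a p) = c ^ e1 * w (\<sigma> (rep b (f p)))" using trans[OF pX D(2)] w by blast
    then have "w (\<sigma> (rep b (f p))) \<noteq> 0" using eq[OF pU D1(2)] by auto
    then show ?thesis using D(2) locally_by_forms_image[OF f pX] by (simp add: V_def E_def)
  qed
  moreover have "openin (subtopology (zariski a) X) U'"
  proof -
    have "openin (subtopology (zariski a) X) {q \<in> X. D1 (rep a q) \<noteq> 0}"
      unfolding openin_zariski_subtopology_iff[OF X] using D1(1) by blast
    moreover have "openin (subtopology (zariski a) X) {q \<in> X. f q \<in> V}"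
      using openin_continuous_map_preimage[OF cont_f V] unfolding top .
    ultimately show ?thesis unfolding U'_def using U by (intro openin_Int)
  qed
  moreover have "p \<in> U'" using pU pX D1(2) \<open>f p \<in> V\<close> by (simp add: U'_def)
  moreover have "U' \<subseteq> U" by (auto simp: U'_def)
  moreover have "f q \<in> V \<and> r q = h (f q)" if "q \<in> U'" for q
  proof -
    have q: "q \<in> U" "q \<in> X" "D1 (rep a q) \<noteq> 0" "f q \<in> V" using that by (auto simp: U'_def)
    have "D (rep b (f q)) \<noteq> 0" using q(4) by (auto simp: V_def E_def)
    from trans[OF q(2) this] obtain c where c: "c \<noteq> 0" "u (rep a q) = c ^ e1 * u (\<sigma> (rep b (f q)))"
      "w (rep a q) = c ^ e1 * w (\<sigma> (rep b (f q)))" using u w by blast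
    then show ?thesis using q(4) eq[OF q(1,3)] by (simp add: h_def)
  qed
  ultimately show "\<exists>V h U'. openin (zariski b) V \<and> f p \<in> V \<and> regular_on b V h \<and>
      openin (subtopology (zariski a) X) U' \<and> p \<in> U' \<and> U' \<subseteq> U \<and> (\<forall>q\<in>U'. f q \<in> V \<and> r q = h (f q))"
    using V by blast
qed

text \<open>Where a matrix of linear forms has a one-dimensional kernel, Cramer's rule gives the kernel
  by forms: complete independent combinations of the rows by a unit row to an invertible square
  matrix and take the corresponding column of the adjugate.\<close>

lemma kernel_map_locally_by_forms:
  assumes lin: "\<And>j i. (\<lambda>x. T x j i) \<in> formfun a 1" and q: "0 < q"
    and X: "X \<subseteq> proj_space a"
    and null: "\<And>l. l \<in> X \<Longrightarrow> \<not> nullity_ge p q 2 (T (rep a l))"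
    and f: "\<And>l. l \<in> X \<Longrightarrow> f l \<in> proj_space q"
    and ker: "\<And>l j. l \<in> X \<Longrightarrow> j < p \<Longrightarrow> (\<Sum>i<q. T (rep a l) j i * rep q (f l) i) = 0"
  shows "locally_by_forms a X q f"
  unfolding locally_by_forms_def
proof
  fix l0 assume l0: "l0 \<in> X"
  define T0 where "T0 = T (rep a l0)"
  obtain r where r: "q = Suc r" using q by (cases q) auto
  obtain C0 where C0: "C0 \<subseteq> {..<q}" "q < card C0 + 2"
    and none0: "\<nexists>y. (\<exists>i\<in>C0. y i \<noteq> 0) \<and> (\<forall>i. i \<notin> C0 \<longrightarrow> y i = 0) \<and> (\<forall>j<p. (\<Sum>i<q. T0 j i * y i) = 0)"
    using null[OF l0] unfolding nullity_ge_def T0_def by blast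
  have "r \<le> card C0" using C0 r by simp
  then obtain C where C: "C \<subseteq> C0" "card C = r" by (rule obtain_subset_with_card_n)
  have Cq: "C \<subseteq> {..<q}" using C C0 by blast
  have finC: "finite C" using Cq finite_subset by blast
  have none: "y i = 0" if y: "\<And>i. i \<notin> C \<Longrightarrow> y i = 0" "\<And>j. j < p \<Longrightarrow> (\<Sum>i<q. T0 j i * y i) = 0" for y i
  proof (rule ccontr)
    assume nz: "y i \<noteq> 0"
    then have "i \<in> C0" using y(1)[of i] C(1) by blast
    moreover have "\<forall>i. i \<notin> C0 \<longrightarrow> y i = 0" using y(1) C(1) by blast
    ultimately show False using none0 nz y(2) by blast
  qed
  have "card ({..<q} - C) = 1" using card_Diff_subset[OF finC Cq] C(2) r by simp
  then obtain i0 where i0: "{..<q} - C = {i0}" by (rule card_1_singletonE)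
  have i0q: "i0 < q" "i0 \<notin> C" using i0 by auto
  have outC: "i = i0" if "i < q" "i \<notin> C" for i using i0 that by blast
  obtain en where en: "bij_betw en {..<r} C"
    using ex_bij_betw_nat_finite[OF finC] C(2) by (auto simp: atLeast0LessThan)
  have "\<exists>P. \<forall>c\<in>C. \<forall>c'\<in>C. (\<Sum>j\<in>{..<p}. P c j * T0 j c') = (if c = c' then 1 else 0)"
  proof (rule left_inverse_of_injective)
    fix z assume z: "\<And>j. j \<in> {..<p} \<Longrightarrow> (\<Sum>c\<in>C. T0 j c * z c) = 0"
    define y where "y i = (if i \<in> C then z i else 0)" for i
    have "(\<Sum>i<q. T0 j i * y i) = 0" if "j < p" for j
    proof -
      have "(\<Sum>i<q. T0 j i * y i) = (\<Sum>i\<in>C. T0 j i * z i)"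
        by (rule sum.mono_neutral_cong_right) (use Cq in \<open>auto simp: y_def\<close>)
      then show ?thesis using z that by simp
    qed
    then have "y i = 0" for i by (rule none[of y, rotated]) (auto simp: y_def)
    then show "\<forall>c\<in>C. z c = 0" by (metis y_def)
  qed (auto simp: finC)
  then obtain P where P: "\<And>c c'. c \<in> C \<Longrightarrow> c' \<in> C \<Longrightarrow> (\<Sum>j<p. P c j * T0 j c') = (if c = c' then 1 else 0)"
    by blast
  define L where "L x s i = (\<Sum>j<p. P (en s) j * T x j i)" for x s i
  have L: "(\<lambda>x. L x s i) \<in> formfun a 1" for s i
    unfolding L_def by (intro formfun_sum formfun_scale lin)
  define Q where "Q x = mat q q (\<lambda>(s, i). if s = r then (if i = i0 then 1 else 0) else L x s i)" for x
  have Q: "Q x \<in> carrier_mat q q" for x by (simp add: Q_def)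
  define \<sigma> where "\<sigma> x i = cofactor (Q x) r i" for x i
  have \<sigma>: "(\<lambda>x. \<sigma> x i) \<in> formfun a r" if "i < q" for i
  proof -
    have "mat_delete (Q x) r i = mat r r (\<lambda>(s, i'). L x s (insert_index i i'))" for x
    proof (rule eq_matI)
      fix s i' assume "s < dim_row (mat r r (\<lambda>(s, i'). L x s (insert_index i i')))"
        "i' < dim_col (mat r r (\<lambda>(s, i'). L x s (insert_index i i')))"
      then have si: "s < r" "i' < r" by auto
      have "insert_index r s = s" using si by (simp add: insert_index_def)
      moreover have "insert_index i i' < q" using si r by (simp add: insert_index_def)
      ultimately show "mat_delete (Q x) r i $$ (s, i') = mat r r (\<lambda>(s, i'). L x s (insert_index i i')) $$ (s, i')"
        using si r that mat_delete_index[of "Q x" r r i s i'] Q[of x] by (simp add: Q_def)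
    qed (auto simp: Q_def r mat_delete_def)
    then have eq: "\<sigma> x i = (- 1) ^ (r + i) * Determinant.det (mat r r (\<lambda>(s, i'). L x s (insert_index i i')))" for x
      by (simp add: \<sigma>_def cofactor_def)
    have "(\<lambda>x. Determinant.det (mat r r (\<lambda>(s, i'). L x s (insert_index i i')))) \<in> formfun a r"
      unfolding formfun_iff_biform[where I = "{} :: unit set"]
      by (rule biform_det) (use L in \<open>simp add: formfun_iff_biform[where I = "{} :: unit set"]\<close>)
    then show ?thesis unfolding eq by (rule formfun_scale)
  qed
  have rowQ: "(\<Sum>i<q. Q x $$ (s, i) * y i) = (if s = r then y i0 else (\<Sum>i<q. L x s i * y i))" if "s < q" for x s y
  proof (cases "s = r")
    case True
    have "(\<Sum>i<q. Q x $$ (s, i) * y i) = (\<Sum>i<q. if i = i0 then y i else 0)"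
      by (intro sum.cong) (use True r in \<open>auto simp: Q_def\<close>)
    then show ?thesis using True i0q by simp
  next
    case False
    then show ?thesis using that by (simp add: Q_def)
  qed
  have adj: "(\<Sum>i<q. Q x $$ (s, i) * \<sigma> x i) = (if s = r then Determinant.det (Q x) else 0)" if "s < q" for x s
  proof -
    have "(Q x * adj_mat (Q x)) $$ (s, r) = (\<Sum>i<q. Q x $$ (s, i) * \<sigma> x i)"
      using that r Q[of x] by (simp add: adj_mat_def scalar_prod_def \<sigma>_def atLeast0LessThan)
    moreover have "(Q x * adj_mat (Q x)) $$ (s, r) = (Determinant.det (Q x) \<cdot>\<^sub>m 1\<^sub>m q) $$ (s, r)"
      by (simp only: adj_mat(2)[OF Q, of x])
    moreover have "(Determinant.det (Q x) \<cdot>\<^sub>m 1\<^sub>m q) $$ (s, r) = (if s = r then Determinant.det (Q x) else 0)"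
      using that r by simp
    ultimately show ?thesis by (simp only:)
  qed
  have \<sigma>0: "\<sigma> x i0 = Determinant.det (Q x)" for x
    using adj[of r x] rowQ[of r x "\<sigma> x"] r by simp
  have trivial: "v i = 0" if det: "Determinant.det (Q x) \<noteq> 0" and v: "\<And>s. s < q \<Longrightarrow> (\<Sum>i<q. Q x $$ (s, i) * v i) = 0" and i: "i < q" for x v i
  proof -
    have "Q x *\<^sub>v vec q v = 0\<^sub>v q"
      by (rule eq_vecI) (use v Q[of x] in \<open>auto simp: scalar_prod_def atLeast0LessThan\<close>)
    then have "vec q v = 0\<^sub>v q" using det det_0_iff_vec_prod_zero[OF Q] by (metis vec_carrier)
    then have "vec q v $ i = 0\<^sub>v q $ i" by simp
    then show ?thesis using i by simp
  qed
  have "\<sigma> (rep a l0) i0 \<noteq> 0"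
  proof
    assume "\<sigma> (rep a l0) i0 = 0"
    then have "Determinant.det (Q (rep a l0)) = 0" by (simp add: \<sigma>0)
    then obtain v where v: "v \<in> carrier_vec q" "v \<noteq> 0\<^sub>v q" "Q (rep a l0) *\<^sub>v v = 0\<^sub>v q"
      using det_0_iff_vec_prod_zero[OF Q] by blast
    have row: "(\<Sum>i<q. Q (rep a l0) $$ (s, i) * v $ i) = 0" if "s < q" for s
      using arg_cong[OF v(3), of "\<lambda>w. w $ s"] that v(1) Q[of "rep a l0"] by (simp add: scalar_prod_def atLeast0LessThan)
    have v0: "v $ i0 = 0" using row[of r] rowQ[of r "rep a l0" "\<lambda>i. v $ i"] r by simp
    have "v $ c = 0" if c: "c \<in> C" for c
    proof -
      obtain s where s: "s < r" "en s = c" using en c by (auto simp: bij_betw_def)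
      have "0 = (\<Sum>i<q. L (rep a l0) s i * v $ i)" using row[of s] rowQ[of s "rep a l0" "\<lambda>i. v $ i"] s r by simp
      also have "\<dots> = (\<Sum>i\<in>C. L (rep a l0) s i * v $ i)"
        by (rule sum.mono_neutral_right) (use Cq outC v0 in auto)
      also have "\<dots> = (\<Sum>i\<in>C. if i = c then v $ c else 0)"
        by (intro sum.cong) (use P c s in \<open>auto simp: L_def T0_def[symmetric]\<close>)
      also have "\<dots> = v $ c" using finC c by simp
      finally show ?thesis by simp
    qed
    then have "v = 0\<^sub>v q" using v(1) v0 outC by (intro eq_vecI) auto
    then show False using v(2) by simp
  qed
  moreover have "nontrivial q (\<sigma> (rep a l)) \<and> f l = line q (\<sigma> (rep a l))" if l: "l \<in> X" "\<sigma> (rep a l) i0 \<noteq> 0" for l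
  proof
    show "nontrivial q (\<sigma> (rep a l))" using l(2) i0q by (auto simp: nontrivial_def)
    define x where "x = rep a l"
    define y where "y = rep q (f l)"
    have det: "Determinant.det (Q x) \<noteq> 0" using l(2) by (simp add: \<sigma>0 x_def)
    have Ly: "(\<Sum>i<q. L x s i * y i) = 0" for s
    proof -
      have "(\<Sum>i<q. L x s i * y i) = (\<Sum>i<q. \<Sum>j<p. P (en s) j * (T x j i * y i))"
        by (simp add: L_def sum_distrib_right mult.assoc)
      also have "\<dots> = (\<Sum>j<p. P (en s) j * (\<Sum>i<q. T x j i * y i))"
        unfolding sum_distrib_left by (rule sum.swap)
      also have "\<dots> = 0" using ker[OF l(1)] by (simp add: x_def y_def)
      finally show ?thesis .
    qed
    have proportional: "\<sigma> x i0 * y i - y i0 * \<sigma> x i = 0" if "i < q" for i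
    proof (rule trivial[OF det _ that, of "\<lambda>i. \<sigma> x i0 * y i - y i0 * \<sigma> x i"])
      fix s assume s: "s < q"
      have "(\<Sum>i<q. Q x $$ (s, i) * (\<sigma> x i0 * y i - y i0 * \<sigma> x i))
          = \<sigma> x i0 * (\<Sum>i<q. Q x $$ (s, i) * y i) - y i0 * (\<Sum>i<q. Q x $$ (s, i) * \<sigma> x i)"
        by (simp add: sum_distrib_left sum_subtractf algebra_simps)
      also have "\<dots> = 0"
        using rowQ[OF s, of x y] adj[OF s, of x] Ly by (cases "s = r") (simp_all add: \<sigma>0)
      finally show "(\<Sum>i<q. Q x $$ (s, i) * (\<sigma> x i0 * y i - y i0 * \<sigma> x i)) = 0" .
    qed
    have y_nt: "nontrivial q y" unfolding y_def by (rule rep(1)[OF f[OF l(1)]])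
    have "y i0 \<noteq> 0"
    proof
      assume "y i0 = 0"
      then have "y i = 0" if "i < q" for i using proportional[OF that] l(2) by (simp add: x_def)
      then show False using y_nt by (auto simp: nontrivial_def)
    qed
    moreover have "\<sigma> x i = (\<sigma> x i0 / y i0) * y i" if "i < q" for i
      using proportional[OF that] \<open>y i0 \<noteq> 0\<close> by (simp add: field_simps)
    moreover have "\<sigma> x i0 / y i0 \<noteq> 0" using l(2) \<open>y i0 \<noteq> 0\<close> by (simp add: x_def)
    ultimately have "line q (\<sigma> x) = line q y" by (intro line_scale[of "\<sigma> x i0 / y i0"])
    then show "f l = line q (\<sigma> (rep a l))" using rep(3)[OF f[OF l(1)]] by (simp add: x_def y_def)
  qed
  ultimately show "\<exists>k e \<sigma>. \<exists>D\<in>formfun a k. D (rep a l0) \<noteq> 0 \<and> (\<forall>i<q. (\<lambda>x. \<sigma> x i) \<in> formfun a e) \<and>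
     (\<forall>l\<in>X. D (rep a l) \<noteq> 0 \<longrightarrow> nontrivial q (\<sigma> (rep a l)) \<and> f l = line q (\<sigma> (rep a l)))"
    using \<sigma> i0q by (intro exI[of _ r] exI[of _ \<sigma>] bexI[of _ "\<lambda>x. \<sigma> x i0"]) auto
qed

section \<open>The degeneracy locus and the kernel correspondence\<close>

lemma nullity_ge_1: "nullity_ge p q 1 T \<longleftrightarrow> (\<exists>y. nontrivial q y \<and> (\<forall>j<p. (\<Sum>i<q. T j i * y i) = 0))"
proof
  assume "nullity_ge p q 1 T"
  then obtain y where "\<exists>i\<in>{..<q}. y i \<noteq> 0" "\<forall>j<p. (\<Sum>i<q. T j i * y i) = 0"
    unfolding nullity_ge_def by (metis card_lessThan less_add_one subset_refl)
  then show "\<exists>y. nontrivial q y \<and> (\<forall>j<p. (\<Sum>i<q. T j i * y i) = 0)" by (auto simp: nontrivial_def)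
next
  assume "\<exists>y. nontrivial q y \<and> (\<forall>j<p. (\<Sum>i<q. T j i * y i) = 0)"
  then obtain y where y: "nontrivial q y" "\<forall>j<p. (\<Sum>i<q. T j i * y i) = 0" by blast
  show "nullity_ge p q 1 T"
    unfolding nullity_ge_def
  proof (intro allI impI, elim conjE)
    fix C assume C: "C \<subseteq> {..<q}" "q < card C + 1"
    then have "C = {..<q}" using card_subset_eq[of "{..<q}" C] card_mono[of "{..<q}" C] by auto
    then show "\<exists>y. (\<exists>i\<in>C. y i \<noteq> 0) \<and> (\<forall>i. i \<notin> C \<longrightarrow> y i = 0) \<and> (\<forall>j<p. (\<Sum>i<q. T j i * y i) = 0)"
      using y by (intro exI[of _ "\<lambda>i. if i < q then y i else 0"]) (auto simp: nontrivial_def)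
  qed
qed

text \<open>Some coordinate subspace \<open>C\<close> that misses the kernel leaves at most one coordinate free. The
  combination of the two kernel vectors that cancels this coordinate is supported on \<open>C\<close>.\<close>

lemma kernel_line_unique:
  assumes not: "\<not> nullity_ge p q 2 T"
    and y: "nontrivial q y" "\<And>j. j < p \<Longrightarrow> (\<Sum>i<q. T j i * y i) = 0"
    and z: "nontrivial q z" "\<And>j. j < p \<Longrightarrow> (\<Sum>i<q. T j i * z i) = 0"
  shows "line q y = line q z"
proof -
  obtain C where C: "C \<subseteq> {..<q}" "q < card C + 2"
    and none: "\<nexists>y. (\<exists>i\<in>C. y i \<noteq> 0) \<and> (\<forall>i. i \<notin> C \<longrightarrow> y i = 0) \<and> (\<forall>j<p. (\<Sum>i<q. T j i * y i) = 0)"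
    using not unfolding nullity_ge_def by blast
  have vanish: "x i = 0" if x: "\<And>j. j < p \<Longrightarrow> (\<Sum>i<q. T j i * x i) = 0" "\<And>i. i < q \<Longrightarrow> i \<notin> C \<Longrightarrow> x i = 0" and i: "i < q" for x i
  proof (rule ccontr)
    assume nz: "x i \<noteq> 0"
    define x' where "x' i = (if i < q then x i else 0)" for i
    have "(\<Sum>i<q. T j i * x' i) = (\<Sum>i<q. T j i * x i)" for j by (intro sum.cong) (auto simp: x'_def)
    then have "\<forall>j<p. (\<Sum>i<q. T j i * x' i) = 0" using x(1) by simp
    moreover have "\<forall>i. i \<notin> C \<longrightarrow> x' i = 0" using x(2) by (auto simp: x'_def)
    moreover have "\<exists>i\<in>C. x' i \<noteq> 0" using nz x(2)[OF i] i by (auto simp: x'_def)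
    ultimately show False using none by blast
  qed
  have finC: "finite C" using C(1) finite_subset by blast
  have "card ({..<q} - C) \<le> 1" using C card_Diff_subset[OF finC C(1)] by simp
  then obtain i0 where i0: "{..<q} - C \<subseteq> {i0}"
    by (metis card_1_singletonE card_eq_0_iff empty_subsetI finite_Diff finite_lessThan le_antisym less_one not_less subset_refl)
  have outC: "i = i0" if "i < q" "i \<notin> C" for i using i0 that by blast
  have y0: "y i0 \<noteq> 0"
  proof
    assume "y i0 = 0"
    then have "y i = 0" if "i < q" for i using vanish[OF y(2) _ that] outC by blast
    then show False using y(1) by (auto simp: nontrivial_def)
  qed
  have z0: "z i0 \<noteq> 0"
  proof
    assume "z i0 = 0"
    then have "z i = 0" if "i < q" for i using vanish[OF z(2) _ that] outC by blast
    then show False using z(1) by (auto simp: nontrivial_def)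
  qed
  have "z i0 * y i - y i0 * z i = 0" if "i < q" for i
  proof (rule vanish[of "\<lambda>i. z i0 * y i - y i0 * z i", OF _ _ that])
    fix j assume "j < p"
    have "(\<Sum>i<q. T j i * (z i0 * y i - y i0 * z i)) = z i0 * (\<Sum>i<q. T j i * y i) - y i0 * (\<Sum>i<q. T j i * z i)"
      by (simp add: sum_distrib_left sum_subtractf algebra_simps)
    then show "(\<Sum>i<q. T j i * (z i0 * y i - y i0 * z i)) = 0" using y(2) z(2) \<open>j < p\<close> by simp
  next
    fix i assume "i < q" "i \<notin> C"
    then show "z i0 * y i - y i0 * z i = 0" using outC by (metis cancel_comm_monoid_add_class.diff_cancel mult.commute)
  qed
  then have "y i = (y i0 / z i0) * z i" if "i < q" for i using that z0 by (simp add: field_simps)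
  moreover have "y i0 / z i0 \<noteq> 0" using y0 z0 by simp
  ultimately show ?thesis by (rule line_scale[rotated])
qed

text \<open>The second vector comes from the coordinate hyperplane on which the first one does not lie.\<close>

lemma nullity_ge_2_two_lines:
  assumes null: "nullity_ge p q 2 T"
  shows "\<exists>y z. nontrivial q y \<and> nontrivial q z \<and> line q y \<noteq> line q z \<and>
    (\<forall>j<p. (\<Sum>i<q. T j i * y i) = 0) \<and> (\<forall>j<p. (\<Sum>i<q. T j i * z i) = 0)"
proof -
  obtain y where y: "nontrivial q y" "\<forall>j<p. (\<Sum>i<q. T j i * y i) = 0"
    using nullity_ge_mono[OF null, of 1] unfolding nullity_ge_1 by auto
  obtain i0 where i0: "i0 < q" "y i0 \<noteq> 0" using y(1) by (auto simp: nontrivial_def)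
  have "{..<q} - {i0} \<subseteq> {..<q}" "q < card ({..<q} - {i0}) + 2" using i0 by auto
  then obtain z where z: "\<exists>i\<in>{..<q} - {i0}. z i \<noteq> 0" "\<forall>i. i \<notin> {..<q} - {i0} \<longrightarrow> z i = 0"
    "\<forall>j<p. (\<Sum>i<q. T j i * z i) = 0"
    using null unfolding nullity_ge_def by blast
  have zn: "nontrivial q z" using z(1) by (auto simp: nontrivial_def)
  have "line q y \<noteq> line q z"
  proof
    assume "line q y = line q z"
    then obtain c where "\<forall>i<q. y i = c * z i" using line_eqD[OF _ y(1)] by blast
    then show False using i0 z(2) by auto
  qed
  then show ?thesis using y z(3) zn by blast
qed

lemma open_bounded_nullity:
  assumes lin: "\<And>j i. (\<lambda>x. T x j i) \<in> formfun a 1" and k: "1 \<le> k" "k \<le> q"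
  shows "openin (zariski a) {l \<in> proj_space a. \<not> nullity_ge p q k (T (rep a l))}"
  unfolding openin_zariski_iff
proof (intro conjI ballI)
  fix l assume "l \<in> {l \<in> proj_space a. \<not> nullity_ge p q k (T (rep a l))}"
  then have l: "l \<in> proj_space a" and "\<not> nullity_ge p q k (T (rep a l))" by auto
  define r where "r = q + 1 - k"
  obtain en P where enP: "inj_on en {..<r}" "en ` {..<r} \<subseteq> {..<q}"
    "Determinant.det (mat r r (\<lambda>(i, i'). \<Sum>j<p. P i j * T (rep a l) j (en i'))) \<noteq> 0"
    using \<open>\<not> nullity_ge p q k (T (rep a l))\<close> unfolding nullity_ge_iff_minors[OF k] r_def[symmetric] by blast
  define f where "f x = Determinant.det (mat r r (\<lambda>(i, i'). \<Sum>j<p. P i j * T x j (en i')))" for x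
  have "(\<lambda>x. \<Sum>j<p. P i j * T x j (en i')) \<in> formfun a 1" for i i'
    by (intro formfun_sum formfun_scale lin)
  then have "f \<in> formfun a r"
    unfolding f_def formfun_iff_biform[where I = "{} :: unit set"] by (intro biform_det) simp
  moreover have "\<not> nullity_ge p q k (T x)" if "f x \<noteq> 0" for x
    using that enP(1,2) unfolding nullity_ge_iff_minors[OF k] r_def[symmetric] f_def by blast
  moreover have "f (rep a l) \<noteq> 0" using enP(3) by (simp add: f_def)
  ultimately show "\<exists>e. \<exists>f\<in>formfun a e. f (rep a l) \<noteq> 0 \<and>
      (\<forall>l'\<in>proj_space a. f (rep a l') \<noteq> 0 \<longrightarrow> l' \<in> {l \<in> proj_space a. \<not> nullity_ge p q k (T (rep a l))})"
    by blast
qed auto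

lemma nullity_ge_scale:
  assumes "nullity_ge p q k T" "\<And>j i. j < p \<Longrightarrow> i < q \<Longrightarrow> T' j i = c * T j i"
  shows "nullity_ge p q k T'"
  unfolding nullity_ge_def
proof (intro allI impI)
  fix C assume "C \<subseteq> {..<q} \<and> q < card C + k"
  then obtain y where y: "\<exists>i\<in>C. y i \<noteq> 0" "\<forall>i. i \<notin> C \<longrightarrow> y i = 0" "\<forall>j<p. (\<Sum>i<q. T j i * y i) = 0"
    using assms(1) unfolding nullity_ge_def by blast
  have "(\<Sum>i<q. T' j i * y i) = c * (\<Sum>i<q. T j i * y i)" if "j < p" for j
    unfolding sum_distrib_left by (intro sum.cong) (use that assms(2) in auto)
  then show "\<exists>y. (\<exists>i\<in>C. y i \<noteq> 0) \<and> (\<forall>i. i \<notin> C \<longrightarrow> y i = 0) \<and> (\<forall>j<p. (\<Sum>i<q. T' j i * y i) = 0)"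
    using y by (intro exI[of _ y]) auto
qed

lemma contract_linear: "(\<lambda>x. contract a \<phi> x j i) \<in> formfun a 1"
  unfolding contract_def by (intro formfun_sum formfun_scale formfun_var) simp

definition swap_tensor :: "(nat \<times> nat \<times> nat \<Rightarrow> complex) \<Rightarrow> nat \<times> nat \<times> nat \<Rightarrow> complex" where
  "swap_tensor \<phi> = (\<lambda>(k, j, i). \<phi> (i, j, k))"

text \<open>The incidence variety: the lines of \<open>\<alpha>\<close> and \<open>v\<close> with \<open>M\<^sub>v\<^sup>t \<alpha> = 0\<close>, written as \<open>A\<^sub>\<alpha> v = 0\<close>.\<close>

definition incident :: "nat \<Rightarrow> nat \<Rightarrow> nat \<Rightarrow> bundle_map \<Rightarrow> complex vec set \<Rightarrow> complex vec set \<Rightarrow> bool" where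
  "incident n m s \<phi> l p \<longleftrightarrow> l \<in> proj_space n \<and> p \<in> proj_space (s+1) \<and>
     (\<forall>j<n+m. (\<Sum>k<s+1. contract n \<phi> (rep n l) j k * rep (s+1) p k) = 0)"

lemma contract_swap:
  "(\<Sum>i<n. contract d (swap_tensor \<phi>) x j i * \<alpha> i) = (\<Sum>k<d. contract n \<phi> \<alpha> j k * x k)"
proof -
  have "(\<Sum>i<n. contract d (swap_tensor \<phi>) x j i * \<alpha> i) = (\<Sum>i<n. \<Sum>k<d. \<phi> (i, j, k) * x k * \<alpha> i)"
    by (simp add: contract_def swap_tensor_def sum_distrib_right)
  also have "\<dots> = (\<Sum>k<d. \<Sum>i<n. \<phi> (i, j, k) * x k * \<alpha> i)" by (rule sum.swap)
  also have "\<dots> = (\<Sum>k<d. contract n \<phi> \<alpha> j k * x k)"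
    unfolding contract_def sum_distrib_right by (simp add: mult_ac)
  finally show ?thesis .
qed

lemma incident_swap:
  "incident n m s \<phi> l p \<longleftrightarrow> l \<in> proj_space n \<and> p \<in> proj_space (s+1) \<and>
     (\<forall>j<n+m. (\<Sum>i<n. contract (s+1) (swap_tensor \<phi>) (rep (s+1) p) j i * rep n l i) = 0)"
  unfolding incident_def contract_swap ..

lemma vec_rep_mem:
  assumes "l \<in> proj_space d" shows "vec d (rep d l) \<in> l"
proof -
  have "vec d (\<lambda>i. 1 * rep d l i) \<in> l - {0\<^sub>v d}"
    unfolding nonzero_in_line[OF assms] by (intro exI[of _ 1]) simp
  then show ?thesis by simp
qed

lemma Mv_carrier: "Mv n m s \<phi> v \<in> carrier_mat n (n+m)"
  by (simp add: Mv_def)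

lemma entries_Mv:
  assumes "i < n" "j < n + m"
  shows "entries (Mv n m s \<phi> (vec (s+1) x)) i j = contract (s+1) (swap_tensor \<phi>) x j i"
  using assms by (auto simp: entries_def Mv_def contract_def swap_tensor_def intro!: sum.cong)

lemma contract_scale: "contract a \<phi> (\<lambda>i. c * x i) j k = c * contract a \<phi> x j k"
  by (simp add: contract_def sum_distrib_left mult_ac)

lemma contract_cong: "(\<And>i. i < a \<Longrightarrow> x i = y i) \<Longrightarrow> contract a \<phi> x j k = contract a \<phi> y j k"
  unfolding contract_def by (intro sum.cong) auto

lemma incident_line_left:
  assumes "nontrivial n \<alpha>" "p \<in> proj_space (s+1)"
  shows "incident n m s \<phi> (line n \<alpha>) p \<longleftrightarrow> (\<forall>j<n+m. (\<Sum>k<s+1. contract n \<phi> \<alpha> j k * rep (s+1) p k) = 0)"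
proof -
  obtain c where c: "c \<noteq> 0" "\<And>i. i < n \<Longrightarrow> rep n (line n \<alpha>) i = c * \<alpha> i" using rep_line[OF assms(1)] by blast
  have "contract n \<phi> (rep n (line n \<alpha>)) j k = c * contract n \<phi> \<alpha> j k" for j k
    using contract_cong[of n "rep n (line n \<alpha>)" "\<lambda>i. c * \<alpha> i" \<phi> j k] c(2) contract_scale by simp
  then have "(\<Sum>k<s+1. contract n \<phi> (rep n (line n \<alpha>)) j k * rep (s+1) p k)
      = c * (\<Sum>k<s+1. contract n \<phi> \<alpha> j k * rep (s+1) p k)" for j
    by (simp only: sum_distrib_left mult.assoc)
  then show ?thesis using c(1) line_in_proj_space[OF assms(1)] assms(2) by (auto simp: incident_def)
qed

lemma incident_line_right:
  assumes "nontrivial (s+1) x" "l \<in> proj_space n"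
  shows "incident n m s \<phi> l (line (s+1) x) \<longleftrightarrow> (\<forall>j<n+m. (\<Sum>k<s+1. contract n \<phi> (rep n l) j k * x k) = 0)"
proof -
  obtain c where c: "c \<noteq> 0" "\<And>i. i < s+1 \<Longrightarrow> rep (s+1) (line (s+1) x) i = c * x i" using rep_line[OF assms(1)] by blast
  have "(\<Sum>k<s+1. contract n \<phi> (rep n l) j k * rep (s+1) (line (s+1) x) k)
      = c * (\<Sum>k<s+1. contract n \<phi> (rep n l) j k * x k)" for j
    unfolding sum_distrib_left by (intro sum.cong) (use c(2) in auto)
  then show ?thesis using c(1) line_in_proj_space[OF assms(1)] assms(2) by (auto simp: incident_def)
qed

lemma degeneracy_locus_iff:
  assumes n: "0 < n"
  shows "p \<in> degeneracy_locus n m s \<phi> \<longleftrightarrow> (\<exists>l. incident n m s \<phi> l p)"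
proof (cases "p \<in> proj_space (s+1)")
  case True
  let ?x = "rep (s+1) p"
  have rank_iff: "vec_space.rank n (Mv n m s \<phi> (vec (s+1) x)) \<le> n - 1 \<longleftrightarrow>
      (\<exists>\<alpha>. nontrivial n \<alpha> \<and> (\<forall>j<n+m. (\<Sum>i<n. contract (s+1) (swap_tensor \<phi>) x j i * \<alpha> i) = 0))" for x
  proof -
    have "vec_space.rank n (Mv n m s \<phi> (vec (s+1) x)) \<le> n - 1 \<longleftrightarrow> vec_space.rank n (Mv n m s \<phi> (vec (s+1) x)) < n"
      using n by auto
    also have "\<dots> \<longleftrightarrow> (\<exists>\<alpha>. nontrivial n \<alpha> \<and> (\<forall>j<n+m. (\<Sum>i<n. entries (Mv n m s \<phi> (vec (s+1) x)) i j * \<alpha> i) = 0))"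
      by (rule rank_less_iff_left_kernel[OF Mv_carrier])
    also have "\<dots> \<longleftrightarrow> (\<exists>\<alpha>. nontrivial n \<alpha> \<and> (\<forall>j<n+m. (\<Sum>i<n. contract (s+1) (swap_tensor \<phi>) x j i * \<alpha> i) = 0))"
      by (simp add: entries_Mv del: One_nat_def Suc_eq_plus1 add_Suc_right)
    finally show ?thesis .
  qed
  show ?thesis
  proof
    assume "p \<in> degeneracy_locus n m s \<phi>"
    moreover have "vec (s+1) ?x \<in> p" by (rule vec_rep_mem[OF True])
    ultimately have "vec_space.rank n (Mv n m s \<phi> (vec (s+1) ?x)) \<le> n - 1" by (auto simp: degeneracy_locus_def)
    then obtain \<alpha> where \<alpha>: "nontrivial n \<alpha>" "\<forall>j<n+m. (\<Sum>i<n. contract (s+1) (swap_tensor \<phi>) ?x j i * \<alpha> i) = 0"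
      unfolding rank_iff by blast
    then have "incident n m s \<phi> (line n \<alpha>) p" unfolding incident_line_left[OF \<alpha>(1) True] contract_swap by blast
    then show "\<exists>l. incident n m s \<phi> l p" by blast
  next
    assume "\<exists>l. incident n m s \<phi> l p"
    then obtain l where l: "incident n m s \<phi> l p" by blast
    have "vec_space.rank n (Mv n m s \<phi> v) \<le> n - 1" if "v \<in> p" for v
    proof -
      obtain c where c: "v = vec (s+1) (\<lambda>i. c * ?x i)" using \<open>v \<in> p\<close> mem_line[of v "s+1" ?x] rep(3)[OF True] by auto
      have "(\<Sum>i<n. contract (s+1) (swap_tensor \<phi>) (\<lambda>i. c * ?x i) j i * rep n l i) = 0" if "j < n+m" for j
      proof -
        have "(\<Sum>i<n. contract (s+1) (swap_tensor \<phi>) (\<lambda>i. c * ?x i) j i * rep n l i)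
            = c * (\<Sum>i<n. contract (s+1) (swap_tensor \<phi>) ?x j i * rep n l i)"
          by (simp only: contract_scale sum_distrib_left mult.assoc)
        then show ?thesis using l that unfolding incident_swap by simp
      qed
      moreover have "nontrivial n (rep n l)" using l rep(1) by (auto simp: incident_def)
      ultimately show ?thesis unfolding c rank_iff by blast
    qed
    then show "p \<in> degeneracy_locus n m s \<phi>" using True by (simp add: degeneracy_locus_def)
  qed
qed (auto simp: degeneracy_locus_def incident_def)

lemma transpose_kernel_iff:
  assumes l: "l \<in> proj_space n" and p: "p \<in> proj_space (s+1)"
  shows "(\<forall>v\<in>p. \<forall>\<alpha>\<in>l. transpose_mat (Mv n m s \<phi> v) *\<^sub>v \<alpha> = 0\<^sub>v (n+m)) \<longleftrightarrow> incident n m s \<phi> l p"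
proof -
  have comp: "(transpose_mat (Mv n m s \<phi> (vec (s+1) x)) *\<^sub>v vec n \<alpha>) $ j
      = (\<Sum>i<n. contract (s+1) (swap_tensor \<phi>) x j i * \<alpha> i)" if "j < n+m" for x \<alpha> j
    using that entries_Mv[of _ n j m s \<phi> x]
    by (auto simp: scalar_prod_def Mv_def contract_def swap_tensor_def atLeast0LessThan intro!: sum.cong)
  have zero: "transpose_mat (Mv n m s \<phi> (vec (s+1) x)) *\<^sub>v vec n \<alpha> = 0\<^sub>v (n+m)
      \<longleftrightarrow> (\<forall>j<n+m. (\<Sum>i<n. contract (s+1) (swap_tensor \<phi>) x j i * \<alpha> i) = 0)" for x \<alpha>
  proof
    assume "transpose_mat (Mv n m s \<phi> (vec (s+1) x)) *\<^sub>v vec n \<alpha> = 0\<^sub>v (n+m)"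
    then show "\<forall>j<n+m. (\<Sum>i<n. contract (s+1) (swap_tensor \<phi>) x j i * \<alpha> i) = 0"
      using comp[of _ x \<alpha>] by simp
  next
    assume "\<forall>j<n+m. (\<Sum>i<n. contract (s+1) (swap_tensor \<phi>) x j i * \<alpha> i) = 0"
    then show "transpose_mat (Mv n m s \<phi> (vec (s+1) x)) *\<^sub>v vec n \<alpha> = 0\<^sub>v (n+m)"
      using comp[of _ x \<alpha>] by (intro eq_vecI) (auto simp: Mv_def)
  qed
  show ?thesis
  proof
    assume A: "\<forall>v\<in>p. \<forall>\<alpha>\<in>l. transpose_mat (Mv n m s \<phi> v) *\<^sub>v \<alpha> = 0\<^sub>v (n+m)"
    have "vec (s+1) (rep (s+1) p) \<in> p" by (rule vec_rep_mem[OF p])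
    moreover have "vec n (rep n l) \<in> l" by (rule vec_rep_mem[OF l])
    ultimately show "incident n m s \<phi> l p" using A l p unfolding incident_swap zero[symmetric] by blast
  next
    assume inc: "incident n m s \<phi> l p"
    show "\<forall>v\<in>p. \<forall>\<alpha>\<in>l. transpose_mat (Mv n m s \<phi> v) *\<^sub>v \<alpha> = 0\<^sub>v (n+m)"
    proof (intro ballI)
      fix v \<alpha> assume "v \<in> p" "\<alpha> \<in> l"
      then obtain c d where cd: "v = vec (s+1) (\<lambda>i. c * rep (s+1) p i)" "\<alpha> = vec n (\<lambda>i. d * rep n l i)"
        using mem_line[of v "s+1" "rep (s+1) p"] rep(3)[OF p] mem_line[of \<alpha> n "rep n l"] rep(3)[OF l] by auto
      have "(\<Sum>i<n. contract (s+1) (swap_tensor \<phi>) (\<lambda>i. c * rep (s+1) p i) j i * (d * rep n l i))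
          = c * d * (\<Sum>i<n. contract (s+1) (swap_tensor \<phi>) (rep (s+1) p) j i * rep n l i)" for j
        unfolding contract_scale sum_distrib_left by (simp add: mult_ac)
      then show "transpose_mat (Mv n m s \<phi> v) *\<^sub>v \<alpha> = 0\<^sub>v (n+m)"
        using inc unfolding cd zero incident_swap by simp
    qed
  qed
qed

lemma Aalpha_carrier: "Aalpha n m s \<phi> \<alpha> \<in> carrier_mat (n+m) (s+1)"
  by (simp add: Aalpha_def)

lemma entries_Aalpha:
  assumes "j < n + m" "k < s + 1"
  shows "entries (Aalpha n m s \<phi> (vec n \<alpha>)) j k = contract n \<phi> \<alpha> j k"
proof -
  have "(\<Sum>k'<s+1. \<phi> (i, j, k') * unit_vec (s+1) k $ k') = \<phi> (i, j, k)" for i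
  proof -
    have "(\<Sum>k'<s+1. \<phi> (i, j, k') * unit_vec (s+1) k $ k') = (\<Sum>k'<s+1. if k' = k then \<phi> (i, j, k) else 0)"
      by (intro sum.cong) (use assms in auto)
    then show ?thesis using assms by simp
  qed
  then show ?thesis using assms
    by (auto simp: entries_def Aalpha_def Mv_def contract_def scalar_prod_def atLeast0LessThan
        simp del: Suc_eq_plus1 add_Suc_right intro!: sum.cong)
qed

section \<open>Fibres over a morphism in general position\<close>

lemma nullity_value: "\<exists>d. nullity_ge p q d T \<and> \<not> nullity_ge p q (Suc d) T"
proof (rule ccontr)
  assume "\<not> ?thesis"
  then have step: "nullity_ge p q d T \<Longrightarrow> nullity_ge p q (Suc d) T" for d by blast
  have "nullity_ge p q d T" for d by (induction d) (auto intro: step)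
  then show False using not_nullity_ge_Suc by blast
qed

lemma nullity_ge_cong:
  assumes "\<And>j i. j < p \<Longrightarrow> i < q \<Longrightarrow> T' j i = T j i"
  shows "nullity_ge p q k T' \<longleftrightarrow> nullity_ge p q k T"
  using nullity_ge_scale[of p q k T T' 1] nullity_ge_scale[of p q k T' T 1] assms by auto

lemma krull_dim_empty:
  assumes "topspace X = {}" shows "krull_dim X = - \<infinity>"
proof -
  have "\<not> irreducible_chain X k Z" for k Z
  proof
    assume "irreducible_chain X k Z"
    then have "irreducible_space (subtopology X (Z 0))" by (auto simp: irreducible_chain_def)
    then show False using assms by (auto simp: irreducible_space_def)
  qed
  then show ?thesis by (simp add: krull_dim_def bot_ereal_def)
qed

lemma krull_dim_subtopology_empty: "krull_dim (subtopology X {}) = - \<infinity>"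
  by (rule krull_dim_empty) simp

text \<open>The first condition says that \<open>M\<^sub>v\<close> has rank at least \<open>n - 1\<close>, so that \<open>\<psi>\<close> is defined on the
  whole degeneracy locus; the second says that \<open>A\<^sub>\<alpha>\<close> is nonzero, so that \<open>f\<close> is defined and injective.\<close>

locale morphism_in_general_position =
  fixes n m s :: nat and \<phi> :: bundle_map
  assumes n_pos: "0 < n"
    and corank_one: "\<And>x. nontrivial (s+1) x \<Longrightarrow> \<not> nullity_ge (n+m) n 2 (contract (s+1) (swap_tensor \<phi>) x)"
    and immersive: "\<And>\<alpha>. nontrivial n \<alpha> \<Longrightarrow> \<not> nullity_ge (n+m) (s+1) (s+1) (contract n \<phi> \<alpha>)"
begin

abbreviation locus where "locus \<equiv> degeneracy_locus n m s \<phi>"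
abbreviation \<psi> where "\<psi> \<equiv> psi n m s \<phi>"
abbreviation f where "f \<equiv> fmap n m s \<phi>"
abbreviation inc where "inc \<equiv> incident n m s \<phi>"
abbreviation coeffs where "coeffs l \<equiv> contract n \<phi> (rep n l)"
abbreviation null where "null k l \<equiv> nullity_ge (n+m) (s+1) k (coeffs l)"

lemma incident_unique:
  assumes "inc l p" "inc l' p" shows "l = l'"
proof -
  have l: "l \<in> proj_space n" and l': "l' \<in> proj_space n" and p: "p \<in> proj_space (s+1)"
    using assms by (auto simp: incident_def)
  have "line n (rep n l) = line n (rep n l')"
    by (rule kernel_line_unique[OF corank_one[OF rep(1)[OF p]] rep(1)[OF l] _ rep(1)[OF l']])
      (use assms[unfolded incident_swap] in blast)+
  then show ?thesis using rep(3)[OF l] rep(3)[OF l'] by simp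
qed

lemma psi_eq: "inc l p \<Longrightarrow> \<psi> p = l"
proof -
  assume inc: "inc l p"
  then have lp: "l \<in> proj_space n" "p \<in> proj_space (s+1)" by (auto simp: incident_def)
  show "\<psi> p = l"
    unfolding psi_def
  proof (rule the_equality)
    show "l \<in> proj_space n \<and> (\<forall>v\<in>p. \<forall>\<alpha>\<in>l. transpose_mat (Mv n m s \<phi> v) *\<^sub>v \<alpha> = 0\<^sub>v (n+m))"
      using transpose_kernel_iff[OF lp] inc lp by blast
    fix l' assume A: "l' \<in> proj_space n \<and> (\<forall>v\<in>p. \<forall>\<alpha>\<in>l'. transpose_mat (Mv n m s \<phi> v) *\<^sub>v \<alpha> = 0\<^sub>v (n+m))"
    then have "inc l' p" using transpose_kernel_iff[OF conjunct1[OF A] lp(2)] by blast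
    then show "l' = l" using incident_unique[OF _ inc] by blast
  qed
qed

lemma psi_incident: "p \<in> locus \<Longrightarrow> inc (\<psi> p) p"
  using psi_eq unfolding degeneracy_locus_iff[OF n_pos] by blast

lemma incident_locus: "inc l p \<Longrightarrow> p \<in> locus"
  unfolding degeneracy_locus_iff[OF n_pos] by blast

lemma psi_fibre: "{p \<in> locus. \<psi> p = l} = {p. inc l p}"
  using psi_incident psi_eq incident_locus by blast

lemma incident_exists_iff: "l \<in> proj_space n \<Longrightarrow> (\<exists>p. inc l p) \<longleftrightarrow> null 1 l"
proof
  assume l: "l \<in> proj_space n"
  assume "\<exists>p. inc l p"
  then obtain p where "inc l p" by blast
  then show "null 1 l" unfolding nullity_ge_1 by (intro exI[of _ "rep (s+1) p"]) (auto simp: incident_def intro: rep(1))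
next
  assume l: "l \<in> proj_space n"
  assume "null 1 l"
  then obtain y where y: "nontrivial (s+1) y" "\<forall>j<n+m. (\<Sum>i<s+1. coeffs l j i * y i) = 0" unfolding nullity_ge_1 by blast
  then have "inc l (line (s+1) y)" unfolding incident_line_right[OF y(1) l] by blast
  then show "\<exists>p. inc l p" by blast
qed

lemma psi_image: "\<psi> ` locus = {l \<in> proj_space n. null 1 l}"
proof -
  have img: "l \<in> \<psi> ` locus \<longleftrightarrow> (\<exists>p. inc l p)" for l
    using psi_incident psi_eq incident_locus by blast
  show ?thesis
  proof (rule Set.set_eqI)
    fix l
    show "l \<in> \<psi> ` locus \<longleftrightarrow> l \<in> {l \<in> proj_space n. null 1 l}"
    proof (cases "l \<in> proj_space n")
      case True
      then show ?thesis unfolding img using incident_exists_iff[OF True] by simp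
    next
      case False
      then have "\<not> inc l p" for p unfolding incident_def by blast
      then show ?thesis unfolding img using False by simp
    qed
  qed
qed

lemma Aalpha_entry:
  assumes "j < n+m" "k < s+1"
  shows "Aalpha n m s \<phi> (vec n \<alpha>) $$ (j, k) = contract n \<phi> \<alpha> j k"
  using entries_Aalpha[OF assms] by (simp add: entries_def)

lemma Aalpha_scale: "Aalpha n m s \<phi> (vec n (\<lambda>i. c * \<alpha> i)) = c \<cdot>\<^sub>m Aalpha n m s \<phi> (vec n \<alpha>)"
proof (rule eq_matI)
  fix j k assume "j < dim_row (c \<cdot>\<^sub>m Aalpha n m s \<phi> (vec n \<alpha>))" "k < dim_col (c \<cdot>\<^sub>m Aalpha n m s \<phi> (vec n \<alpha>))"
  then have jk: "j < n+m" "k < s+1" using Aalpha_carrier[of n m s \<phi> "vec n \<alpha>"] by auto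
  have "(c \<cdot>\<^sub>m Aalpha n m s \<phi> (vec n \<alpha>)) $$ (j, k) = c * Aalpha n m s \<phi> (vec n \<alpha>) $$ (j, k)"
    using jk Aalpha_carrier[of n m s \<phi> "vec n \<alpha>"] by simp
  also have "\<dots> = Aalpha n m s \<phi> (vec n (\<lambda>i. c * \<alpha> i)) $$ (j, k)"
    unfolding Aalpha_entry[OF jk] contract_scale ..
  finally show "Aalpha n m s \<phi> (vec n (\<lambda>i. c * \<alpha> i)) $$ (j, k) = (c \<cdot>\<^sub>m Aalpha n m s \<phi> (vec n \<alpha>)) $$ (j, k)" ..
qed (simp_all add: Aalpha_def)

lemma zero_contract:
  assumes "\<And>j k. j < n+m \<Longrightarrow> k < s+1 \<Longrightarrow> contract n \<phi> \<alpha> j k = 0"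
  shows "\<not> nontrivial n \<alpha>"
proof
  assume nt: "nontrivial n \<alpha>"
  have "nullity_ge (n+m) (s+1) (s+1) (contract n \<phi> \<alpha>)"
    unfolding nullity_ge_def
  proof (intro allI impI)
    fix C assume C: "C \<subseteq> {..<s+1} \<and> s+1 < card C + (s+1)"
    then have "C \<noteq> {}" by auto
    then obtain i where "i \<in> C" by blast
    then show "\<exists>y. (\<exists>i\<in>C. y i \<noteq> 0) \<and> (\<forall>i. i \<notin> C \<longrightarrow> y i = 0) \<and> (\<forall>j<n+m. (\<Sum>i<s+1. contract n \<phi> \<alpha> j i * y i) = 0)"
      using assms by (intro exI[of _ "\<lambda>k. if k = i then 1 else 0"]) auto
  qed
  then show False using immersive[OF nt] by blast
qed

lemma f_eq_range: "l \<in> proj_space n \<Longrightarrow> f l = range (\<lambda>t. t \<cdot>\<^sub>m Aalpha n m s \<phi> (vec n (rep n l)))"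
proof -
  assume l: "l \<in> proj_space n"
  have "l = range (\<lambda>c. vec n (\<lambda>i. c * rep n l i))"
    using mem_line[of _ n "rep n l"] rep(3)[OF l] by auto
  from arg_cong[OF this, of "image (Aalpha n m s \<phi>)"]
  have "f l = range (\<lambda>c. Aalpha n m s \<phi> (vec n (\<lambda>i. c * rep n l i)))"
    unfolding fmap_def image_image .
  then show ?thesis unfolding Aalpha_scale .
qed

lemma f_in_proj_mat: "l \<in> proj_space n \<Longrightarrow> f l \<in> proj_mat (n+m) (s+1)"
proof -
  assume l: "l \<in> proj_space n"
  have "Aalpha n m s \<phi> (vec n (rep n l)) \<noteq> 0\<^sub>m (n+m) (s+1)"
  proof
    assume z: "Aalpha n m s \<phi> (vec n (rep n l)) = 0\<^sub>m (n+m) (s+1)"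
    have "contract n \<phi> (rep n l) j k = 0" if "j < n+m" "k < s+1" for j k
      unfolding Aalpha_entry[OF that, symmetric] z using that by simp
    then show False using zero_contract rep(1)[OF l] by blast
  qed
  then show ?thesis
    unfolding proj_mat_def using f_eq_range[OF l] Aalpha_carrier[of n m s \<phi> "vec n (rep n l)"] by blast
qed

lemma f_inj:
  assumes l: "l \<in> proj_space n" and l': "l' \<in> proj_space n" and eq: "f l = f l'"
  shows "l = l'"
proof -
  have "1 \<cdot>\<^sub>m Aalpha n m s \<phi> (vec n (rep n l)) \<in> f l" unfolding f_eq_range[OF l] by blast
  then obtain c where c: "1 \<cdot>\<^sub>m Aalpha n m s \<phi> (vec n (rep n l)) = c \<cdot>\<^sub>m Aalpha n m s \<phi> (vec n (rep n l'))"
    unfolding eq f_eq_range[OF l'] by blast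
  have "contract n \<phi> (\<lambda>i. rep n l i - c * rep n l' i) j k = 0" if jk: "j < n+m" "k < s+1" for j k
  proof -
    have "contract n \<phi> (rep n l) j k = c * contract n \<phi> (rep n l') j k"
      using arg_cong[OF c, of "\<lambda>A. A $$ (j, k)"] jk Aalpha_carrier[of n m s \<phi> "vec n (rep n l)"]
        Aalpha_carrier[of n m s \<phi> "vec n (rep n l')"] Aalpha_entry[OF jk] by simp
    moreover have "contract n \<phi> (\<lambda>i. rep n l i - c * rep n l' i) j k = contract n \<phi> (rep n l) j k - c * contract n \<phi> (rep n l') j k"
      by (simp add: contract_def sum_distrib_left sum_subtractf algebra_simps)
    ultimately show ?thesis by simp
  qed
  then have *: "rep n l i = c * rep n l' i" if "i < n" for i
    using zero_contract[of "\<lambda>i. rep n l i - c * rep n l' i"] that by (auto simp: nontrivial_def)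
  moreover have "c \<noteq> 0" using * rep(1)[OF l] by (auto simp: nontrivial_def)
  ultimately have "line n (rep n l) = line n (rep n l')" by (intro line_scale) auto
  then show ?thesis using rep(3)[OF l] rep(3)[OF l'] by simp
qed

lemma rank_locus_iff:
  assumes l: "l \<in> proj_space n" and r: "r \<le> s+1"
  shows "f l \<in> rank_locus (n+m) (s+1) r \<longleftrightarrow> null (s+1-r) l"
proof -
  let ?A = "Aalpha n m s \<phi> (vec n (rep n l))"
  have iff: "vec_space.rank (n+m) B \<le> r \<longleftrightarrow> nullity_ge (n+m) (s+1) (s+1-r) (entries B)" if "B \<in> carrier_mat (n+m) (s+1)" for B
    using rank_le_iff_nullity_ge[OF that, of "s+1-r"] r by auto
  have ent: "nullity_ge (n+m) (s+1) k (entries ?A) \<longleftrightarrow> null k l" for k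
    by (rule nullity_ge_cong) (rule entries_Aalpha)
  have "(\<forall>B\<in>f l. vec_space.rank (n+m) B \<le> r) \<longleftrightarrow> vec_space.rank (n+m) ?A \<le> r"
  proof
    assume "\<forall>B\<in>f l. vec_space.rank (n+m) B \<le> r"
    moreover have "1 \<cdot>\<^sub>m ?A \<in> f l" unfolding f_eq_range[OF l] by blast
    moreover have "1 \<cdot>\<^sub>m ?A = ?A" by (rule eq_matI) auto
    ultimately show "vec_space.rank (n+m) ?A \<le> r" by metis
  next
    assume A: "vec_space.rank (n+m) ?A \<le> r"
    show "\<forall>B\<in>f l. vec_space.rank (n+m) B \<le> r"
    proof
      fix B assume "B \<in> f l"
      then obtain t where B: "B = t \<cdot>\<^sub>m ?A" unfolding f_eq_range[OF l] by blast
      then have Bc: "B \<in> carrier_mat (n+m) (s+1)" using Aalpha_carrier by simp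
      have "nullity_ge (n+m) (s+1) (s+1-r) (entries ?A)" using A iff[OF Aalpha_carrier] by blast
      then have "nullity_ge (n+m) (s+1) (s+1-r) (entries B)"
        by (rule nullity_ge_scale[where c = t]) (use Aalpha_carrier[of n m s \<phi> "vec n (rep n l)"] in \<open>auto simp: B entries_def\<close>)
      then show "vec_space.rank (n+m) B \<le> r" using iff[OF Bc] by blast
    qed
  qed
  then show ?thesis
    unfolding rank_locus_def using f_in_proj_mat[OF l] iff[OF Aalpha_carrier] ent by blast
qed

lemma fibre_incident: "l \<in> proj_space n \<Longrightarrow> {p \<in> locus. f (\<psi> p) = f l} = {p. inc l p}"
proof -
  assume l: "l \<in> proj_space n"
  have "\<psi> p \<in> proj_space n" if "p \<in> locus" for p
    using psi_incident[OF that] unfolding incident_def by blast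
  then have "{p \<in> locus. f (\<psi> p) = f l} = {p \<in> locus. \<psi> p = l}" using f_inj[OF _ l] by blast
  then show ?thesis unfolding psi_fibre .
qed

lemma fibre_eq:
  assumes l: "l \<in> proj_space n"
  shows "{p \<in> locus. f (\<psi> p) = f l} = {p \<in> proj_space (s+1). \<forall>j<n+m. (\<Sum>k<s+1. coeffs l j k * rep (s+1) p k) = 0}"
  unfolding fibre_incident[OF l] incident_def using l by blast

lemma fibre_dim_outside: "q \<notin> Im_f n m s \<phi> \<Longrightarrow> fibre_dim n m s \<phi> q = - \<infinity>"
proof -
  assume q: "q \<notin> Im_f n m s \<phi>"
  have "{p \<in> locus. f (\<psi> p) = q} = {}"
  proof -
    have "\<psi> p \<in> proj_space n" if "p \<in> locus" for p
      using psi_incident[OF that] unfolding incident_def by blast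
    then show ?thesis using q unfolding Im_f_def by blast
  qed
  then show ?thesis unfolding fibre_dim_def by (simp only: krull_dim_subtopology_empty)
qed

text \<open>The fibre is the projective space of the kernel of \<open>A\<^sub>\<alpha>\<close>, and is empty if that kernel is zero.\<close>

lemma fibre_dim_value:
  assumes l: "l \<in> proj_space n"
  shows "fibre_dim n m s \<phi> (f l) \<ge> ereal (real k) \<longleftrightarrow> null (Suc k) l"
    and "fibre_dim n m s \<phi> (f l) = ereal (real k) \<longleftrightarrow> null (Suc k) l \<and> \<not> null (Suc (Suc k)) l"
proof -
  obtain d where d: "null d l" "\<not> null (Suc d) l" using nullity_value by blast
  have le: "null k l \<longleftrightarrow> k \<le> d" for k
    using d nullity_ge_mono[of "n+m" "s+1" _ "coeffs l"] by (meson not_less_eq_eq)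
  have "fibre_dim n m s \<phi> (f l) = (if d = 0 then - \<infinity> else ereal (real (d - 1)))"
  proof (cases "d = 0")
    case True
    then have "\<not> null 1 l" using d(2) by simp
    then have "{p. inc l p} = {}" using incident_exists_iff[OF l] by blast
    then have "fibre_dim n m s \<phi> (f l) = - \<infinity>"
      unfolding fibre_dim_def fibre_incident[OF l] by (simp only: krull_dim_subtopology_empty)
    then show ?thesis using True by simp
  next
    case False
    then obtain e where e: "d = Suc e" by (cases d) auto
    show ?thesis
      unfolding fibre_dim_def fibre_eq[OF l] using krull_dim_linear_subspace[of "n+m" "s+1" e "coeffs l"] d e by simp
  qed
  then show "fibre_dim n m s \<phi> (f l) \<ge> ereal (real k) \<longleftrightarrow> null (Suc k) l"
    and "fibre_dim n m s \<phi> (f l) = ereal (real k) \<longleftrightarrow> null (Suc k) l \<and> \<not> null (Suc (Suc k)) l"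
    unfolding le by auto
qed

lemma fibres_precisely:
  assumes k: "k \<le> s"
  shows "fibres_of_dim_precisely_over n m s \<phi> k (s - k)"
proof -
  have sk: "s + 1 - (s - k) = Suc k" using k by simp
  have ge: "q \<in> proj_mat (n+m) (s+1) \<and> fibre_dim n m s \<phi> q \<ge> ereal (real k) \<longleftrightarrow>
      q \<in> Im_f n m s \<phi> \<inter> rank_locus (n+m) (s+1) (s - k)" for q
  proof (cases "q \<in> Im_f n m s \<phi>")
    case True
    then obtain l where l: "l \<in> proj_space n" "q = f l" by (auto simp: Im_f_def)
    then show ?thesis using fibre_dim_value(1)[OF l(1), of k] f_in_proj_mat[OF l(1)] rank_locus_iff[OF l(1), of "s - k"] sk True by simp
  qed (simp add: fibre_dim_outside)
  have eq: "q \<in> proj_mat (n+m) (s+1) \<and> fibre_dim n m s \<phi> q = ereal (real k) \<longleftrightarrow>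
      q \<in> Im_f n m s \<phi> \<inter> rank_locus (n+m) (s+1) (s - k) - rank_locus (n+m) (s+1) (s - k - 1)" for q
  proof (cases "q \<in> Im_f n m s \<phi>")
    case True
    then obtain l where l: "l \<in> proj_space n" "q = f l" by (auto simp: Im_f_def)
    show ?thesis
    proof (cases "k = s")
      case True
      \<comment> \<open>Then both sides are empty: rank zero does not occur, so no fibre is all of the source.\<close>
      have "\<not> null (s+1) l" by (rule immersive[OF rep(1)[OF l(1)]])
      then show ?thesis using fibre_dim_value(2)[OF l(1), of k] rank_locus_iff[OF l(1), of 0] True l(2) by simp
    next
      case False
      then have "s + 1 - (s - k - 1) = Suc (Suc k)" using k by simp
      then show ?thesis using fibre_dim_value(2)[OF l(1), of k] f_in_proj_mat[OF l(1)] rank_locus_iff[OF l(1), of "s - k"]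
          rank_locus_iff[OF l(1), of "s - k - 1"] sk \<open>q \<in> Im_f n m s \<phi>\<close> l(2) by simp
    qed
  qed (simp add: fibre_dim_outside)
  show ?thesis unfolding fibres_of_dim_precisely_over_def using ge eq by blast
qed

lemma null_line:
  assumes "nontrivial n \<alpha>"
  shows "null k (line n \<alpha>) \<longleftrightarrow> nullity_ge (n+m) (s+1) k (contract n \<phi> \<alpha>)"
proof -
  obtain c where c: "c \<noteq> 0" "\<And>i. i < n \<Longrightarrow> rep n (line n \<alpha>) i = c * \<alpha> i" using rep_line[OF assms] by blast
  have eq: "coeffs (line n \<alpha>) j k = c * contract n \<phi> \<alpha> j k" for j k
    using contract_cong[of n "rep n (line n \<alpha>)" "\<lambda>i. c * \<alpha> i" \<phi> j k] c(2) contract_scale by simp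
  then have eq': "contract n \<phi> \<alpha> j k = (1 / c) * coeffs (line n \<alpha>) j k" for j k using c(1) by simp
  show ?thesis
    using nullity_ge_scale[of "n+m" "s+1" k "contract n \<phi> \<alpha>" "coeffs (line n \<alpha>)" c, OF _ eq]
      nullity_ge_scale[of "n+m" "s+1" k "coeffs (line n \<alpha>)" "contract n \<phi> \<alpha>" "1 / c", OF _ eq'] by blast
qed

lemma admits_fibres_iff:
  "admits_fibres_of_dim n m s \<phi> k \<longleftrightarrow>
    (\<exists>\<alpha>. nontrivial n \<alpha> \<and> nullity_ge (n+m) (s+1) (Suc k) (contract n \<phi> \<alpha>) \<and> \<not> nullity_ge (n+m) (s+1) (Suc (Suc k)) (contract n \<phi> \<alpha>))"
proof
  assume "admits_fibres_of_dim n m s \<phi> k"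
  then obtain q where q: "fibre_dim n m s \<phi> q = ereal (real k)" by (auto simp: admits_fibres_of_dim_def)
  then have "q \<in> Im_f n m s \<phi>" using fibre_dim_outside[of q] by force
  then obtain l where l: "l \<in> proj_space n" "q = f l" by (auto simp: Im_f_def)
  then have "null (Suc k) l \<and> \<not> null (Suc (Suc k)) l" using fibre_dim_value(2)[OF l(1)] q by simp
  then show "\<exists>\<alpha>. nontrivial n \<alpha> \<and> nullity_ge (n+m) (s+1) (Suc k) (contract n \<phi> \<alpha>) \<and> \<not> nullity_ge (n+m) (s+1) (Suc (Suc k)) (contract n \<phi> \<alpha>)"
    using rep(1)[OF l(1)] by blast
next
  assume "\<exists>\<alpha>. nontrivial n \<alpha> \<and> nullity_ge (n+m) (s+1) (Suc k) (contract n \<phi> \<alpha>) \<and> \<not> nullity_ge (n+m) (s+1) (Suc (Suc k)) (contract n \<phi> \<alpha>)"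
  then obtain \<alpha> where \<alpha>: "nontrivial n \<alpha>" "null (Suc k) (line n \<alpha>)" "\<not> null (Suc (Suc k)) (line n \<alpha>)"
    using null_line by blast
  then have "fibre_dim n m s \<phi> (f (line n \<alpha>)) = ereal (real k)"
    using fibre_dim_value(2)[OF line_in_proj_space[OF \<alpha>(1)]] by blast
  then show "admits_fibres_of_dim n m s \<phi> k"
    unfolding admits_fibres_of_dim_def using f_in_proj_mat[OF line_in_proj_space[OF \<alpha>(1)]] by blast
qed

lemma image_composition: "(f \<circ> \<psi>) ` locus = Im_f n m s \<phi> \<inter> rank_locus (n+m) (s+1) s"
proof -
  have "f l \<in> rank_locus (n+m) (s+1) s \<longleftrightarrow> null 1 l" if "l \<in> proj_space n" for l
    using rank_locus_iff[OF that, of s] by simp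
  then show ?thesis unfolding image_comp[symmetric] psi_image Im_f_def by blast
qed

text \<open>Kernels are one-dimensional on both sides of the incidence variety, so the same lemma gives
  \<open>\<psi>\<close> and its inverse locally by cofactors. The image is closed because it is where \<open>A\<^sub>\<alpha>\<close> has
  deficient rank.\<close>

lemma closed_immersion_psi:
  assumes no: "\<And>l. l \<in> proj_space n \<Longrightarrow> \<not> null 2 l"
  shows "closed_immersion (s+1) locus n \<psi>"
proof (rule closed_immersion_of_local_inverse)
  show locusP: "locus \<subseteq> proj_space (s+1)" by (auto simp: degeneracy_locus_def)
  have incP: "inc l p \<Longrightarrow> l \<in> proj_space n" "inc l p \<Longrightarrow> p \<in> proj_space (s+1)" for l p
    by (simp_all add: incident_def)
  show "locally_by_forms (s+1) locus n \<psi>"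
  proof (rule kernel_map_locally_by_forms[where T = "contract (s+1) (swap_tensor \<phi>)" and p = "n+m"])
    show "\<not> nullity_ge (n+m) n 2 (contract (s+1) (swap_tensor \<phi>) (rep (s+1) p))" if "p \<in> locus" for p
      using that locusP by (intro corank_one rep(1)) blast
    show "\<psi> p \<in> proj_space n" if "p \<in> locus" for p using psi_incident[OF that] incP by blast
    show "(\<Sum>i<n. contract (s+1) (swap_tensor \<phi>) (rep (s+1) p) j i * rep n (\<psi> p) i) = 0" if "p \<in> locus" "j < n+m" for p j
      using psi_incident[OF that(1)] that(2) unfolding incident_swap by blast
  qed (use contract_linear n_pos locusP in auto)
  have unique: "p = p'" if p: "inc l p" and p': "inc l p'" for l p p'
  proof -
    have "line (s+1) (rep (s+1) p) = line (s+1) (rep (s+1) p')"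
      by (rule kernel_line_unique[OF no[OF incP(1)[OF p]] rep(1)[OF incP(2)[OF p]] _ rep(1)[OF incP(2)[OF p']]])
        (use p p' in \<open>unfold incident_def, blast+\<close>)
    then show ?thesis using rep(3)[OF incP(2)[OF p]] rep(3)[OF incP(2)[OF p']] by simp
  qed
  define g where "g l = (THE p. inc l p)" for l
  have g: "g (\<psi> p) = p" if "p \<in> locus" for p
    unfolding g_def
    by (rule the_equality[where a = p and P = "inc (\<psi> p)", OF psi_incident[OF that]]) (rule unique[OF _ psi_incident[OF that]])
  show "g (\<psi> p) = p" if "p \<in> locus" for p by (rule g[OF that])
  have imgP: "\<psi> ` locus \<subseteq> proj_space n" unfolding psi_image by blast
  have ginc: "inc l (g l)" if "l \<in> \<psi> ` locus" for l using that g psi_incident by auto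
  show "locally_by_forms n (\<psi> ` locus) (s+1) g"
  proof (rule kernel_map_locally_by_forms[where T = "contract n \<phi>" and p = "n+m"])
    show "\<not> nullity_ge (n+m) (s+1) 2 (contract n \<phi> (rep n l))" if "l \<in> \<psi> ` locus" for l
      using that imgP no by blast
    show "g l \<in> proj_space (s+1)" if "l \<in> \<psi> ` locus" for l using ginc[OF that] incP by blast
    show "(\<Sum>i<s+1. contract n \<phi> (rep n l) j i * rep (s+1) (g l) i) = 0" if "l \<in> \<psi> ` locus" "j < n+m" for l j
      using ginc[OF that(1)] that(2) unfolding incident_def by blast
  qed (use contract_linear imgP in auto)
  have op: "openin (zariski n) {l \<in> proj_space n. \<not> null 1 l}"
    by (rule open_bounded_nullity[OF contract_linear]) auto
  have eq: "\<psi> ` locus = topspace (zariski n) - {l \<in> proj_space n. \<not> null 1 l}"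
    unfolding psi_image by auto
  show "closedin (zariski n) (\<psi> ` locus)"
    unfolding eq by (rule closedin_diff[OF closedin_topspace op])
qed

lemma not_closed_immersion_psi:
  assumes l: "l \<in> proj_space n" and null2: "null 2 l"
  shows "\<not> closed_immersion (s+1) locus n \<psi>"
proof
  assume "closed_immersion (s+1) locus n \<psi>"
  then have "embedding_map (subtopology (zariski (s+1)) locus) (zariski n) \<psi>" by (simp add: closed_immersion_def)
  then have "inj_on \<psi> (topspace (subtopology (zariski (s+1)) locus))"
    unfolding embedding_map_def by (rule homeomorphic_imp_injective_map)
  moreover have "topspace (subtopology (zariski (s+1)) locus) = locus" by (auto simp: degeneracy_locus_def)
  ultimately have inj: "inj_on \<psi> locus" by simp
  obtain y z where y: "nontrivial (s+1) y" and z: "nontrivial (s+1) z" and ne: "line (s+1) y \<noteq> line (s+1) z"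
    and yk: "\<forall>j<n+m. (\<Sum>i<s+1. coeffs l j i * y i) = 0" and zk: "\<forall>j<n+m. (\<Sum>i<s+1. coeffs l j i * z i) = 0"
    using nullity_ge_2_two_lines[OF null2] by blast
  have "inc l (line (s+1) y)" "inc l (line (s+1) z)"
    using yk zk incident_line_right[OF y l] incident_line_right[OF z l] by blast+
  then show False using inj ne psi_eq incident_locus by (metis inj_onD)
qed

lemma psi_surjective:
  assumes s: "s = n + m"
  shows "\<psi> ` locus = proj_space n"
proof -
  have "null 1 l" for l
  proof -
    obtain z where "\<exists>i\<in>{..<s+1}. z i \<noteq> 0" "\<forall>j\<in>{..<n+m}. (\<Sum>i<s+1. coeffs l j i * z i) = 0"
      using underdetermined_system[of "{..<n+m}" "{..<s+1}" "coeffs l"] s by auto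
    then show ?thesis unfolding nullity_ge_1 by (auto simp: nontrivial_def)
  qed
  then show ?thesis unfolding psi_image by blast
qed

lemma generic_fibre_point:
  assumes s: "s = n + m" and \<alpha>: "nontrivial n \<alpha>" "\<not> nullity_ge (n+m) (s+1) 2 (contract n \<phi> \<alpha>)"
  shows "\<exists>U. openin (zariski n) U \<and> U \<noteq> {} \<and> (\<forall>l\<in>U. \<exists>p. {p' \<in> locus. \<psi> p' = l} = {p})"
proof (intro exI conjI)
  define U where "U = {l \<in> proj_space n. \<not> null 2 l}"
  show "openin (zariski n) U"
    unfolding U_def by (rule open_bounded_nullity[OF contract_linear]) (use s n_pos in auto)
  show "U \<noteq> {}" using null_line[OF \<alpha>(1)] \<alpha>(2) line_in_proj_space[OF \<alpha>(1)] by (auto simp: U_def)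
  show "\<forall>l\<in>U. \<exists>p. {p' \<in> locus. \<psi> p' = l} = {p}"
  proof
    fix l assume "l \<in> U"
    then have l: "l \<in> proj_space n" and no: "\<not> null 2 l" by (auto simp: U_def)
    have "l \<in> \<psi> ` locus" using psi_surjective[OF s] l by simp
    then obtain p where p: "inc l p" using psi_incident by blast
    have "p' = p" if "inc l p'" for p'
    proof -
      have P: "p \<in> proj_space (s+1)" "p' \<in> proj_space (s+1)" using p that by (simp_all add: incident_def)
      have "line (s+1) (rep (s+1) p') = line (s+1) (rep (s+1) p)"
        by (rule kernel_line_unique[OF no rep(1)[OF P(2)] _ rep(1)[OF P(1)]])
          (use p that in \<open>unfold incident_def, blast+\<close>)
      then show ?thesis using rep(3)[OF P(1)] rep(3)[OF P(2)] by simp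
    qed
    then show "\<exists>p. {p' \<in> locus. \<psi> p' = l} = {p}" using p unfolding psi_fibre by blast
  qed
qed

end

section \<open>General morphisms\<close>

text \<open>An open set given by one polynomial. It need not be restricted to extensional functions, which
  makes it convenient to combine conditions.\<close>

definition generically :: "'i set \<Rightarrow> (('i \<Rightarrow> complex) \<Rightarrow> bool) \<Rightarrow> bool" where
  "generically I Q \<longleftrightarrow> (\<exists>D\<in>polyfun I. (\<exists>x. D x \<noteq> 0) \<and> (\<forall>x. D x \<noteq> 0 \<longrightarrow> Q x))"

lemma generically_conj:
  assumes "generically I P" "generically I Q"
  shows "generically I (\<lambda>x. P x \<and> Q x)"
proof -
  obtain D x where D: "D \<in> polyfun I" "D x \<noteq> 0" "\<And>x. D x \<noteq> 0 \<Longrightarrow> P x" using assms(1) unfolding generically_def by blast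
  obtain E y where E: "E \<in> polyfun I" "E y \<noteq> 0" "\<And>x. E x \<noteq> 0 \<Longrightarrow> Q x" using assms(2) unfolding generically_def by blast
  obtain t where t: "D (\<lambda>i. x i + t * (y i - x i)) \<noteq> 0 \<and> E (\<lambda>i. x i + t * (y i - x i)) \<noteq> 0"
    using polyfun_common_nonzero[of D I x E y, OF D(1,2) E(1,2)] by (elim exE)
  show ?thesis
    unfolding generically_def
  proof (rule bexI[OF _ polyfun_mult[OF D(1) E(1)]], intro conjI allI impI)
    show "\<exists>x. D x * E x \<noteq> 0" by (rule exI[of _ "\<lambda>i. x i + t * (y i - x i)"]) (use t in simp)
    fix x assume "D x * E x \<noteq> 0"
    then show "P x" "Q x" using D(3) E(3) by simp_all
  qed
qed

lemma generically_True: "(\<And>x. Q x) \<Longrightarrow> generically I Q"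
  unfolding generically_def by (intro bexI[OF _ polyfun_const[of 1]]) auto

lemma generically_imp: "(P \<Longrightarrow> generically I Q) \<Longrightarrow> generically I (\<lambda>x. P \<longrightarrow> Q x)"
  by (cases P) (auto intro: generically_True)

lemma generically_mono: "generically I P \<Longrightarrow> (\<And>x. P x \<Longrightarrow> Q x) \<Longrightarrow> generically I Q"
  unfolding generically_def by blast

lemma for_general_morphism_of_generically:
  assumes "generically (bundle_map_index n m s) Q"
  shows "for_general_morphism n m s Q"
proof -
  let ?I = "bundle_map_index n m s"
  obtain D x where D: "D \<in> polyfun ?I" "D x \<noteq> 0" "\<And>x. D x \<noteq> 0 \<Longrightarrow> Q x"
    using assms unfolding generically_def by blast
  obtain F where F: "F \<in> poly_in ?I" "D = peval F" using D(1) by (auto simp: polyfun_def)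
  let ?U = "{x \<in> ?I \<rightarrow>\<^sub>E UNIV. peval F x \<noteq> 0}"
  have "openin (affine_zariski ?I) ?U"
    unfolding affine_zariski_def by (rule topology_generated_by_Basis) (use F(1) in blast)
  moreover have "restrict x ?I \<in> ?U"
    using polyfun_cong[OF D(1), of x "restrict x ?I"] D(2) F(2) by simp
  moreover have "\<forall>\<phi>\<in>?U. Q \<phi>" using D(3) F(2) by blast
  ultimately show ?thesis unfolding for_general_morphism_def by blast
qed

lemma polyfun_mono: "D \<in> polyfun I \<Longrightarrow> I \<subseteq> J \<Longrightarrow> D \<in> polyfun J"
  by (auto simp: polyfun_def poly_in_def image_iff)

lemma generically_bounded_nullity:
  assumes "a \<le> k * (n + m + k - (s + 1))" "a \<le> n" "1 \<le> k" "k \<le> s + 1" "s + 1 \<le> n + m + k"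
  shows "generically (bundle_map_index n m s) (\<lambda>\<phi>. \<forall>\<alpha>. nontrivial a \<alpha> \<longrightarrow> \<not> nullity_ge (n+m) (s+1) k (contract a \<phi> \<alpha>))"
proof -
  obtain \<phi>0 where "\<forall>x. nontrivial a x \<longrightarrow> \<not> nullity_ge (n+m) (s+1) k (contract a \<phi>0 x)"
    using exists_space_of_bounded_nullity[OF assms(1,3,4,5)] by blast
  then obtain D where D: "D \<in> polyfun ({..<a} \<times> {..<n+m} \<times> {..<s+1})" "D \<phi>0 \<noteq> 0"
    "\<forall>\<phi>. D \<phi> \<noteq> 0 \<longrightarrow> (\<forall>x. nontrivial a x \<longrightarrow> \<not> nullity_ge (n+m) (s+1) k (contract a \<phi> x))"
    using bounded_nullity_is_open[OF assms(3,4), of a "n+m" \<phi>0] by blast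
  have "D \<in> polyfun (bundle_map_index n m s)"
    by (rule polyfun_mono[OF D(1)]) (use assms(2) in \<open>auto simp: bundle_map_index_def\<close>)
  then show ?thesis unfolding generically_def using D(2,3) by blast
qed

lemma generically_corank_one:
  assumes "s + 1 \<le> 2 * (m + 2)" "2 \<le> n"
  shows "generically (bundle_map_index n m s) (\<lambda>\<phi>. \<forall>x. nontrivial (s+1) x \<longrightarrow>
    \<not> nullity_ge (n+m) n 2 (contract (s+1) (swap_tensor \<phi>) x))"
proof -
  obtain \<phi>0 where "\<forall>x. nontrivial (s+1) x \<longrightarrow> \<not> nullity_ge (n+m) n 2 (contract (s+1) \<phi>0 x)"
    using exists_space_of_bounded_nullity[of "s+1" 2 "n+m" n] assms by auto
  then obtain D where D: "D \<in> polyfun ({..<s+1} \<times> {..<n+m} \<times> {..<n})" "D \<phi>0 \<noteq> 0"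
    "\<forall>\<phi>. D \<phi> \<noteq> 0 \<longrightarrow> (\<forall>x. nontrivial (s+1) x \<longrightarrow> \<not> nullity_ge (n+m) n 2 (contract (s+1) \<phi> x))"
    using bounded_nullity_is_open[of 2 n "s+1" "n+m" \<phi>0] assms(2) by auto
  have poly: "(\<lambda>\<phi>. D (swap_tensor \<phi>)) \<in> polyfun (bundle_map_index n m s)"
  proof (rule polyfun_compose[OF D(1)])
    fix idx assume "idx \<in> {..<s+1} \<times> {..<n+m} \<times> {..<n}"
    then obtain k j i where idx: "idx = (k, j, i)" "k < s+1" "j < n+m" "i < n" by auto
    then show "(\<lambda>\<phi>. swap_tensor \<phi> idx) \<in> polyfun (bundle_map_index n m s)"
      unfolding idx(1) swap_tensor_def by (auto simp: bundle_map_index_def intro!: polyfun_var)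
  qed
  have "swap_tensor (swap_tensor \<phi>0) = \<phi>0" by (auto simp: swap_tensor_def)
  then have nz: "D (swap_tensor (swap_tensor \<phi>0)) \<noteq> 0" using D(2) by simp
  show ?thesis
    unfolding generically_def
  proof (rule bexI[OF _ poly], intro conjI)
    show "\<exists>\<phi>. D (swap_tensor \<phi>) \<noteq> 0" by (rule exI[of _ "swap_tensor \<phi>0"]) (rule nz)
    show "\<forall>\<phi>. D (swap_tensor \<phi>) \<noteq> 0 \<longrightarrow> (\<forall>x. nontrivial (s+1) x \<longrightarrow>
        \<not> nullity_ge (n+m) n 2 (contract (s+1) (swap_tensor \<phi>) x))"
      by (rule allI) (rule spec[OF D(3)])
  qed
qed

lemma contract_extend: "a \<le> n \<Longrightarrow> contract n \<phi> (\<lambda>i. if i < a then \<alpha> i else 0) j k = contract a \<phi> \<alpha> j k"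
  unfolding contract_def by (rule sum.mono_neutral_cong_right) auto

text \<open>The subfamily of the first \<open>k (n + m + k - (s + 1)) + 1\<close> parameters has a member of nullity at least
  \<open>k\<close> for dimension reasons, but in general no nonzero member of nullity at least \<open>k + 1\<close>.\<close>

lemma generically_exact_nullity:
  assumes a: "k * (n + m + k - (s + 1)) + 1 \<le> n" and k: "1 \<le> k" "k \<le> s" "s \<le> n + m"
  shows "generically (bundle_map_index n m s) (\<lambda>\<phi>. \<exists>\<alpha>. nontrivial n \<alpha> \<and>
    nullity_ge (n+m) (s+1) k (contract n \<phi> \<alpha>) \<and> \<not> nullity_ge (n+m) (s+1) (Suc k) (contract n \<phi> \<alpha>))"
proof -
  define a' where "a' = k * (n + m + k - (s + 1)) + 1"
  have "a' \<le> Suc k * (n + m + Suc k - (s + 1))"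
  proof -
    obtain t where t: "n + m + k = s + 1 + t" using k by (metis add_mono le_iff_add)
    then have "n + m + k - (s + 1) = t" "n + m + Suc k - (s + 1) = Suc t" by auto
    then show ?thesis by (simp add: a'_def)
  qed
  then have "generically (bundle_map_index n m s) (\<lambda>\<phi>. \<forall>\<alpha>. nontrivial a' \<alpha> \<longrightarrow> \<not> nullity_ge (n+m) (s+1) (Suc k) (contract a' \<phi> \<alpha>))"
    by (rule generically_bounded_nullity) (use a k in \<open>auto simp: a'_def\<close>)
  then show ?thesis
  proof (rule generically_mono)
    fix \<phi> assume no: "\<forall>\<alpha>. nontrivial a' \<alpha> \<longrightarrow> \<not> nullity_ge (n+m) (s+1) (Suc k) (contract a' \<phi> \<alpha>)"
    obtain \<alpha> where \<alpha>: "nontrivial a' \<alpha>" "nullity_ge (n+m) (s+1) k (contract a' \<phi> \<alpha>)"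
      using exists_point_of_nullity[of k "s+1" "n+m" a' \<phi>] k by (auto simp: a'_def)
    define \<alpha>' where "\<alpha>' i = (if i < a' then \<alpha> i else 0)" for i
    have "contract n \<phi> \<alpha>' j i = contract a' \<phi> \<alpha> j i" for j i
      unfolding \<alpha>'_def by (rule contract_extend) (use a in \<open>simp add: a'_def\<close>)
    then have "contract n \<phi> \<alpha>' = contract a' \<phi> \<alpha>" by (intro ext)
    moreover have "nontrivial n \<alpha>'" using \<alpha>(1) a by (auto simp: nontrivial_def \<alpha>'_def a'_def)
    ultimately show "\<exists>\<alpha>. nontrivial n \<alpha> \<and> nullity_ge (n+m) (s+1) k (contract n \<phi> \<alpha>) \<and>
        \<not> nullity_ge (n+m) (s+1) (Suc k) (contract n \<phi> \<alpha>)" using \<alpha> no by metis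
  qed
qed

theorem theorem5p2:
  fixes n m s :: nat
  assumes "n \<ge> 3" and "m \<ge> 0" and "s \<in> {m+2..2*m+3}"
  shows "for_general_morphism n m s (\<lambda>\<phi>.
    (s = n + m \<longrightarrow>
      (psi n m s \<phi> ` degeneracy_locus n m s \<phi> = proj_space n \<and>
       (\<exists>U. openin (zariski n) U \<and> U \<noteq> {} \<and>
          (\<forall>l \<in> U. \<exists>p. {p' \<in> degeneracy_locus n m s \<phi>. psi n m s \<phi> p' = l} = {p}))) \<and>
      (admits_fibres_of_dim n m s \<phi> 1 \<and>
       fibres_of_dim_precisely_over n m s \<phi> 1 (s - 1))) \<and>
    (s < n + m \<longrightarrow>
      ((closed_immersion (s+1) (degeneracy_locus n m s \<phi>) n (psi n m s \<phi>) \<longleftrightarrow>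
          int n > 2 * int s - 2 * int m - 3) \<and>
       (int n > 2 * int s - 2 * int m - 3 \<longrightarrow>
          (fmap n m s \<phi> \<circ> psi n m s \<phi>) ` degeneracy_locus n m s \<phi> =
            Im_f n m s \<phi> \<inter> rank_locus (n+m) (s+1) s)) \<and>
      ((admits_fibres_of_dim n m s \<phi> 1 \<longleftrightarrow> int n \<le> 2 * int s - 2 * int m - 3) \<and>
       fibres_of_dim_precisely_over n m s \<phi> 1 (s - 1)) \<and>
      ((admits_fibres_of_dim n m s \<phi> 2 \<longleftrightarrow>
          real n \<le> 1/2 * (3 * real s - 3 * real m - 7)) \<and>
       fibres_of_dim_precisely_over n m s \<phi> 2 (s - 2))))"
proof -
  let "for_general_morphism _ _ _ ?Q" = ?thesis
  let ?I = "bundle_map_index n m s"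
  let ?null = "\<lambda>k \<phi> \<alpha>. nullity_ge (n+m) (s+1) k (contract n \<phi> \<alpha>)"
  have n: "3 \<le> n" and s: "m + 2 \<le> s" "s \<le> 2 * m + 3" using assms by auto
  define P1 where "P1 \<longleftrightarrow> int n \<le> 2 * int s - 2 * int m - 3"
  define P2 where "P2 \<longleftrightarrow> 2 * int n \<le> 3 * int s - 3 * int m - 7"
  have P2: "real n \<le> 1/2 * (3 * real s - 3 * real m - 7) \<longleftrightarrow> P2"
  proof -
    have "P2 \<longleftrightarrow> real_of_int (2 * int n) \<le> real_of_int (3 * int s - 3 * int m - 7)"
      unfolding P2_def of_int_le_iff ..
    also have "\<dots> \<longleftrightarrow> real n \<le> 1/2 * (3 * real s - 3 * real m - 7)" by auto
    finally show ?thesis ..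
  qed
  let ?G = "\<lambda>\<phi>. s \<le> n + m \<longrightarrow>
     (\<forall>x. nontrivial (s+1) x \<longrightarrow> \<not> nullity_ge (n+m) n 2 (contract (s+1) (swap_tensor \<phi>) x)) \<and>
     (\<forall>\<alpha>. nontrivial n \<alpha> \<longrightarrow> \<not> ?null (s+1) \<phi> \<alpha>) \<and>
     (\<forall>\<alpha>. nontrivial 1 \<alpha> \<longrightarrow> \<not> nullity_ge (n+m) (s+1) 2 (contract 1 \<phi> \<alpha>)) \<and>
     (\<not> P1 \<longrightarrow> (\<forall>\<alpha>. nontrivial n \<alpha> \<longrightarrow> \<not> ?null 2 \<phi> \<alpha>)) \<and>
     (P1 \<longrightarrow> (\<exists>\<alpha>. nontrivial n \<alpha> \<and> ?null 2 \<phi> \<alpha> \<and> \<not> ?null (Suc 2) \<phi> \<alpha>)) \<and>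
     (\<not> P2 \<longrightarrow> (\<forall>\<alpha>. nontrivial n \<alpha> \<longrightarrow> \<not> ?null 3 \<phi> \<alpha>)) \<and>
     (P2 \<longrightarrow> (\<exists>\<alpha>. nontrivial n \<alpha> \<and> ?null 3 \<phi> \<alpha> \<and> \<not> ?null (Suc 3) \<phi> \<alpha>))"
  have gen: "generically ?I ?G"
  proof (intro generically_imp generically_conj)
    assume sn: "s \<le> n + m"
    show "generically ?I (\<lambda>\<phi>. \<forall>x. nontrivial (s+1) x \<longrightarrow> \<not> nullity_ge (n+m) n 2 (contract (s+1) (swap_tensor \<phi>) x))"
      by (rule generically_corank_one) (use n s in auto)
    show "generically ?I (\<lambda>\<phi>. \<forall>\<alpha>. nontrivial n \<alpha> \<longrightarrow> \<not> ?null (s+1) \<phi> \<alpha>)"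
    proof (rule generically_bounded_nullity)
      have "n \<le> 1 * (n + m)" by simp
      also have "\<dots> \<le> (s + 1) * (n + m + (s + 1) - (s + 1))" by (intro mult_mono) auto
      finally show "n \<le> (s + 1) * (n + m + (s + 1) - (s + 1))" .
    qed auto
    show "generically ?I (\<lambda>\<phi>. \<forall>\<alpha>. nontrivial 1 \<alpha> \<longrightarrow> \<not> nullity_ge (n+m) (s+1) 2 (contract 1 \<phi> \<alpha>))"
      by (rule generically_bounded_nullity) (use n s sn in auto)
    show "generically ?I (\<lambda>\<phi>. \<forall>\<alpha>. nontrivial n \<alpha> \<longrightarrow> \<not> ?null 2 \<phi> \<alpha>)" if "\<not> P1"
      by (rule generically_bounded_nullity) (use n s sn that in \<open>auto simp: P1_def\<close>)
    show "generically ?I (\<lambda>\<phi>. \<exists>\<alpha>. nontrivial n \<alpha> \<and> ?null 2 \<phi> \<alpha> \<and> \<not> ?null (Suc 2) \<phi> \<alpha>)" if "P1"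
      by (rule generically_exact_nullity) (use n s sn that in \<open>auto simp: P1_def\<close>)
    show "generically ?I (\<lambda>\<phi>. \<forall>\<alpha>. nontrivial n \<alpha> \<longrightarrow> \<not> ?null 3 \<phi> \<alpha>)" if "\<not> P2"
      by (rule generically_bounded_nullity) (use n s sn that in \<open>auto simp: P2_def\<close>)
    show "generically ?I (\<lambda>\<phi>. \<exists>\<alpha>. nontrivial n \<alpha> \<and> ?null 3 \<phi> \<alpha> \<and> \<not> ?null (Suc 3) \<phi> \<alpha>)" if "P2"
      by (rule generically_exact_nullity) (use n s sn that in \<open>auto simp: P2_def\<close>)
  qed
  show ?thesis
  proof (rule for_general_morphism_of_generically, rule generically_mono[OF gen])
    fix \<phi> assume G: "?G \<phi>"
    show "?Q \<phi>"
    proof (cases "s \<le> n + m")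
      case False
      then show ?thesis by simp
    next
      case True
      note H = mp[OF G True]
      interpret morphism_in_general_position n m s \<phi>
        by unfold_locales (use n H in auto)
      have no2: "\<not> null 2 l" if "\<not> P1" "l \<in> proj_space n" for l
        using H that rep(1) by blast
      have admits1: "admits_fibres_of_dim n m s \<phi> 1 \<longleftrightarrow> P1"
        using H unfolding admits_fibres_iff numeral_2_eq_2 by auto
      have admits2: "admits_fibres_of_dim n m s \<phi> 2 \<longleftrightarrow> P2"
        using H unfolding admits_fibres_iff numeral_2_eq_2 numeral_3_eq_3 by auto
      have precise: "fibres_of_dim_precisely_over n m s \<phi> 1 (s - 1)" "fibres_of_dim_precisely_over n m s \<phi> 2 (s - 2)"
        using s by (auto intro!: fibres_precisely)
      have immersion: "closed_immersion (s+1) (degeneracy_locus n m s \<phi>) n (psi n m s \<phi>) \<longleftrightarrow> \<not> P1"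
      proof
        assume closed: "closed_immersion (s+1) (degeneracy_locus n m s \<phi>) n (psi n m s \<phi>)"
        show "\<not> P1"
        proof
          assume "P1"
          then obtain \<alpha> where "nontrivial n \<alpha>" "?null 2 \<phi> \<alpha>" using H by blast
          then show False
            using not_closed_immersion_psi[OF line_in_proj_space] null_line closed by blast
        qed
      next
        assume "\<not> P1"
        then show "closed_immersion (s+1) (degeneracy_locus n m s \<phi>) n (psi n m s \<phi>)"
          by (intro closed_immersion_psi no2)
      qed
      have generic: "\<exists>U. openin (zariski n) U \<and> U \<noteq> {} \<and>
          (\<forall>l \<in> U. \<exists>p. {p' \<in> degeneracy_locus n m s \<phi>. psi n m s \<phi> p' = l} = {p})" if "s = n + m"
      proof (rule generic_fibre_point[OF that])
        define \<alpha> where "\<alpha> i = (if i < 1 then 1 else 0 :: complex)" for i :: nat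
        show "nontrivial n \<alpha>" using n by (auto simp: nontrivial_def \<alpha>_def)
        have "contract n \<phi> \<alpha> = contract 1 \<phi> (\<lambda>_. 1)"
          unfolding \<alpha>_def by (intro ext contract_extend) (use n in simp)
        moreover have "nontrivial 1 (\<lambda>_. 1)" by (simp add: nontrivial_def)
        ultimately show "\<not> ?null 2 \<phi> \<alpha>" using H by auto
      qed
      \<comment> \<open>This is where \<open>n \<ge> 3\<close> enters in the case \<open>s = n + m\<close>.\<close>
      have "P1" if "s = n + m" using that n by (simp add: P1_def)
      then show ?thesis
        using psi_surjective generic admits1 admits2 precise immersion image_composition
        unfolding P2 P1_def[symmetric] by (auto simp: P1_def not_le)
    qed
  qed
qed

end
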